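(* Let $G$ and its unitary representation $V=V_1\oplus V_2$ be one of the following: (1) $G=\mathrm{SU}(n)$, $n\geq 2$, $V=\Lambda_1\oplus\Lambda_1^*$ (i.e. $\mathbb C^n\oplus(\mathbb C^n)^*$); (2) $G=\mathrm{SU}(2n+1)$, $n\ge 2$, $V=\Lambda_2\oplus\Lambda_1$ (i.e. $\Lambda^2(\mathbb C^{2n+1})\oplus\mathbb C^{2n+1}$); (3) $G=\mathrm{Sp}(n)$, $n\ge 1$, $V=\Lambda_1\oplus\Lambda_1$ (i.e. $\mathbb C^{2n}\oplus\mathbb C^{2n}$); (4) $G=\mathrm{Spin}(10)$, $V=\Lambda_e\oplus\Lambda_e$ (i.e. $\mathbb C^{16}\oplus\mathbb C^{16}$). Let $k,s$ be distinct positive integers and let $\mathbb P(V)_{[k,s]}$ be the weighted projective space obtained as the symplectic reduction of $V$ by the $\mathrm T^1$-action $t(v,w)=(t^{-k}v,t^{-s}w)$, $v\in V_1$, $w\in V_2$. Then the induced Hamiltonian $G$-action on $\mathbb P(V)_{[k,s]}$ admits a Lagrangian orbit.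
   Context: Fundamental weights $\Lambda_i$ are identified with the corresponding irreducible representations: $\Lambda_1$ is the standard representation, $\Lambda_2$ its second exterior power, and $\Lambda_e$ is a 16-dimensional half-spin representation of $\mathrm{Spin}(10)$; $\mathrm{Sp}(n)$ is the compact symplectic group. $V$ carries a $G$-invariant Hermitian scalar product, making $V_1$ and $V_2$ orthogonal, and the associated standard symplectic form. The $\mathrm T^1$-action on $V$ is Hamiltonian with moment map $\psi(v,w)=\frac i2(k\|v\|^2+s\|w\|^2)$, and $\mathbb P(V)_{[k,s]}=\psi^{-1}(\frac i2)/\mathrm T^1$, a symplectic orbifold ($\mathrm T^1$ acts with finite stabilizers on the regular level set $\psi^{-1}(\frac i2)$), with reduced symplectic form pulling back to the restriction of the symplectic form of $V$ to $\psi^{-1}(\frac i2)$. $G$ commutes with $\mathrm T^1$ and acts on $\mathbb P(V)_{[k,s]}$ by $g[p]=[gp]$. An orbit is Lagrangian if its dimension is half the real dimension of $\mathbb P(V)_{[k,s]}$ and the reduced symplectic form vanishes on it. *)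

theory Defs
  imports "HOL-Analysis.Analysis"
begin

text \<open>
  All representation spaces are complex subspaces \<open>V1\<close>, \<open>V2\<close> of coordinate spaces
  \<open>complex ^ 'a\<close>, \<open>complex ^ 'b\<close>, and \<open>V1 \<oplus> V2\<close> is the set \<open>V1 \<times> V2\<close> of pairs.  A representation
  is the map sending a group element to the operator it induces.
\<close>

definition adj :: "complex ^ 'a::finite ^ 'a \<Rightarrow> complex ^ 'a ^ 'a" where
  "adj A = (\<chi> i j. cnj (A $ j $ i))"

definition SU :: "(complex ^ 'n::finite ^ 'n) set" where
  "SU = {A. adj A ** A = mat 1 \<and> det A = 1}"

definition sympl_J :: "complex ^ ('n::finite + 'n) ^ ('n + 'n)" where
  "sympl_J = (\<chi> a b. case (a, b) of
      (Inl i, Inr j) \<Rightarrow> if i = j then 1 else 0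
    | (Inr i, Inl j) \<Rightarrow> if i = j then - 1 else 0
    | _ \<Rightarrow> 0)"

text \<open>The compact group \<open>Sp(n) = U(2n) \<inter> Sp(2n, \<complex>)\<close>.\<close>

definition Sp :: "(complex ^ ('n::finite + 'n) ^ ('n + 'n)) set" where
  "Sp = {A. adj A ** A = mat 1 \<and> transpose A ** sympl_J ** A = sympl_J}"

definition std_rep :: "complex ^ 'a::finite ^ 'a \<Rightarrow> complex ^ 'a \<Rightarrow> complex ^ 'a" where
  "std_rep A v = A *v v"

text \<open>A functional is represented by its coefficient vector \<open>f\<close>; \<open>A\<close> sends it to
  \<open>f \<circ> A\<^sup>-\<^sup>1\<close>.\<close>

definition dual_rep :: "complex ^ 'a::finite ^ 'a \<Rightarrow> complex ^ 'a \<Rightarrow> complex ^ 'a" where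
  "dual_rep A f = transpose (matrix_inv A) *v f"

text \<open>The second exterior power is the space of alternating tensors in
  \<open>\<complex>\<^sup>m \<otimes> \<complex>\<^sup>m = complex ^ ('m \<times> 'm)\<close>, on which \<open>A\<close> acts by \<open>A \<otimes> A\<close>.\<close>

definition ext2 :: "(complex ^ ('m::finite \<times> 'm)) set" where
  "ext2 = {T. \<forall>i j. T $ (i, j) = - T $ (j, i)}"

definition ext2_rep :: "complex ^ 'm::finite ^ 'm \<Rightarrow> complex ^ ('m \<times> 'm) \<Rightarrow> complex ^ ('m \<times> 'm)" where
  "ext2_rep A T = (\<chi> p. \<Sum>a\<in>UNIV. \<Sum>b\<in>UNIV. A $ fst p $ a * A $ snd p $ b * T $ (a, b))"

text \<open>
  The spinor module of the Clifford algebra of \<open>\<real>\<^sup>1\<^sup>0 = \<complex>\<^sup>5\<close> is the exterior algebra of \<open>\<complex>\<^sup>5\<close>, with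
  basis \<open>e\<^sub>A\<close> indexed by the subsets \<open>A\<close> of the five-element type \<open>5\<close>.  The vector \<open>z\<close> acts by
  \<open>clifford z\<close> = (exterior product with \<open>z\<close>) - (its Hermitian adjoint), so that
  \<open>clifford z ** clifford z = - \<parallel>z\<parallel>\<^sup>2\<close>.
  The complexified Clifford algebra is the full algebra of \<open>32 \<times> 32\<close> matrices, so the Clifford
  algebra, and the group \<open>Spin(10)\<close> of products of an even number of unit vectors in it, is
  faithfully represented by these matrices.
\<close>

definition wedge_sign :: "5 \<Rightarrow> 5 set \<Rightarrow> complex" where
  "wedge_sign i A = (- 1) ^ card {j \<in> A. j < i}"

definition creation :: "5 \<Rightarrow> complex ^ (5 set) ^ (5 set)" where
  "creation i = (\<chi> B A. if i \<notin> A \<and> B = insert i A then wedge_sign i A else 0)"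

definition annihilation :: "5 \<Rightarrow> complex ^ (5 set) ^ (5 set)" where
  "annihilation i = (\<chi> B A. if i \<in> A \<and> B = A - {i} then wedge_sign i A else 0)"

definition clifford :: "complex ^ 5 \<Rightarrow> complex ^ (5 set) ^ (5 set)" where
  "clifford z = (\<chi> B A. \<Sum>i\<in>UNIV. z $ i * creation i $ B $ A - cnj (z $ i) * annihilation i $ B $ A)"

definition Spin10 :: "(complex ^ (5 set) ^ (5 set)) set" where
  "Spin10 = {foldr (\<lambda>z M. clifford z ** M) zs (mat 1) | zs.
     even (length zs) \<and> (\<forall>z \<in> set zs. norm z = 1)}"

text \<open>The two half-spin representations are the even part (\<open>half_spin True\<close>) and the odd part
  (\<open>half_spin False\<close>) of the spinor module, with \<open>Spin10\<close> acting by \<open>std_rep\<close>.\<close>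

definition half_spin :: "bool \<Rightarrow> (complex ^ (5 set)) set" where
  "half_spin par = {x. \<forall>A. x $ A \<noteq> 0 \<longrightarrow> even (card A) = par}"

definition dsum_rep :: "('g \<Rightarrow> 'v \<Rightarrow> 'v) \<Rightarrow> ('g \<Rightarrow> 'w \<Rightarrow> 'w) \<Rightarrow> 'g \<Rightarrow> 'v \<times> 'w \<Rightarrow> 'v \<times> 'w" where
  "dsum_rep \<rho> \<sigma> g = map_prod (\<rho> g) (\<sigma> g)"

type_synonym ('a, 'b) vsum = "(complex ^ 'a) \<times> (complex ^ 'b)"

definition cscale :: "complex \<Rightarrow> ('a::finite, 'b::finite) vsum \<Rightarrow> ('a, 'b) vsum" where
  "cscale c x = (c *s fst x, c *s snd x)"

text \<open>Hermitian products are complex linear in the first argument.  Only their values on \<open>V\<close>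
  matter.\<close>

definition hermitian_product ::
    "('a::finite, 'b::finite) vsum set \<Rightarrow> (('a, 'b) vsum \<Rightarrow> ('a, 'b) vsum \<Rightarrow> complex) \<Rightarrow> bool" where
  "hermitian_product V h \<longleftrightarrow>
     (\<forall>x\<in>V. \<forall>y\<in>V. \<forall>z\<in>V. h (x + y) z = h x z + h y z) \<and>
     (\<forall>x\<in>V. \<forall>y\<in>V. \<forall>c. h (cscale c x) y = c * h x y) \<and>
     (\<forall>x\<in>V. \<forall>y\<in>V. h y x = cnj (h x y)) \<and>
     (\<forall>x\<in>V. x \<noteq> 0 \<longrightarrow> Re (h x x) > 0)"

definition invariant_product ::
    "'g set \<Rightarrow> ('g \<Rightarrow> ('a::finite, 'b::finite) vsum \<Rightarrow> ('a, 'b) vsum) \<Rightarrow>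
     (complex ^ 'a) set \<Rightarrow> (complex ^ 'b) set \<Rightarrow>
     (('a, 'b) vsum \<Rightarrow> ('a, 'b) vsum \<Rightarrow> complex) \<Rightarrow> bool" where
  "invariant_product G \<rho> V1 V2 h \<longleftrightarrow>
     hermitian_product (V1 \<times> V2) h \<and>
     (\<forall>g\<in>G. \<forall>x \<in> V1 \<times> V2. \<forall>y \<in> V1 \<times> V2. h (\<rho> g x) (\<rho> g y) = h x y) \<and>
     (\<forall>v\<in>V1. \<forall>w\<in>V2. h (v, 0) (0, w) = 0)"

text \<open>The standard symplectic form \<open>\<omega>(x, y) = Re h(\<i>x, y)\<close>.\<close>

definition sympl :: "(('a::finite, 'b::finite) vsum \<Rightarrow> ('a, 'b) vsum \<Rightarrow> complex) \<Rightarrow>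
    ('a, 'b) vsum \<Rightarrow> ('a, 'b) vsum \<Rightarrow> real" where
  "sympl h x y = - Im (h x y)"

definition circle_act :: "nat \<Rightarrow> nat \<Rightarrow> complex \<Rightarrow> ('a::finite, 'b::finite) vsum \<Rightarrow> ('a, 'b) vsum" where
  "circle_act k s t x = (t powi (- int k) *s fst x, t powi (- int s) *s snd x)"

definition moment :: "(('a::finite, 'b::finite) vsum \<Rightarrow> ('a, 'b) vsum \<Rightarrow> complex) \<Rightarrow> nat \<Rightarrow> nat \<Rightarrow>
    ('a, 'b) vsum \<Rightarrow> complex" where
  "moment h k s x = \<i> / 2 * (of_nat k * h (fst x, 0) (fst x, 0) + of_nat s * h (0, snd x) (0, snd x))"

definition level_set :: "(complex ^ 'a) set \<Rightarrow> (complex ^ 'b) set \<Rightarrow>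
    (('a::finite, 'b::finite) vsum \<Rightarrow> ('a, 'b) vsum \<Rightarrow> complex) \<Rightarrow> nat \<Rightarrow> nat \<Rightarrow> ('a, 'b) vsum set" where
  "level_set V1 V2 h k s = {x \<in> V1 \<times> V2. moment h k s x = \<i> / 2}"

text \<open>Points of the quotient are the circle orbits themselves, so the preimage of a subset \<open>L\<close> of
  the quotient under the quotient map is \<open>\<Union>L\<close>.\<close>

definition circle_class :: "nat \<Rightarrow> nat \<Rightarrow> ('a::finite, 'b::finite) vsum \<Rightarrow> ('a, 'b) vsum set" where
  "circle_class k s x = {circle_act k s t x | t. norm t = 1}"

definition wproj :: "(complex ^ 'a) set \<Rightarrow> (complex ^ 'b) set \<Rightarrow>
    (('a::finite, 'b::finite) vsum \<Rightarrow> ('a, 'b) vsum \<Rightarrow> complex) \<Rightarrow> nat \<Rightarrow> nat \<Rightarrow> ('a, 'b) vsum set set" where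
  "wproj V1 V2 h k s = circle_class k s ` level_set V1 V2 h k s"

text \<open>The orbit of \<open>[p]\<close> under the induced action \<open>g[p] = [gp]\<close>.\<close>

definition induced_orbit :: "'g set \<Rightarrow> ('g \<Rightarrow> ('a::finite, 'b::finite) vsum \<Rightarrow> ('a, 'b) vsum) \<Rightarrow> nat \<Rightarrow> nat \<Rightarrow>
    ('a, 'b) vsum \<Rightarrow> ('a, 'b) vsum set set" where
  "induced_orbit G \<rho> k s p = {circle_class k s (\<rho> g p) | g. g \<in> G}"

text \<open>Velocities at \<open>p\<close> of curves lying in \<open>S\<close>.  If \<open>S\<close> is an embedded submanifold, as are level
  sets and group orbits below, this is its tangent space.\<close>

definition tangent :: "'v::real_normed_vector set \<Rightarrow> 'v \<Rightarrow> 'v set" where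
  "tangent S p = {u. \<exists>\<gamma>::real \<Rightarrow> 'v. \<gamma> 0 = p \<and> (\<forall>r. \<gamma> r \<in> S) \<and> (\<gamma> has_vector_derivative u) (at 0)}"

text \<open>
  In an orbifold chart at \<open>[p]\<close> (a slice to the circle orbit), the tangent space of a subset
  \<open>L\<close> of the quotient is the quotient of the tangent space of its preimage \<open>\<Union>L\<close> by that of the
  circle orbit.  Tangent vectors at \<open>[p]\<close> are therefore cosets.
\<close>

definition tangent_class :: "nat \<Rightarrow> nat \<Rightarrow> ('a::finite, 'b::finite) vsum \<Rightarrow> ('a, 'b) vsum \<Rightarrow>
    ('a, 'b) vsum set" where
  "tangent_class k s p u = {u + x | x. x \<in> tangent (circle_class k s p) p}"

definition quot_tangent :: "nat \<Rightarrow> nat \<Rightarrow> ('a::finite, 'b::finite) vsum set set \<Rightarrow> ('a, 'b) vsum \<Rightarrow>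
    ('a, 'b) vsum set set" where
  "quot_tangent k s L p = tangent_class k s p ` tangent (\<Union>L) p"

definition quot_dim :: "nat \<Rightarrow> nat \<Rightarrow> ('a::finite, 'b::finite) vsum set set \<Rightarrow> ('a, 'b) vsum \<Rightarrow> nat" where
  "quot_dim k s L p = dim (tangent (\<Union>L) p) - dim (tangent (circle_class k s p) p)"

text \<open>The value of the reduced form on two cosets is the common value of the symplectic form on
  their representatives.\<close>

definition reduced_form :: "(('a::finite, 'b::finite) vsum \<Rightarrow> ('a, 'b) vsum \<Rightarrow> complex) \<Rightarrow>
    ('a, 'b) vsum set \<Rightarrow> ('a, 'b) vsum set \<Rightarrow> real" where
  "reduced_form h U W = (THE c. \<forall>u\<in>U. \<forall>w\<in>W. sympl h u w = c)"

definition lagrangian :: "(complex ^ 'a) set \<Rightarrow> (complex ^ 'b) set \<Rightarrow>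
    (('a::finite, 'b::finite) vsum \<Rightarrow> ('a, 'b) vsum \<Rightarrow> complex) \<Rightarrow> nat \<Rightarrow> nat \<Rightarrow>
    ('a, 'b) vsum set set \<Rightarrow> bool" where
  "lagrangian V1 V2 h k s L \<longleftrightarrow>
     L \<subseteq> wproj V1 V2 h k s \<and>
     (\<forall>p \<in> \<Union>L.
        2 * quot_dim k s L p = quot_dim k s (wproj V1 V2 h k s) p \<and>
        (\<forall>U \<in> quot_tangent k s L p. \<forall>W \<in> quot_tangent k s L p. reduced_form h U W = 0))"

definition admits_lagrangian_orbit ::
    "'g set \<Rightarrow> ('g \<Rightarrow> ('a::finite, 'b::finite) vsum \<Rightarrow> ('a, 'b) vsum) \<Rightarrow>
     (complex ^ 'a) set \<Rightarrow> (complex ^ 'b) set \<Rightarrow>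
     (('a, 'b) vsum \<Rightarrow> ('a, 'b) vsum \<Rightarrow> complex) \<Rightarrow> nat \<Rightarrow> nat \<Rightarrow> bool" where
  "admits_lagrangian_orbit G \<rho> V1 V2 h k s \<longleftrightarrow>
     (\<exists>p \<in> level_set V1 V2 h k s. lagrangian V1 V2 h k s (induced_orbit G \<rho> k s p))"

end

theory Submission
  imports Defs
begin

text \<open>
  If the moment map of \<open>G\<close> vanishes on the orbit \<open>G p\<close> in the level set, then every velocity of a curve in
  \<open>T\<^sup>1 G p\<close> is symplectically orthogonal to the real span \<open>W\<close> of the infinitesimal orbits of \<open>G\<close> and \<open>T\<^sup>1\<close>
  at \<open>p\<close>: differentiate the moment maps of \<open>G\<close> and \<open>T\<^sup>1\<close>, which are constant there.  So \<open>W\<close> is isotropic,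
  and if moreover \<open>W\<close> spans \<open>V\<close> over the complex numbers, then \<open>V = W \<oplus> \<i> W\<close>, \<open>W\<close> is Lagrangian in \<open>V\<close>
  and is the whole tangent space; dividing by the circle direction gives a Lagrangian orbit.

  The base points are \<open>(a e, b e)\<close> and \<open>(a e, b j e)\<close> for \<open>SU(n)\<close> and \<open>Sp(n)\<close>, \<open>j\<close> the quaternionic structure;
  \<open>(a \<Omega>, b e\<^sub>o)\<close> for \<open>SU(2n+1)\<close>, where \<open>\<Omega>\<close> is a symplectic form on the complement of \<open>e\<^sub>o\<close>; and for \<open>Spin(10)\<close>
  the pair \<open>(a (e\<^sub>A + e\<^sub>A\<^sub>'), b (e\<^sub>B + e\<^sub>B\<^sub>'))\<close> with stabilizer \<open>G\<^sub>2\<close>, where \<open>A, A', B, B'\<close> are pairwise at even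
  distance and the primed set differs from the unprimed one in the indices \<open>0, 1, 2, 3\<close>.  The scalars are
  chosen so that the two contributions to the moment map of \<open>G\<close> cancel.
\<close>

text \<open>\<open>tangent\<close> admits the velocities of arbitrary curves in the preimage of the
  orbit, and such a curve comes with no differentiable lift to \<open>G\<close>. Differentiating the
  action therefore bounds tangent spaces only from below; the upper bound has to come from functions
  on V, and the moment maps are such functions. The spanning condition says that the
  complexification of \<open>G\<close> times the circle has an open orbit at \<open>p\<close>. It is
  linear algebra in the complexified Lie algebra, where elementary matrices exist although no curve
  in \<open>G\<close> has them as velocity. In every case the complexified Lie algebra of
  \<open>G\<close> yields V up to one missing direction: at p = (v, w) its Cartan part gives (v, - m
  w) with some m > 0, the circle gives (k v, s w), and the two are independent because k m + s > 0.
  Since the invariant product is arbitrary, Schur's lemma must be made explicit to reduce it to two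
  positive constants; these are absorbed into \<open>a\<close> and \<open>b\<close>, whose ratio is
  dictated by the moment map of \<open>G\<close> and whose size is dictated by the level.\<close>

section \<open>Hermitian pairings on coordinate spaces and on their direct sum\<close>

definition cip :: "complex ^ 'a::finite \<Rightarrow> complex ^ 'a \<Rightarrow> complex" where
  "cip x y = (\<Sum>i\<in>UNIV. x $ i * cnj (y $ i))"

lemma cip_add_left: "cip (x + y) z = cip x z + cip y z"
  and cip_add_right: "cip z (x + y) = cip z x + cip z y"
  and cip_diff_left: "cip (x - y) z = cip x z - cip y z"
  and cip_diff_right: "cip z (x - y) = cip z x - cip z y"
  and cip_minus_left: "cip (- x) z = - cip x z"
  and cip_minus_right: "cip z (- x) = - cip z x"
  and cip_smult_left: "cip (c *s x) z = c * cip x z"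
  and cip_smult_right: "cip z (c *s x) = cnj c * cip z x"
  and cip_zero_left: "cip 0 z = 0"
  and cip_zero_right: "cip z 0 = 0"
  by (simp_all add: cip_def algebra_simps sum.distrib sum_subtractf sum_negf sum_distrib_left)

lemmas cip_simps = cip_add_left cip_add_right cip_diff_left cip_diff_right cip_minus_left
  cip_minus_right cip_smult_left cip_smult_right cip_zero_left cip_zero_right

lemma cnj_cip: "cnj (cip x y) = cip y x"
  by (simp add: cip_def mult.commute)

lemma scaleR_eq_smult: "r *\<^sub>R (x :: complex ^ 'a) = complex_of_real r *s x"
  by (simp add: vec_eq_iff scaleR_conv_of_real [where 'a = complex])

lemma Re_cip: "Re (cip x y) = x \<bullet> y"
  by (simp add: cip_def inner_vec_def inner_complex_def)

lemma cip_self: "cip x x = complex_of_real ((norm x)\<^sup>2)"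
proof (rule complex_eqI)
  have "cnj (cip x x) = cip x x" by (rule cnj_cip)
  then show "Im (cip x x) = Im (complex_of_real ((norm x)\<^sup>2))"
    by (simp add: complex_eq_iff)
qed (simp add: Re_cip power2_norm_eq_inner)

lemma bounded_bilinear_cip: "bounded_bilinear cip"
  unfolding bilinear_conv_bounded_bilinear [symmetric] bilinear_def
  by (auto intro!: linearI simp: cip_simps scaleR_eq_smult scaleR_conv_of_real [where 'a = complex])

lemma cip_adj: "cip (A *v x) y = cip x (adj A *v y)"
proof -
  have "cip (A *v x) y = (\<Sum>i\<in>UNIV. \<Sum>j\<in>UNIV. A $ i $ j * x $ j * cnj (y $ i))"
    by (simp add: cip_def matrix_vector_mult_def sum_distrib_right)
  also have "\<dots> = (\<Sum>j\<in>UNIV. \<Sum>i\<in>UNIV. A $ i $ j * x $ j * cnj (y $ i))"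
    by (rule sum.swap)
  also have "\<dots> = cip x (adj A *v y)"
    by (simp add: cip_def matrix_vector_mult_def adj_def sum_distrib_left ac_simps)
  finally show ?thesis .
qed

text \<open>By Schur's lemma every invariant product agrees on V with one of these. Isomorphic
  summands do no harm, because their orthogonality is part of
  \<open>invariant_product\<close>.\<close>

definition hp :: "real \<Rightarrow> real \<Rightarrow> ('a::finite, 'b::finite) vsum \<Rightarrow> ('a, 'b) vsum \<Rightarrow> complex" where
  "hp c1 c2 x y = complex_of_real c1 * cip (fst x) (fst y) + complex_of_real c2 * cip (snd x) (snd y)"

lemma hp_add_left: "hp c1 c2 (x + y) z = hp c1 c2 x z + hp c1 c2 y z"
  and hp_add_right: "hp c1 c2 z (x + y) = hp c1 c2 z x + hp c1 c2 z y"
  and hp_cscale_left: "hp c1 c2 (cscale c x) z = c * hp c1 c2 x z"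
  and hp_cscale_right: "hp c1 c2 z (cscale c x) = cnj c * hp c1 c2 z x"
  and hp_scaleR_left: "hp c1 c2 (r *\<^sub>R x) z = of_real r * hp c1 c2 x z"
  and hp_scaleR_right: "hp c1 c2 z (r *\<^sub>R x) = of_real r * hp c1 c2 z x"
  and hp_zero_left: "hp c1 c2 0 z = 0"
  and hp_zero_right: "hp c1 c2 z 0 = 0"
  by (simp_all add: hp_def cip_simps cscale_def algebra_simps scaleR_eq_smult)

lemma cnj_hp: "cnj (hp c1 c2 x y) = hp c1 c2 y x"
  by (simp add: hp_def cnj_cip)

lemma bounded_bilinear_hp:
  "bounded_bilinear (hp c1 c2 :: ('a::finite, 'b::finite) vsum \<Rightarrow> _)"
  unfolding bilinear_conv_bounded_bilinear [symmetric] bilinear_def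
  by (auto intro!: linearI simp: hp_def cip_simps algebra_simps scaleR_eq_smult
      scaleR_conv_of_real [where 'a = complex])

lemma hp_self_zero:
  assumes "0 < c1" "0 < c2" "Re (hp c1 c2 x x) = 0"
  shows "x = 0"
proof -
  have "c1 * (norm (fst x))\<^sup>2 + c2 * (norm (snd x))\<^sup>2 = 0"
    using assms(3) by (simp add: hp_def cip_self)
  moreover have "0 \<le> c1 * (norm (fst x))\<^sup>2" "0 \<le> c2 * (norm (snd x))\<^sup>2" using assms by auto
  ultimately have "c1 * (norm (fst x))\<^sup>2 = 0" "c2 * (norm (snd x))\<^sup>2 = 0" by linarith+
  with assms show ?thesis by (simp add: prod_eq_iff)
qed

text \<open>The velocity at r = 0 of \<open>circle_act k s (cis r) x\<close>; the signs come from
  the weights -k and -s.\<close>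

definition circ_vel :: "nat \<Rightarrow> nat \<Rightarrow> ('a::finite, 'b::finite) vsum \<Rightarrow> ('a, 'b) vsum" where
  "circ_vel k s x = ((- (\<i> * of_nat k)) *s fst x, (- (\<i> * of_nat s)) *s snd x)"

text \<open>Complex subspaces of V. Pairs are not of a type \<open>complex ^ _\<close>, so
  \<open>vec.subspace\<close> does not apply to them.\<close>

definition csub :: "('a::finite, 'b::finite) vsum set \<Rightarrow> bool" where
  "csub C \<longleftrightarrow> 0 \<in> C \<and> (\<forall>x\<in>C. \<forall>y\<in>C. x + y \<in> C) \<and> (\<forall>c. \<forall>x\<in>C. cscale c x \<in> C)"

lemma csubD:
  assumes "csub C"
  shows "0 \<in> C" "x \<in> C \<Longrightarrow> y \<in> C \<Longrightarrow> x + y \<in> C" "x \<in> C \<Longrightarrow> cscale c x \<in> C"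
    "x \<in> C \<Longrightarrow> y \<in> C \<Longrightarrow> x - y \<in> C"
proof -
  show *: "0 \<in> C" "x \<in> C \<Longrightarrow> y \<in> C \<Longrightarrow> x + y \<in> C" "x \<in> C \<Longrightarrow> cscale c x \<in> C" for x y c
    using assms by (auto simp: csub_def)
  assume "x \<in> C" "y \<in> C"
  then have "x + cscale (- 1) y \<in> C" by (intro *)
  moreover have "x + cscale (- 1) y = x - y" by (simp add: cscale_def prod_eq_iff vec_eq_iff)
  ultimately show "x - y \<in> C" by simp
qed

lemma csub_span:
  assumes C: "csub C" and B: "\<And>b. b \<in> B \<Longrightarrow> f b \<in> C"
    and f: "f 0 = 0" "\<And>x y. f (x + y) = f x + f y" "\<And>c x. f (c *s x) = cscale c (f x)"
    and x: "x \<in> vec.span B"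
  shows "f x \<in> C"
  using x
proof (induction rule: vec.span_induct_alt)
  case (step c x y)
  have "cscale c (f x) + f y \<in> C" using step B by (intro csubD[OF C]) auto
  then show ?case by (simp add: f)
qed (simp add: f csubD[OF C])

lemma csub_Times:
  assumes C: "csub C"
    and 1: "\<And>x. x \<in> B1 \<Longrightarrow> (x, 0) \<in> C" and 2: "\<And>x. x \<in> B2 \<Longrightarrow> (0, x) \<in> C"
  shows "vec.span B1 \<times> vec.span B2 \<subseteq> C"
proof (clarify)
  fix x y assume x: "x \<in> vec.span B1" and y: "y \<in> vec.span B2"
  have "(x, 0) \<in> C"
    by (rule csub_span[OF C, where f = "\<lambda>x. (x, 0)", OF 1 _ _ _ x]) (simp_all add: cscale_def zero_prod_def)
  moreover have "(0, y) \<in> C"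
    by (rule csub_span[OF C, where f = "\<lambda>x. (0, x)", OF 2 _ _ _ y]) (simp_all add: cscale_def zero_prod_def)
  ultimately have "(x, 0) + (0, y) \<in> C" by (rule csubD(2)[OF C])
  then show "(x, y) \<in> C" by simp
qed

section \<open>The circle action and velocities of curves\<close>

lemma norm_powi: "norm (t powi n) = 1" if "norm t = 1" for t :: complex
  using that by (simp add: norm_power_int)

lemma hp_circle_act:
  assumes "norm t = 1"
  shows "hp c1 c2 (circle_act k s t x) (circle_act k s t y) = hp c1 c2 x y"
proof -
  have "cnj t * t = 1"
    using assms complex_norm_square[of t] by (simp add: mult.commute)
  then have *: "cnj t powi n * (t powi n * c) = c" for n c
    by (simp add: mult.assoc [symmetric] power_int_mult_distrib [symmetric])
  show ?thesis
    by (simp add: hp_def circle_act_def cip_simps *)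
qed

lemma circle_act_circle_act:
  assumes "t \<noteq> 0" "u \<noteq> 0"
  shows "circle_act k s t (circle_act k s u x) = circle_act k s (t * u) x"
  by (simp add: circle_act_def vector_smult_assoc power_int_mult_distrib)

lemma circle_act_1: "circle_act k s 1 x = x"
  by (simp add: circle_act_def)

lemma linear_circle_act: "linear (circle_act k s t)"
  by (rule linearI) (simp_all add: circle_act_def vector_add_ldistrib vec_eq_iff algebra_simps)

lemma tangent_image:
  assumes "bounded_linear L" "L ` S \<subseteq> S'" "u \<in> tangent S q"
  shows "L u \<in> tangent S' (L q)"
proof -
  obtain g where "g 0 = q" "\<forall>r. g r \<in> S" "(g has_vector_derivative u) (at 0)"
    using assms(3) by (auto simp: tangent_def)
  then show ?thesis
    using assms unfolding tangent_def
    by (intro CollectI exI[of _ "L \<circ> g"]) (auto simp: o_def intro: bounded_linear.has_vector_derivative)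
qed

lemma tangent_mono: "S \<subseteq> T \<Longrightarrow> tangent S q \<subseteq> tangent T q"
  unfolding tangent_def by blast

text \<open>The inner product of the curve with a vector orthogonal to \<open>V\<close> is
  constantly zero, so its velocity is orthogonal to the orthogonal complement of
  \<open>V\<close>.\<close>

lemma tangent_subspace:
  fixes V :: "'a::euclidean_space set"
  assumes "subspace V" "S \<subseteq> V"
  shows "tangent S q \<subseteq> V"
proof
  fix u assume "u \<in> tangent S q"
  then obtain g where g: "g 0 = q" "\<forall>r. g r \<in> S" "(g has_vector_derivative u) (at 0)"
    by (auto simp: tangent_def)
  have "u \<bullet> z = 0" if "z \<in> orthogonal_comp V" for z
  proof -
    have "((\<lambda>r. g r \<bullet> z) has_vector_derivative u \<bullet> z) (at 0)"
      by (rule bounded_linear.has_vector_derivative[OF bounded_linear_inner_left g(3)])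
    moreover have "(\<lambda>r. g r \<bullet> z) = (\<lambda>r. 0)"
      using that g(2) assms(2) by (auto simp: orthogonal_comp_def orthogonal_def)
    ultimately show ?thesis
      using vector_derivative_unique_at has_vector_derivative_const by metis
  qed
  then have "u \<in> orthogonal_comp (orthogonal_comp V)"
    by (auto simp: orthogonal_comp_def orthogonal_def inner_commute)
  then show "u \<in> V" using assms(1) by (simp add: orthogonal_comp_self)
qed

section \<open>Lagrangian orbits from isotropic orbits\<close>

lemma cip_norm: "cip x x = cip y y \<Longrightarrow> norm x = norm (y :: complex ^ 'c::finite)"
  unfolding cip_self of_real_eq_iff by simp

lemma norm_smult: "norm (c *s (x :: complex ^ 'c::finite)) = norm c * norm x"
proof -
  have "cip (c *s x) (c *s x) = c * cnj c * cip x x" by (simp add: cip_simps)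
  then have "(norm (c *s x))\<^sup>2 = (norm c * norm x)\<^sup>2"
    unfolding cip_self by (metis complex_norm_square of_real_eq_iff of_real_mult power_mult_distrib)
  then show ?thesis by (simp add: power2_eq_iff_nonneg)
qed

lemma has_vector_derivative_cis_powi:
  "((\<lambda>r. cis (\<theta> * r) powi (- int n) *s (y :: complex ^ 'c::finite)) has_vector_derivative
      \<theta> *\<^sub>R ((- (\<i> * of_nat n)) *s y)) (at 0)"
  proof -
    have eq: "cis (\<theta> * r) powi (- int n) = cis ((- real n * \<theta>) * r)" for r
      by (simp add: cis_power_int algebra_simps)
    have "((\<lambda>r. cis ((- real n * \<theta>) * r)) has_vector_derivative (- real n * \<theta>) *\<^sub>R \<i>) (at 0)"
      using has_derivative_cis[of "\<lambda>r. (- real n * \<theta>) * r" "\<lambda>r. (- real n * \<theta>) * r" 0 UNIV]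
      by (auto simp: has_vector_derivative_def scaleR_conv_of_real[where 'a = complex] mult_ac
        intro!: derivative_eq_intros)
    then have "((\<lambda>r. cis ((- real n * \<theta>) * r) *s y) has_vector_derivative
      ((- real n * \<theta>) *\<^sub>R \<i>) *s y) (at 0)"
      by (rule bounded_linear.has_vector_derivative[rotated])
        (auto intro!: linear_conv_bounded_linear[THEN iffD1] linearI
          simp: vec_eq_iff algebra_simps scaleR_conv_of_real[where 'a = complex])
    then show ?thesis unfolding eq
      by (simp add: scaleR_eq_smult vector_smult_assoc scaleR_conv_of_real[where 'a = complex] mult_ac)
  qed

text \<open>Group elements and infinitesimal generators both enter in this form, so linearity and
  commutation with the circle are shown once for both.\<close>

definition act2 :: "complex ^ 'a::finite ^ 'a \<Rightarrow> complex ^ 'b::finite ^ 'b \<Rightarrow> ('a, 'b) vsum \<Rightarrow> ('a, 'b) vsum" where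
  "act2 A B x = (A *v fst x, B *v snd x)"

lemma linear_act2: "linear (act2 A B)"
  by (rule linearI) (simp_all add: act2_def vec.add vec.scale scaleR_eq_smult)

lemma circle_act2: "circle_act k s t (act2 A B x) = act2 A B (circle_act k s t x)"
  by (simp add: circle_act_def act2_def vec.scale)

lemma bounded_linear_mult_vec: "bounded_linear (\<lambda>A. A *v (x :: complex ^ 'a::finite) :: complex ^ 'b::finite)"
  by (auto intro!: linear_conv_bounded_linear[THEN iffD1] linearI
      simp: matrix_vector_mult_def vec_eq_iff scaleR_sum_right distrib_right sum.distrib)

lemma cip_unitary: "adj A ** A = mat 1 \<Longrightarrow> cip (A *v x) (A *v y) = cip x y"
  by (simp add: cip_adj matrix_vector_mul_assoc)

text \<open>\<open>\<rho>1\<close> and \<open>\<rho>2\<close> are matrix representations only on \<open>G\<close>: \<open>dual_rep\<close> has junk values at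
  singular matrices.\<close>

locale isotropic_orbit =
  fixes G :: "(complex ^ 'd::finite ^ 'd) set"
    and \<rho>1 :: "complex ^ 'd ^ 'd \<Rightarrow> complex ^ 'a::finite \<Rightarrow> complex ^ 'a"
    and \<rho>2 :: "complex ^ 'd ^ 'd \<Rightarrow> complex ^ 'b::finite \<Rightarrow> complex ^ 'b"
    and R1 R2 V1 V2 and h :: "('a, 'b) vsum \<Rightarrow> ('a, 'b) vsum \<Rightarrow> complex"
    and c1 c2 :: real and k s :: nat and S and p :: "('a, 'b) vsum"
  assumes c_pos: "0 < c1" "0 < c2" and ks_pos: "0 < k" "0 < s"
    and subspace_V: "vec.subspace V1" "vec.subspace V2"
    and h_eq: "\<And>x y. x \<in> V1 \<times> V2 \<Longrightarrow> y \<in> V1 \<times> V2 \<Longrightarrow> h x y = hp c1 c2 x y"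
    and G_one: "mat 1 \<in> G"
    and G_mult: "\<And>g g'. g \<in> G \<Longrightarrow> g' \<in> G \<Longrightarrow> g ** g' \<in> G"
    and G_inv: "\<And>g. g \<in> G \<Longrightarrow> \<exists>g'\<in>G. g' ** g = mat 1"
    and rep_eq: "\<And>g. g \<in> G \<Longrightarrow> \<rho>1 g = (*v) (R1 g)" "\<And>g. g \<in> G \<Longrightarrow> \<rho>2 g = (*v) (R2 g)"
    and R_one: "R1 (mat 1) = mat 1" "R2 (mat 1) = mat 1"
    and R_mult: "\<And>A B. R1 (A ** B) = R1 A ** R1 B" "\<And>A B. R2 (A ** B) = R2 A ** R2 B"
    and R_unitary: "\<And>g. g \<in> G \<Longrightarrow> adj (R1 g) ** R1 g = mat 1" "\<And>g. g \<in> G \<Longrightarrow> adj (R2 g) ** R2 g = mat 1"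
    and R_stable: "\<And>g x. g \<in> G \<Longrightarrow> x \<in> V1 \<Longrightarrow> R1 g *v x \<in> V1" "\<And>g x. g \<in> G \<Longrightarrow> x \<in> V2 \<Longrightarrow> R2 g *v x \<in> V2"
    and S_curve: "\<And>X1 X2. (X1, X2) \<in> S \<Longrightarrow> \<exists>\<gamma>::real \<Rightarrow> _. (\<forall>r. \<gamma> r \<in> G) \<and> \<gamma> 0 = mat 1 \<and>
      ((\<lambda>r. R1 (\<gamma> r)) has_vector_derivative X1) (at 0) \<and> ((\<lambda>r. R2 (\<gamma> r)) has_vector_derivative X2) (at 0)"
    and moment_zero: "\<And>X1 X2 g. (X1, X2) \<in> S \<Longrightarrow> g \<in> G \<Longrightarrow>
      hp c1 c2 (act2 X1 X2 (act2 (R1 g) (R2 g) p)) (act2 (R1 g) (R2 g) p) = 0"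
    and p_in: "p \<in> V1 \<times> V2" and p_nz: "fst p \<noteq> 0" "snd p \<noteq> 0"
    and p_level: "of_nat k * (c1 * (norm (fst p))\<^sup>2) + of_nat s * (c2 * (norm (snd p))\<^sup>2) = 1"
    and spanning: "\<And>C. csub C \<Longrightarrow> circ_vel k s p \<in> C \<Longrightarrow>
      (\<And>X1 X2. (X1, X2) \<in> S \<Longrightarrow> act2 X1 X2 p \<in> C) \<Longrightarrow> V1 \<times> V2 \<subseteq> C"
begin

abbreviation "\<rho> \<equiv> dsum_rep \<rho>1 \<rho>2"
abbreviation "V \<equiv> V1 \<times> V2"
abbreviation "H \<equiv> hp c1 c2"

lemma rep_act2: "g \<in> G \<Longrightarrow> \<rho> g x = act2 (R1 g) (R2 g) x"
  by (cases x) (simp add: dsum_rep_def act2_def rep_eq)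

lemma rep_circle: "g \<in> G \<Longrightarrow> circle_act k s t (\<rho> g x) = \<rho> g (circle_act k s t x)"
  by (simp add: rep_act2 circle_act2)

lemma H_rep: "g \<in> G \<Longrightarrow> H (\<rho> g x) (\<rho> g y) = H x y"
  by (simp add: hp_def rep_act2 act2_def cip_unitary R_unitary)

lemma rep_V: "g \<in> G \<Longrightarrow> x \<in> V \<Longrightarrow> \<rho> g x \<in> V"
  by (auto simp: rep_act2 act2_def R_stable)

lemma rep_mult: "g \<in> G \<Longrightarrow> g' \<in> G \<Longrightarrow> \<rho> g (\<rho> g' x) = \<rho> (g ** g') x"
  by (simp add: rep_act2 G_mult act2_def R_mult matrix_vector_mul_assoc)

lemma rep_one: "\<rho> (mat 1) x = x"
  by (simp add: rep_act2 G_one act2_def R_one)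

lemma circle_V: "x \<in> V \<Longrightarrow> circle_act k s t x \<in> V"
  by (auto simp: circle_act_def intro: vec.subspace_scale subspace_V)

lemma csub_V: "csub V"
  using subspace_V by (auto simp: csub_def cscale_def zero_prod_def vec.subspace_def)

lemma csub_subspace: "csub C \<Longrightarrow> subspace C"
proof (rule subspaceI)
  fix c :: real and x assume "csub C" "x \<in> C"
  then have "cscale (of_real c) x \<in> C" by (rule csubD)
  moreover have "cscale (of_real c) x = c *\<^sub>R x"
    by (simp add: cscale_def prod_eq_iff scaleR_eq_smult)
  ultimately show "c *\<^sub>R x \<in> C" by simp
qed (auto dest: csubD)

lemma subspace_V_real: "subspace V"
  by (rule csub_subspace[OF csub_V])

lemma sympl_H: "x \<in> V \<Longrightarrow> y \<in> V \<Longrightarrow> sympl h x y = - Im (H x y)"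
  by (simp add: sympl_def h_eq)

section \<open>The level set of the circle moment map and its tangent spaces\<close>

text \<open>On V, \<open>moment\<close> is \<i> / 2 times this real quadratic form;
  \<open>polar\<close> is its polarization, and the level set is its unit sphere.\<close>

definition level :: "('a, 'b) vsum \<Rightarrow> real" where
  "level x = of_nat k * c1 * (norm (fst x))\<^sup>2 + of_nat s * c2 * (norm (snd x))\<^sup>2"

definition polar :: "('a, 'b) vsum \<Rightarrow> ('a, 'b) vsum \<Rightarrow> real" where
  "polar x y = of_nat k * c1 * (fst x \<bullet> fst y) + of_nat s * c2 * (snd x \<bullet> snd y)"

lemma polar_self: "polar x x = level x"
  by (simp add: polar_def level_def power2_norm_eq_inner)

lemma polar_simps:
  "polar (x + y) z = polar x z + polar y z" "polar z (x + y) = polar z x + polar z y"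
  "polar (c *\<^sub>R x) z = c * polar x z" "polar z (c *\<^sub>R x) = c * polar z x" "polar x y = polar y x"
  "polar (x - y) z = polar x z - polar y z" "polar 0 x = 0"
  by (auto simp: polar_def algebra_simps inner_commute)

lemma bounded_bilinear_polar: "bounded_bilinear polar"
  unfolding bilinear_conv_bounded_bilinear [symmetric] bilinear_def
  by (auto intro!: linearI simp: polar_def algebra_simps)

lemma level_set_eq: "level_set V1 V2 h k s = {x \<in> V. level x = 1}"
proof -
  have "moment h k s x = \<i> / 2 * of_real (level x)" if "x \<in> V" for x
  proof -
    have "(fst x, 0) \<in> V" "(0, snd x) \<in> V"
      using that subspace_V by (auto simp: vec.subspace_0)
    then show ?thesis by (simp add: moment_def h_eq hp_def cip_self cip_zero_left level_def)
  qed
  then show ?thesis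
    by (auto simp: level_set_def complex_eq_iff)
qed

lemma norm_rep:
  "g \<in> G \<Longrightarrow> norm (fst (\<rho> g x)) = norm (fst x)" "g \<in> G \<Longrightarrow> norm (snd (\<rho> g x)) = norm (snd x)"
  by (auto intro!: cip_norm simp: rep_act2 act2_def cip_unitary R_unitary)

lemma level_rep: "g \<in> G \<Longrightarrow> level (\<rho> g x) = level x"
  by (simp add: level_def norm_rep)

lemma level_circle: "norm t = 1 \<Longrightarrow> level (circle_act k s t x) = level x"
  by (simp add: level_def circle_act_def norm_smult norm_powi)

text \<open>The preimage of the orbit under the quotient map: an orbit of the circle times
  \<open>G\<close>, on which all tangent computations take place.\<close>

definition M :: "('a, 'b) vsum set" where
  "M = {circle_act k s t (\<rho> g p) | t g. norm t = 1 \<and> g \<in> G}"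

lemma Union_orbit: "\<Union>(induced_orbit G \<rho> k s p) = M"
  unfolding induced_orbit_def circle_class_def M_def by blast

lemma circle_class_self: "x \<in> circle_class k s x"
  unfolding circle_class_def using circle_act_1[of k s x] by (metis (mono_tags, lifting) mem_Collect_eq norm_one)

lemma Union_wproj: "\<Union>(wproj V1 V2 h k s) = {x \<in> V. level x = 1}"
proof (intro equalityI subsetI)
  fix x assume "x \<in> \<Union>(wproj V1 V2 h k s)"
  then obtain y t where "y \<in> V" "level y = 1" "x = circle_act k s t y" "norm t = 1"
    by (auto simp: wproj_def level_set_eq circle_class_def)
  then show "x \<in> {x \<in> V. level x = 1}" using circle_V level_circle by simp
next
  fix x assume "x \<in> {x \<in> V. level x = 1}"
  then show "x \<in> \<Union>(wproj V1 V2 h k s)"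
    unfolding wproj_def level_set_eq using circle_class_self by blast
qed

lemma M_level: "x \<in> M \<Longrightarrow> x \<in> V \<and> level x = 1"
proof -
  assume "x \<in> M"
  then obtain t g where x: "x = circle_act k s t (\<rho> g p)" "norm t = 1" "g \<in> G"
    by (auto simp: M_def)
  have "level p = 1" using p_level by (simp add: level_def mult.assoc)
  then show ?thesis using x circle_V[OF rep_V[OF x(3) p_in]] by (simp add: level_circle level_rep)
qed

lemma p_M: "p \<in> M"
  unfolding M_def using G_one
  by (intro CollectI exI[of _ 1] exI[of _ "mat 1"]) (auto simp: circle_act_1 rep_one)

lemma M_circle: "x \<in> M \<Longrightarrow> norm t = 1 \<Longrightarrow> circle_act k s t x \<in> M"
proof -
  assume "x \<in> M" and t: "norm t = 1"
  then obtain u g where x: "x = circle_act k s u (\<rho> g p)" "norm u = 1" "g \<in> G"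
    by (auto simp: M_def)
  have "circle_act k s t x = circle_act k s (t * u) (\<rho> g p)"
    unfolding x using t x(2) by (intro circle_act_circle_act) auto
  moreover have "norm (t * u) = 1" using t x(2) by (simp add: norm_mult)
  ultimately show ?thesis using x(3) unfolding M_def by blast
qed

lemma M_rep: "x \<in> M \<Longrightarrow> g \<in> G \<Longrightarrow> \<rho> g x \<in> M"
proof -
  assume "x \<in> M" and g: "g \<in> G"
  then obtain u g' where x: "x = circle_act k s u (\<rho> g' p)" "norm u = 1" "g' \<in> G"
    by (auto simp: M_def)
  have "\<rho> g x = circle_act k s u (\<rho> (g ** g') p)"
    by (simp add: x(1) rep_circle[OF g, symmetric] rep_mult[OF g x(3)])
  then show ?thesis using x(2) G_mult[OF g x(3)] unfolding M_def by blast
qed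

lemma circle_class_M: "x \<in> M \<Longrightarrow> circle_class k s x \<subseteq> M"
  unfolding circle_class_def using M_circle by blast

lemma H_self_zero: "Re (H x x) = 0 \<Longrightarrow> x = 0"
  using hp_self_zero c_pos by blast

lemma circ_vel_curve:
  "((\<lambda>r. circle_act k s (cis (\<theta> * r)) x) has_vector_derivative \<theta> *\<^sub>R circ_vel k s x) (at 0)"
proof -
  show ?thesis
    unfolding circle_act_def circ_vel_def scaleR_prod_def fst_conv snd_conv
    by (intro has_vector_derivative_Pair has_vector_derivative_cis_powi)
qed

text \<open>Differentiability of the scalar factor is recovered from that of the vector by pairing
  with \<open>x\<close>.\<close>

lemma has_vector_derivative_line:
  fixes x u :: "complex ^ 'c::finite"
  assumes d: "((\<lambda>r. \<psi> r *s x) has_vector_derivative u) (at 0)" and x: "x \<noteq> 0"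
  shows "\<exists>d. u = d *s x \<and> (\<psi> has_vector_derivative d) (at 0)"
proof -
  define d where "d = cip u x / of_real ((norm x)\<^sup>2)"
  have "\<psi> r = cip (\<psi> r *s x) x / of_real ((norm x)\<^sup>2)" for r
    using x by (simp add: cip_simps cip_self)
  moreover have "((\<lambda>r. cip (\<psi> r *s x) x / of_real ((norm x)\<^sup>2)) has_vector_derivative d) (at 0)"
    unfolding d_def by (intro bounded_linear.has_vector_derivative[OF _ d] bounded_linear_divide[THEN bounded_linear_compose]
        bounded_bilinear.bounded_linear_left[OF bounded_bilinear_cip])
  ultimately have \<psi>: "(\<psi> has_vector_derivative d) (at 0)" by simp
  have "bounded_linear (\<lambda>c. c *s x)"
    by (auto intro!: linear_conv_bounded_linear[THEN iffD1] linearI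
        simp: vec_eq_iff algebra_simps scaleR_conv_of_real[where 'a = complex])
  from bounded_linear.has_vector_derivative[OF this \<psi>] d have "u = d *s x"
    by (rule vector_derivative_unique_at[symmetric])
  with \<psi> show ?thesis by blast
qed

text \<open>A curve in the circle orbit determines its parameter \<open>t\<close> only up to a
  finite stabilizer, so a chosen \<open>t\<close> need not even be continuous. The powers t^(-k) and
  t^(-s), however, are determined by the curve since both components of \<open>x\<close> are
  nonzero, and they are differentiable. Their derivatives are tied together by \<open>cross\<close>
  and by unimodularity.\<close>

lemma tangent_circle:
  assumes x: "fst x \<noteq> 0" "snd x \<noteq> 0"
  shows "tangent (circle_class k s x) x = range (\<lambda>\<theta>. \<theta> *\<^sub>R circ_vel k s x)"
proof (intro equalityI subsetI)
  fix u assume "u \<in> range (\<lambda>\<theta>. \<theta> *\<^sub>R circ_vel k s x)"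
  then obtain \<theta> where u: "u = \<theta> *\<^sub>R circ_vel k s x" by blast
  show "u \<in> tangent (circle_class k s x) x"
    unfolding tangent_def u
    using circ_vel_curve[of \<theta> x]
    by (intro CollectI exI[of _ "\<lambda>r. circle_act k s (cis (\<theta> * r)) x"])
      (auto simp: circle_act_1 circle_class_def)
next
  fix u assume "u \<in> tangent (circle_class k s x) x"
  then obtain \<gamma> where \<gamma>: "\<gamma> 0 = x" "\<forall>r. \<gamma> r \<in> circle_class k s x"
    "(\<gamma> has_vector_derivative u) (at 0)" by (auto simp: tangent_def)
  obtain t where t: "\<And>r. norm (t r) = 1" "\<And>r. \<gamma> r = circle_act k s (t r) x"
    using \<gamma>(2) unfolding circle_class_def by (simp add: mem_Collect_eq) metis
  define \<phi> where "\<phi> n r = t r powi (- int n)" for n and r :: real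
  have n\<phi>: "norm (\<phi> n r) = 1" for n r by (simp add: \<phi>_def norm_powi t)
  have comp: "fst (\<gamma> r) = \<phi> k r *s fst x" "snd (\<gamma> r) = \<phi> s r *s snd x" for r
    by (simp_all add: \<phi>_def t circle_act_def)
  \<comment> \<open>Both sides are t^(- k s): the relation between the two factors that does not
    mention \<open>t\<close>.\<close>
  have cross: "\<phi> k r ^ s = \<phi> s r ^ k" for r
    by (simp add: \<phi>_def power_int_of_nat [symmetric] power_int_mult [symmetric] mult.commute del: power_int_of_nat)
  have \<phi>0: "\<phi> k 0 = 1" "\<phi> s 0 = 1"
  proof -
    have "\<phi> k 0 *s fst x = fst x" "\<phi> s 0 *s snd x = snd x"
      using comp[of 0] \<gamma>(1) by simp_all
    then show "\<phi> k 0 = 1" "\<phi> s 0 = 1" using x by (metis vec.scale_cancel_right vec.scale_one)+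
  qed
  have dfst: "((\<lambda>r. fst (\<gamma> r)) has_vector_derivative fst u) (at 0)"
    and dsnd: "((\<lambda>r. snd (\<gamma> r)) has_vector_derivative snd u) (at 0)"
    by (rule bounded_linear.has_vector_derivative[OF _ \<gamma>(3)], simp_all add: bounded_linear_fst bounded_linear_snd)+
  obtain d1 where u1: "fst u = d1 *s fst x" and d\<phi>1: "(\<phi> k has_vector_derivative d1) (at 0)"
    using has_vector_derivative_line[OF dfst[unfolded comp] x(1)] by blast
  obtain d2 where u2: "snd u = d2 *s snd x" and d\<phi>2: "(\<phi> s has_vector_derivative d2) (at 0)"
    using has_vector_derivative_line[OF dsnd[unfolded comp] x(2)] by blast
  have pw: "((\<lambda>r. \<psi> r ^ n) has_vector_derivative of_nat n * d) (at 0)"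
    if "(\<psi> has_vector_derivative d) (at 0)" "\<psi> 0 = 1" for \<psi> :: "real \<Rightarrow> complex" and d n
  proof -
    have "((\<lambda>z. z ^ n) has_field_derivative of_nat n) (at (\<psi> 0))"
      unfolding that(2) by (auto intro!: derivative_eq_intros)
    from field_vector_diff_chain_at[OF that(1) this] show ?thesis
      by (simp add: o_def mult.commute)
  qed
  have "of_nat s * d1 = of_nat k * d2"
    using pw[OF d\<phi>1 \<phi>0(1), of s] pw[OF d\<phi>2 \<phi>0(2), of k] unfolding cross
    by (rule vector_derivative_unique_at)
  \<comment> \<open>A unimodular function with value 1 at 0 has purely imaginary derivative
    there.\<close>
  moreover have "d1 + cnj d1 = 0"
  proof -
    have "((\<lambda>r. \<phi> k r * cnj (\<phi> k r)) has_vector_derivative \<phi> k 0 * cnj d1 + d1 * cnj (\<phi> k 0)) (at 0)"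
      by (intro bounded_bilinear.has_vector_derivative[OF bounded_bilinear_mult] d\<phi>1
          bounded_linear.has_vector_derivative[OF bounded_linear_cnj])
    moreover have "\<phi> k r * cnj (\<phi> k r) = 1" for r
      using n\<phi>[of k r] complex_norm_square[of "\<phi> k r"] by simp
    ultimately have "((\<lambda>r::real. 1::complex) has_vector_derivative cnj d1 + d1) (at 0)"
      by (simp add: \<phi>0)
    then show ?thesis
      using vector_derivative_unique_at[OF _ has_vector_derivative_const] by (metis add.commute)
  qed
  ultimately have "d1 = of_real (- Im d1 / k) * (- (\<i> * of_nat k))"
      "d2 = of_real (- Im d1 / k) * (- (\<i> * of_nat s))"
    using ks_pos by (auto simp: complex_eq_iff field_simps)
  then have "u = (- Im d1 / k) *\<^sub>R circ_vel k s x"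
    by (simp add: prod_eq_iff circ_vel_def u1 u2 scaleR_eq_smult vector_smult_assoc)
  then show "u \<in> range (\<lambda>\<theta>. \<theta> *\<^sub>R circ_vel k s x)" by blast
qed

lemma tangent_level:
  assumes x: "x \<in> V" "level x = 1"
  shows "tangent {x \<in> V. level x = 1} x = {u \<in> V. polar u x = 0}"
proof (intro equalityI subsetI)
  fix u assume u: "u \<in> tangent {x \<in> V. level x = 1} x"
  then obtain \<gamma> where \<gamma>: "\<gamma> 0 = x" "\<forall>r. level (\<gamma> r) = 1"
    "(\<gamma> has_vector_derivative u) (at 0)" by (auto simp: tangent_def)
  have "((\<lambda>r. polar (\<gamma> r) (\<gamma> r)) has_vector_derivative polar x u + polar u x) (at 0)"
    using bounded_bilinear.has_vector_derivative[OF bounded_bilinear_polar \<gamma>(3) \<gamma>(3)]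
    by (simp add: \<gamma>(1))
  then have "((\<lambda>r::real. 1::real) has_vector_derivative polar x u + polar u x) (at 0)"
    using \<gamma>(2) by (simp add: polar_self)
  then have "polar x u + polar u x = 0"
    using vector_derivative_unique_at[OF _ has_vector_derivative_const] by metis
  then have "polar u x = 0" by (simp add: polar_simps(5)[of x u])
  then show "u \<in> {u \<in> V. polar u x = 0}"
    using u tangent_subspace[OF subspace_V_real, of "{x \<in> V. level x = 1}" x] by blast
next
  fix u assume u: "u \<in> {u \<in> V. polar u x = 0}"
  define c where "c = level u"
  have c: "0 \<le> c" using c_pos by (simp add: c_def level_def)
  \<comment> \<open>Since \<open>u\<close> is polar to \<open>x\<close>, the level at x + r u is 1 +
    c r^2. Dividing by the square root puts the line back on the level set, and the factor has
    derivative 0 at 0, so the velocity remains \<open>u\<close>.\<close>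
  define f where "f r = inverse (sqrt (1 + c * r\<^sup>2))" for r
  have pos: "1 + c * r\<^sup>2 > 0" for r using c by (simp add: add_pos_nonneg)
  have f2: "f r * f r * (1 + c * r\<^sup>2) = 1" for r
    using pos[of r] by (simp add: f_def inverse_eq_divide field_simps)
  have "level (f r *\<^sub>R (x + r *\<^sub>R u)) = f r * f r * (level x + 2 * r * polar u x + r\<^sup>2 * c)" for r
    by (simp add: polar_self[symmetric] polar_simps c_def power2_eq_square algebra_simps)
  then have lev: "level (f r *\<^sub>R (x + r *\<^sub>R u)) = 1" for r
    using u x f2[of r] by (simp add: mult.commute[of c])
  have "(f has_vector_derivative 0) (at 0)"
    unfolding f_def has_real_derivative_iff_has_vector_derivative[symmetric]
    by (auto intro!: derivative_eq_intros)
  moreover have "((\<lambda>r. x + r *\<^sub>R u) has_vector_derivative u) (at 0)"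
    by (auto intro!: derivative_eq_intros simp: has_vector_derivative_def)
  ultimately have "((\<lambda>r. f r *\<^sub>R (x + r *\<^sub>R u)) has_vector_derivative
      f 0 *\<^sub>R u + 0 *\<^sub>R (x + 0 *\<^sub>R u)) (at 0)"
    by (rule bounded_bilinear.has_vector_derivative[OF bounded_bilinear_scaleR])
  then have "((\<lambda>r. f r *\<^sub>R (x + r *\<^sub>R u)) has_vector_derivative u) (at 0)"
    by (simp add: f_def)
  moreover have "f r *\<^sub>R (x + r *\<^sub>R u) \<in> V" for r
    using u x by (intro subspace_scale subspace_add subspace_V_real) auto
  ultimately show "u \<in> tangent {x \<in> V. level x = 1} x"
    unfolding tangent_def using lev
    by (intro CollectI exI[of _ "\<lambda>r. f r *\<^sub>R (x + r *\<^sub>R u)"]) (auto simp: f_def)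
qed

lemma dim_tangent_level:
  assumes x: "x \<in> V" "level x = 1"
  shows "dim (tangent {x \<in> V. level x = 1} x) = dim V - 1"
proof -
  define T where "T = {u \<in> V. polar u x = 0}"
  have sT: "subspace T"
    using subspace_V_real by (auto simp: T_def subspace_def polar_simps)
  have "x \<notin> span T"
    using x sT by (auto simp: T_def polar_self span_eq_iff[THEN iffD2])
  then have "dim (insert x T) = dim T + 1" by (simp add: dim_insert)
  moreover have "V \<subseteq> span (insert x T)"
  proof
    fix v assume v: "v \<in> V"
    have "v - polar v x *\<^sub>R x \<in> V"
      using v x by (intro subspace_diff subspace_scale subspace_V_real)
    moreover have "polar (v - polar v x *\<^sub>R x) x = 0"
      using x by (simp add: polar_simps(6,3) polar_self)
    ultimately have "v - polar v x *\<^sub>R x \<in> T" by (simp add: T_def)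
    then have "(v - polar v x *\<^sub>R x) + polar v x *\<^sub>R x \<in> span (insert x T)"
      by (intro span_add span_scale span_base) auto
    then show "v \<in> span (insert x T)" by simp
  qed
  then have "dim V = dim (insert x T)"
    by (intro antisym dim_subset dim_mono) (use x in \<open>auto simp: T_def\<close>)
  ultimately show ?thesis by (simp add: tangent_level[OF x] T_def)
qed

section \<open>The infinitesimal orbit at the base point is Lagrangian in V\<close>

text \<open>\<open>span K\<close> is the space W of the overview. \<open>S\<close> is only a family
  of generators, not the whole Lie algebra.\<close>

definition K :: "('a, 'b) vsum set" where
  "K = insert (circ_vel k s p) {act2 X1 X2 p | X1 X2. (X1, X2) \<in> S}"

lemma S_rep_curve:
  assumes "(X1, X2) \<in> S"
  shows "\<exists>\<gamma>::real \<Rightarrow> _. (\<forall>r. \<gamma> r \<in> G) \<and> (\<forall>x. \<rho> (\<gamma> 0) x = x \<and>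
    ((\<lambda>r. \<rho> (\<gamma> r) x) has_vector_derivative act2 X1 X2 x) (at 0))"
proof -
  obtain \<gamma> :: "real \<Rightarrow> _" where \<gamma>: "\<forall>r. \<gamma> r \<in> G" "\<gamma> 0 = mat 1"
    and d: "((\<lambda>r. R1 (\<gamma> r)) has_vector_derivative X1) (at 0)" "((\<lambda>r. R2 (\<gamma> r)) has_vector_derivative X2) (at 0)"
    using S_curve[OF assms] by blast
  have "((\<lambda>r. (R1 (\<gamma> r) *v fst x, R2 (\<gamma> r) *v snd x)) has_vector_derivative (X1 *v fst x, X2 *v snd x)) (at 0)" for x
    by (intro has_vector_derivative_Pair bounded_linear.has_vector_derivative[OF bounded_linear_mult_vec] d)
  then show ?thesis using \<gamma> by (intro exI[of _ \<gamma>]) (simp add: rep_act2 rep_one act2_def)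
qed

lemma K_tangent: "K \<subseteq> tangent M p"
proof
  fix w assume "w \<in> K"
  then consider "w = circ_vel k s p" | X1 X2 where "(X1, X2) \<in> S" "w = act2 X1 X2 p"
    by (auto simp: K_def)
  then show "w \<in> tangent M p"
  proof cases
    case 1
    have "w \<in> tangent (circle_class k s p) p"
      unfolding tangent_circle[OF p_nz] 1 by (rule range_eqI[of _ _ 1]) simp
    then show ?thesis using tangent_mono[OF circle_class_M[OF p_M]] by blast
  next
    case 2
    then obtain \<gamma> where \<gamma>: "\<forall>r::real. \<gamma> r \<in> G" "\<rho> (\<gamma> 0) p = p"
      "((\<lambda>r. \<rho> (\<gamma> r) p) has_vector_derivative w) (at 0)"
      using S_rep_curve[OF 2(1)] by blast
    then show ?thesis
      unfolding tangent_def
      by (intro CollectI exI[of _ "\<lambda>r. \<rho> (\<gamma> r) p"]) (auto intro: M_rep p_M)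
  qed
qed

lemma X_skew:
  assumes "(X1, X2) \<in> S"
  shows "H (act2 X1 X2 x) y + H x (act2 X1 X2 y) = 0"
proof -
  let ?X = "act2 X1 X2"
  obtain \<gamma> where \<gamma>: "\<And>r::real. \<gamma> r \<in> G" "\<And>x. \<rho> (\<gamma> 0) x = x"
      "\<And>x. ((\<lambda>r. \<rho> (\<gamma> r) x) has_vector_derivative ?X x) (at 0)"
    using S_rep_curve[OF assms] by blast
  have "((\<lambda>r. H (\<rho> (\<gamma> r) x) (\<rho> (\<gamma> r) y)) has_vector_derivative
      H (\<rho> (\<gamma> 0) x) (?X y) + H (?X x) (\<rho> (\<gamma> 0) y)) (at 0)"
    by (intro bounded_bilinear.has_vector_derivative[OF bounded_bilinear_hp] \<gamma>(3))
  then have "((\<lambda>r::real. H x y) has_vector_derivative H x (?X y) + H (?X x) y) (at 0)"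
    by (simp add: H_rep \<gamma>)
  then have "H x (?X y) + H (?X x) y = 0"
    using vector_derivative_unique_at[OF _ has_vector_derivative_const] by metis
  then show ?thesis by (simp add: add.commute)
qed

text \<open>Only the constancy of the moment maps on \<open>M\<close> is used about the curve, so no
  lift of it to the group is needed.\<close>

lemma tangent_orthogonal_K:
  assumes u: "u \<in> tangent M p" and w: "w \<in> K"
  shows "Im (H w u) = 0"
proof -
  from w consider "w = circ_vel k s p" | X1 X2 where "(X1, X2) \<in> S" "w = act2 X1 X2 p"
    by (auto simp: K_def)
  then show ?thesis
  proof cases
    case 1
    have "u \<in> tangent {x \<in> V. level x = 1} p"
      using u tangent_mono[of M "{x \<in> V. level x = 1}"] M_level by blast
    \<comment> \<open>The imaginary part of \<open>H\<close> between the circle direction and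
      \<open>u\<close> is - \<open>polar u p\<close>, so for the circle the claim is tangency to the
      level set.\<close>
    then have "polar u p = 0" using tangent_level[of p] M_level[OF p_M] by blast
    then show ?thesis
      unfolding 1 by (simp add: hp_def circ_vel_def cip_simps polar_def Re_cip inner_commute algebra_simps)
  next
    case 2
    let ?X = "act2 X1 X2"
    obtain \<gamma> where \<gamma>: "\<gamma> 0 = p" "\<forall>r. \<gamma> r \<in> M" "(\<gamma> has_vector_derivative u) (at 0)"
      using u by (auto simp: tangent_def)
    have bX: "bounded_linear ?X"
      using linear_act2 by (simp add: linear_conv_bounded_linear)
    have "H (?X q) q = 0" if "q \<in> M" for q
    proof -
      obtain t g where q: "q = circle_act k s t (\<rho> g p)" "norm t = 1" "g \<in> G"
        using \<open>q \<in> M\<close> unfolding M_def by blast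
      then have "H (?X q) q = H (circle_act k s t (?X (\<rho> g p))) (circle_act k s t (\<rho> g p))"
        by (simp only: circle_act2)
      then show ?thesis using moment_zero[OF 2(1) q(3)] by (simp add: hp_circle_act q rep_act2)
    qed
    then have 0: "H (?X (\<gamma> r)) (\<gamma> r) = 0" for r using \<gamma>(2) by blast
    have "((\<lambda>r. H (?X (\<gamma> r)) (\<gamma> r)) has_vector_derivative H (?X (\<gamma> 0)) u + H (?X u) (\<gamma> 0)) (at 0)"
      by (intro bounded_bilinear.has_vector_derivative[OF bounded_bilinear_hp] \<gamma>(3)
          bounded_linear.has_vector_derivative[OF bX])
    then have "((\<lambda>r::real. 0::complex) has_vector_derivative H (?X p) u + H (?X u) p) (at 0)"
      by (simp only: 0 \<gamma>(1))
    then have "H (?X p) u + H (?X u) p = 0"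
      using vector_derivative_unique_at[OF _ has_vector_derivative_const] by metis
    moreover have "H (?X u) p + H u (?X p) = 0" by (rule X_skew[OF 2(1)])
    \<comment> \<open>Differentiating the moment map gives H (X p) u = - H (X u) p, and skewness
      turns the right side into H u (X p), the conjugate of the left. So the value is real.\<close>
    ultimately have "H (?X p) u = cnj (H (?X p) u)"
      by (simp add: cnj_hp add_eq_0_iff2)
    then show ?thesis unfolding 2 by (metis complex_cnj_cancel_iff complex_is_Real_iff Reals_cnj_iff)
  qed
qed

lemma tangent_orthogonal_span:
  assumes "u \<in> tangent M p" "w \<in> span K"
  shows "Im (H w u) = 0"
proof -
  have "subspace {w. Im (H w u) = 0}"
    by (auto simp: subspace_def hp_add_left hp_scaleR_left hp_zero_left)
  then have "span K \<subseteq> {w. Im (H w u) = 0}"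
    using tangent_orthogonal_K[OF assms(1)] by (intro span_minimal) auto
  then show ?thesis using assms(2) by blast
qed

text \<open>The elements of \<open>K\<close> are themselves velocities in \<open>M\<close>, so the
  orthogonality just shown can be used in both arguments.\<close>

lemma span_K_isotropic:
  assumes "u \<in> span K" "w \<in> span K"
  shows "Im (H w u) = 0"
proof -
  have "subspace {u. Im (H w u) = 0}"
    by (auto simp: subspace_def hp_add_right hp_scaleR_right hp_zero_right)
  then have "span K \<subseteq> {u. Im (H w u) = 0}"
    using tangent_orthogonal_span[OF _ assms(2)] K_tangent by (intro span_minimal) blast+
  then show ?thesis using assms(1) by blast
qed

lemma tangent_M_V: "tangent M q \<subseteq> V"
  using M_level by (intro tangent_subspace subspace_V_real) auto

lemma span_K_V: "span K \<subseteq> V"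
  using K_tangent tangent_M_V by (intro span_minimal subspace_V_real) blast

lemma cscale_ii: "cscale \<i> (cscale \<i> x) = - x"
  by (simp add: cscale_def prod_eq_iff vec_eq_iff)

text \<open>W + \<i> W is a complex subspace containing \<open>K\<close>, hence all of V by
  \<open>spanning\<close>.\<close>

lemma V_decomp:
  assumes "x \<in> V"
  obtains w1 w2 where "w1 \<in> span K" "w2 \<in> span K" "x = w1 + cscale \<i> w2"
proof -
  let ?C = "{w1 + cscale \<i> w2 | w1 w2. w1 \<in> span K \<and> w2 \<in> span K}"
  have "csub ?C"
    unfolding csub_def
  proof (intro conjI ballI allI)
    show "0 \<in> ?C"
      using span_0[of K] by (intro CollectI exI[of _ 0]) (simp add: cscale_def prod_eq_iff)
  next
    fix x y assume "x \<in> ?C" "y \<in> ?C"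
    then obtain a b c d where "x = a + cscale \<i> b" "y = c + cscale \<i> d"
      "a \<in> span K" "b \<in> span K" "c \<in> span K" "d \<in> span K" by blast
    then show "x + y \<in> ?C"
      by (intro CollectI exI[of _ "a + c"] exI[of _ "b + d"])
        (auto simp: cscale_def vector_add_ldistrib intro: span_add)
  next
    fix c x assume "x \<in> ?C"
    then obtain a b where x: "x = a + cscale \<i> b" and ab: "a \<in> span K" "b \<in> span K" by blast
    have "cscale c x = (Re c *\<^sub>R a - Im c *\<^sub>R b) + cscale \<i> (Im c *\<^sub>R a + Re c *\<^sub>R b)"
      unfolding x by (auto simp: cscale_def prod_eq_iff vec_eq_iff complex_eq_iff algebra_simps)
    moreover have "Re c *\<^sub>R a - Im c *\<^sub>R b \<in> span K" "Im c *\<^sub>R a + Re c *\<^sub>R b \<in> span K"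
      using ab by (auto intro!: span_add span_diff span_scale)
    ultimately show "cscale c x \<in> ?C" by blast
  qed
  moreover have "K \<subseteq> ?C"
  proof
    fix w assume "w \<in> K"
    then show "w \<in> ?C"
      by (intro CollectI exI[of _ w] exI[of _ 0])
        (auto simp: cscale_def zero_prod_def[symmetric] intro: span_base span_0)
  qed
  moreover have "circ_vel k s p \<in> K" "\<And>X1 X2. (X1, X2) \<in> S \<Longrightarrow> act2 X1 X2 p \<in> K"
    unfolding K_def by blast+
  ultimately have "V \<subseteq> ?C" by (intro spanning) blast+
  then show ?thesis using that assms by blast
qed

text \<open>An isotropic real subspace is totally real: the symplectic form pairs w with \<i> w to
  the squared norm, up to sign.\<close>

lemma span_K_Int:
  assumes "w \<in> span K" "cscale \<i> w \<in> span K"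
  shows "w = 0"
proof -
  have "Im (H w (cscale \<i> w)) = 0" by (rule span_K_isotropic[OF assms(2,1)])
  then show ?thesis by (intro H_self_zero) (simp add: hp_cscale_right)
qed

text \<open>The upper bound for the tangent space. Write u = w1 + \<i> w2; pairing with w2 kills w1
  by isotropy and \<open>u\<close> by orthogonality, which leaves the squared norm of w2 equal to
  0.\<close>

lemma tangent_M_p: "tangent M p \<subseteq> span K"
proof
  fix u assume u: "u \<in> tangent M p"
  then obtain w1 w2 where w: "w1 \<in> span K" "w2 \<in> span K" "u = w1 + cscale \<i> w2"
    using V_decomp tangent_M_V by blast
  have "Im (H w2 u) = 0" by (rule tangent_orthogonal_span[OF u w(2)])
  moreover have "Im (H w2 w1) = 0" by (rule span_K_isotropic[OF w(1,2)])
  ultimately have "Im (H w2 (cscale \<i> w2)) = 0" unfolding w(3) by (simp add: hp_add_right)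
  then have "w2 = 0" by (intro H_self_zero) (simp add: hp_cscale_right)
  then show "u \<in> span K" using w by (simp add: cscale_def zero_prod_def[symmetric])
qed

lemma dim_tangent_M_p: "dim V = 2 * dim (tangent M p)"
proof -
  have "span (tangent M p) = span K"
    using span_minimal[OF tangent_M_p] span_mono[OF K_tangent] by simp
  then have 1: "dim (tangent M p) = dim (span K)" by (metis dim_span)
  have lin: "linear (cscale \<i> :: ('a, 'b) vsum \<Rightarrow> _)"
    by (auto intro!: linearI simp: cscale_def vec_eq_iff algebra_simps)
  have inj: "inj (cscale \<i> :: ('a, 'b) vsum \<Rightarrow> _)"
    by (rule inj_on_inverseI[of _ "\<lambda>x. - cscale \<i> x"]) (simp add: cscale_ii)
  have 2: "dim (cscale \<i> ` span K) = dim (span K)"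
    by (intro dim_image_eq[OF lin] inj_on_subset[OF inj] subset_UNIV)
  have "dim {x + y |x y. x \<in> span K \<and> y \<in> cscale \<i> ` span K} + dim (span K \<inter> cscale \<i> ` span K) =
    dim (span K) + dim (cscale \<i> ` span K)"
    by (intro dim_sums_Int subspace_span linear_subspace_image[OF lin])
  moreover have "span K \<inter> cscale \<i> ` span K \<subseteq> {0}"
  proof
    fix x assume "x \<in> span K \<inter> cscale \<i> ` span K"
    then obtain w where w: "w \<in> span K" "x = cscale \<i> w" "cscale \<i> w \<in> span K" by blast
    then have "w = 0" by (intro span_K_Int)
    then show "x \<in> {0}" by (simp add: w cscale_def prod_eq_iff)
  qed
  then have "dim (span K \<inter> cscale \<i> ` span K) = 0" by (simp only: dim_eq_0)
  moreover have "{x + y |x y. x \<in> span K \<and> y \<in> cscale \<i> ` span K} = V"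
  proof (intro equalityI subsetI)
    fix x assume "x \<in> V"
    then show "x \<in> {x + y |x y. x \<in> span K \<and> y \<in> cscale \<i> ` span K}"
      by (rule V_decomp) blast
  next
    fix x assume "x \<in> {x + y |x y. x \<in> span K \<and> y \<in> cscale \<i> ` span K}"
    then obtain a b where ab: "x = a + cscale \<i> b" "a \<in> span K" "b \<in> span K" by blast
    have "a + cscale \<i> b \<in> V" using span_K_V ab(2,3) by (intro csubD[OF csub_V]) auto
    then show "x \<in> V" unfolding ab .
  qed
  ultimately show ?thesis using 1 2 by simp
qed

section \<open>Passing from the base point to every point of the orbit\<close>

text \<open>The circle times \<open>G\<close> acts transitively on \<open>M\<close> by isometries of
  \<open>H\<close>. Both directions are recorded because the dimension comparison uses one injection
  each way.\<close>

lemma transport: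
  assumes "q \<in> M"
  shows "\<exists>L L'. linear L \<and> linear L' \<and> (\<forall>x y. H (L x) (L y) = H x y) \<and>
    (\<forall>x y. H (L' x) (L' y) = H x y) \<and> L ` M \<subseteq> M \<and> L' ` M \<subseteq> M \<and> L p = q \<and> L' q = p"
proof -
  obtain t g where q: "q = circle_act k s t (\<rho> g p)" "norm t = 1" "g \<in> G"
    using assms unfolding M_def by blast
  obtain g' where g': "g' \<in> G" "g' ** g = mat 1" using G_inv[OF q(3)] by blast
  then have g'g: "\<rho> g' (\<rho> g x) = x" for x using q(3) by (simp add: rep_mult rep_one)
  have t0: "t \<noteq> 0" "norm (inverse t) = 1" using q(2) by (auto simp: norm_inverse)
  have linr: "linear (\<rho> g)" if "g \<in> G" for g
  proof -
    have "\<rho> g = act2 (R1 g) (R2 g)" using that by (auto simp: rep_act2)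
    then show ?thesis by (simp add: linear_act2)
  qed
  show ?thesis
  proof (rule exI[of _ "circle_act k s t \<circ> \<rho> g"], rule exI[of _ "\<rho> g' \<circ> circle_act k s (inverse t)"],
      intro conjI)
    show "linear (circle_act k s t \<circ> \<rho> g)" "linear (\<rho> g' \<circ> circle_act k s (inverse t))"
      by (intro linear_compose linear_circle_act linr q g')+
    show "(circle_act k s t \<circ> \<rho> g) ` M \<subseteq> M" "(\<rho> g' \<circ> circle_act k s (inverse t)) ` M \<subseteq> M"
      by (intro image_subsetI; simp add: M_rep M_circle q g' t0)+
    show "(\<rho> g' \<circ> circle_act k s (inverse t)) q = p"
      using t0 by (simp add: q circle_act_circle_act circle_act_1 g'g)
    show "(circle_act k s t \<circ> \<rho> g) p = q" by (simp add: q)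
    show "\<forall>x y. H ((circle_act k s t \<circ> \<rho> g) x) ((circle_act k s t \<circ> \<rho> g) y) = H x y"
      "\<forall>x y. H ((\<rho> g' \<circ> circle_act k s (inverse t)) x) ((\<rho> g' \<circ> circle_act k s (inverse t)) y) = H x y"
      by (simp_all only: o_apply H_rep hp_circle_act q g' t0 simp_thms)
  qed
qed

lemma tangent_M_isotropic:
  assumes "q \<in> M" "u \<in> tangent M q" "w \<in> tangent M q"
  shows "Im (H u w) = 0"
proof -
  obtain L' where L: "linear L'" "\<forall>x y. H (L' x) (L' y) = H x y" "L' ` M \<subseteq> M" "L' q = p"
    using transport[OF assms(1)] by blast
  have "bounded_linear L'" using L(1) by (simp add: linear_conv_bounded_linear)
  from tangent_image[OF this L(3)] have "L' u \<in> tangent M p" "L' w \<in> tangent M p"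
    using assms(2,3) L(4) by metis+
  then have "Im (H (L' u) (L' w)) = 0" using tangent_M_p span_K_isotropic by blast
  then show ?thesis using L(2) by simp
qed

lemma inj_isometry:
  assumes "linear L" "\<forall>x y. H (L x) (L y) = H x y"
  shows "inj L"
  unfolding linear_injective_0[OF assms(1)]
  using assms(2) H_self_zero by (metis hp_zero_left zero_complex.simps(1))

lemma dim_tangent_M:
  assumes "q \<in> M"
  shows "dim (tangent M q) = dim (tangent M p)"
proof -
  obtain L L' where  L: "linear L" "linear L'" "\<forall>x y. H (L x) (L y) = H x y"
    "\<forall>x y. H (L' x) (L' y) = H x y" "L ` M \<subseteq> M" "L' ` M \<subseteq> M" "L p = q" "L' q = p"
    using transport[OF assms] by blast
  have "bounded_linear L" "bounded_linear L'" using L(1,2) by (simp_all add: linear_conv_bounded_linear)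
  from tangent_image[OF this(1) L(5)] tangent_image[OF this(2) L(6)]
  have "L ` tangent M p \<subseteq> tangent M q" "L' ` tangent M q \<subseteq> tangent M p"
    using L(7,8) by (metis image_subsetI)+
  then have "dim (L ` tangent M p) \<le> dim (tangent M q)" "dim (L' ` tangent M q) \<le> dim (tangent M p)"
    by (auto intro: dim_subset)
  moreover have "dim (L ` tangent M p) = dim (tangent M p)" "dim (L' ` tangent M q) = dim (tangent M q)"
    by (intro dim_image_eq L inj_on_subset[OF inj_isometry[OF L(1,3)]] inj_on_subset[OF inj_isometry[OF L(2,4)]]
        subset_UNIV)+
  ultimately show ?thesis by simp
qed

lemma M_nz:
  assumes "q \<in> M" shows "fst q \<noteq> 0" "snd q \<noteq> 0"
proof -
  obtain t g where q: "q = circle_act k s t (\<rho> g p)" "norm t = 1" "g \<in> G"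
    using assms unfolding M_def by blast
  then have "norm (fst q) = norm (fst p)" "norm (snd q) = norm (snd p)"
    by (auto simp: circle_act_def norm_smult norm_powi norm_rep)
  then show "fst q \<noteq> 0" "snd q \<noteq> 0" using p_nz by auto
qed

theorem lagrangian_orbit: "admits_lagrangian_orbit G \<rho> V1 V2 h k s"
  unfolding admits_lagrangian_orbit_def
proof
  show "p \<in> level_set V1 V2 h k s" using M_level[OF p_M] by (simp add: level_set_eq)
  show "lagrangian V1 V2 h k s (induced_orbit G \<rho> k s p)"
    unfolding lagrangian_def Union_orbit
  proof (intro conjI ballI)
    show "induced_orbit G \<rho> k s p \<subseteq> wproj V1 V2 h k s"
    proof
      fix c assume "c \<in> induced_orbit G \<rho> k s p"
      then obtain g where g: "g \<in> G" "c = circle_class k s (\<rho> g p)" by (auto simp: induced_orbit_def)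
      then show "c \<in> wproj V1 V2 h k s"
        using M_level[OF M_rep[OF p_M g(1)]] by (auto simp: wproj_def level_set_eq)
    qed
  next
    fix q assume q: "q \<in> M"
    have "circ_vel k s q \<noteq> 0"
      using M_nz[OF q] ks_pos by (auto simp: circ_vel_def prod_eq_iff)
    moreover have "range (\<lambda>\<theta>. \<theta> *\<^sub>R circ_vel k s q) = span {circ_vel k s q}"
      by (auto simp: span_singleton)
    ultimately have 1: "dim (tangent (circle_class k s q) q) = 1"
      unfolding tangent_circle[OF M_nz[OF q]] by simp
    have "dim (tangent {x \<in> V. level x = 1} q) = dim V - 1"
      using M_level[OF q] by (intro dim_tangent_level) auto
    \<comment> \<open>With d the dimension of the tangent space of \<open>M\<close>, the two sides
      are 2 (d - 1) and (2 d - 1) - 1.\<close>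
    then show "2 * quot_dim k s (induced_orbit G \<rho> k s p) q = quot_dim k s (wproj V1 V2 h k s) q"
      unfolding quot_dim_def Union_orbit Union_wproj 1 dim_tangent_M[OF q]
      using dim_tangent_M_p by simp
  next
    fix q U W
    assume q: "q \<in> M" and U: "U \<in> quot_tangent k s (induced_orbit G \<rho> k s p) q"
      and W: "W \<in> quot_tangent k s (induced_orbit G \<rho> k s p) q"
    obtain u w where uw: "u \<in> tangent M q" "w \<in> tangent M q"
      "U = tangent_class k s q u" "W = tangent_class k s q w"
      using U W by (auto simp: quot_tangent_def Union_orbit)
    let ?T = "tangent (circle_class k s q) q"
    \<comment> \<open>Circle orbits lie in \<open>M\<close>, so a change of representatives stays
      inside the isotropic tangent space.\<close>
    have T: "?T \<subseteq> tangent M q" by (intro tangent_mono circle_class_M q)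
    have *: "sympl h (u + x) (w + y) = 0" if "x \<in> ?T" "y \<in> ?T" for x y
    proof -
      have xy: "x \<in> tangent M q" "y \<in> tangent M q" using that T by auto
      then have "u + x \<in> V" "w + y \<in> V" using uw tangent_M_V by (blast intro: csubD[OF csub_V])+
      then have "sympl h (u + x) (w + y) = - Im (H (u + x) (w + y))" by (rule sympl_H)
      then show ?thesis
        using tangent_M_isotropic[OF q] uw xy by (simp add: hp_add_left hp_add_right)
    qed
    \<comment> \<open>\<open>THE\<close> determines a value only if both cosets are nonempty; the
      zero velocity provides elements.\<close>
    have "0 \<in> ?T" unfolding tangent_circle[OF M_nz[OF q]] by (rule range_eqI[of _ _ 0]) simp
    then have 0: "u + 0 \<in> U" "w + 0 \<in> W" unfolding uw tangent_class_def by blast+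
    have "\<forall>u\<in>U. \<forall>w\<in>W. sympl h u w = 0"
      unfolding uw tangent_class_def using * by blast
    then show "reduced_form h U W = 0"
      unfolding reduced_form_def using 0 by (intro the_equality) fastforce+
  qed
qed

end

section \<open>Invariant Hermitian products\<close>

text \<open>The conditions of \<open>hermitian_product\<close> on a single summand. Nothing is known
  about \<open>f\<close> off \<open>V\<close>, which is why every later manipulation carries
  membership facts.\<close>

definition herm_on :: "(complex ^ 'a::finite) set \<Rightarrow> (complex ^ 'a \<Rightarrow> complex ^ 'a \<Rightarrow> complex) \<Rightarrow> bool" where
  "herm_on V f \<longleftrightarrow>
     (\<forall>x\<in>V. \<forall>y\<in>V. \<forall>z\<in>V. f (x + y) z = f x z + f y z) \<and>
     (\<forall>x\<in>V. \<forall>y\<in>V. \<forall>c. f (c *s x) y = c * f x y) \<and>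
     (\<forall>x\<in>V. \<forall>y\<in>V. f y x = cnj (f x y)) \<and>
     (\<forall>x\<in>V. x \<noteq> 0 \<longrightarrow> Re (f x x) > 0)"

lemma herm_onD:
  assumes "herm_on V f"
  shows "x \<in> V \<Longrightarrow> y \<in> V \<Longrightarrow> z \<in> V \<Longrightarrow> f (x + y) z = f x z + f y z"
    and "x \<in> V \<Longrightarrow> y \<in> V \<Longrightarrow> f (c *s x) y = c * f x y"
    and "x \<in> V \<Longrightarrow> y \<in> V \<Longrightarrow> f y x = cnj (f x y)"
    and "x \<in> V \<Longrightarrow> x \<noteq> 0 \<Longrightarrow> Re (f x x) > 0"
  using assms unfolding herm_on_def by blast+

lemma herm_onD_right:
  assumes f: "herm_on V f" and V: "vec.subspace V" and x: "x \<in> V" and y: "y \<in> V"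
  shows "z \<in> V \<Longrightarrow> f x (y + z) = f x y + f x z" "f x (c *s y) = cnj c * f x y"
proof -
  have *: "c *s y \<in> V" "z \<in> V \<Longrightarrow> y + z \<in> V" for z
    using V y by (auto simp: vec.subspace_def)
  show "z \<in> V \<Longrightarrow> f x (y + z) = f x y + f x z"
    using herm_onD(3)[OF f _ x] herm_onD(1)[OF f y _ x] *(2) y by simp
  show "f x (c *s y) = cnj c * f x y"
    using herm_onD(3)[OF f _ x] herm_onD(2)[OF f y x] *(1) y by simp
qed

lemma herm_on_pullback:
  assumes h: "hermitian_product W h" and f: "\<And>x. x \<in> V \<Longrightarrow> f x \<in> W" "\<And>x. x \<noteq> 0 \<Longrightarrow> f x \<noteq> 0"
    "\<And>x y. f (x + y) = f x + f y" "\<And>c x. f (c *s x) = cscale c (f x)"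
  shows "herm_on V (\<lambda>x y. h (f x) (f y))"
  unfolding herm_on_def f(3,4)
  by (intro conjI ballI allI impI; use h f(1,2) in \<open>unfold hermitian_product_def, blast\<close>)

lemma herm_on_components:
  assumes h: "hermitian_product (V1 \<times> V2) h" and V: "vec.subspace V1" "vec.subspace V2"
  shows "herm_on V1 (\<lambda>x y. h (x, 0) (y, 0))" "herm_on V2 (\<lambda>x y. h (0, x) (0, y))"
  using V by (auto intro!: herm_on_pullback[OF h] simp: cscale_def prod_eq_iff vec.subspace_0)

lemma herm_on_span_eq:
  assumes f: "herm_on (vec.span B) f"
    and B: "\<And>b b'. b \<in> B \<Longrightarrow> b' \<in> B \<Longrightarrow> f b b' = of_real c * cip b b'"
    and x: "x \<in> vec.span B" and y: "y \<in> vec.span B"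
  shows "f x y = of_real c * cip x y"
proof -
  have 0: "f 0 y = 0" "f y 0 = 0" if y: "y \<in> vec.span B" for y
  proof -
    show *: "f 0 y = 0" using herm_onD(2)[OF f vec.span_zero y, of 0] by simp
    show "f y 0 = 0" using herm_onD(3)[OF f vec.span_zero y] unfolding * by simp
  qed
  have 1: "f b y = of_real c * cip b y" if b: "b \<in> B" for b
  proof -
    \<comment> \<open>Membership in the span goes through the induction along with the equation,
      because \<open>f\<close> is additive only there.\<close>
    from y have "y \<in> vec.span B \<and> f b y = of_real c * cip b y"
    proof (induction rule: vec.span_induct_alt)
      case base show ?case using 0(2)[OF vec.span_base[OF b]] by (simp add: cip_simps vec.span_zero)
    next
      case (step a b' z)
      have *: "b \<in> vec.span B" "b' \<in> vec.span B" "a *s b' \<in> vec.span B" "z \<in> vec.span B"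
        using b step by (simp_all add: vec.span_base vec.span_scale)
      have e1: "f b (a *s b' + z) = f b (a *s b') + f b z"
        by (rule herm_onD_right(1)[OF f vec.subspace_span *(1,3,4)])
      have e2: "f b (a *s b') = cnj a * f b b'"
        by (rule herm_onD_right(2)[OF f vec.subspace_span *(1,2)])
      have e3: "f b z = of_real c * cip b z" using step(2) by blast
      have e4: "f b b' = of_real c * cip b b'" by (rule B[OF b step(1)])
      have "f b (a *s b' + z) = of_real c * cip b (a *s b' + z)"
        unfolding e1 e2 e3 e4 cip_add_right cip_smult_right by (simp only: distrib_left mult.left_commute)
      then show ?case using vec.span_add[OF *(3,4)] by blast
    qed
    then show ?thesis by simp
  qed
  from x have "x \<in> vec.span B \<and> f x y = of_real c * cip x y"
  proof (induction rule: vec.span_induct_alt)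
    case base show ?case using 0(1)[OF y] by (simp add: cip_simps vec.span_zero)
  next
    case (step a b z)
    have *: "b \<in> vec.span B" "a *s b \<in> vec.span B" "z \<in> vec.span B"
      using step by (simp_all add: vec.span_base vec.span_scale)
    have "f (a *s b + z) y = a * f b y + f z y"
      using herm_onD(1)[OF f *(2,3) y] herm_onD(2)[OF f *(1) y] by simp
    then show ?case using 1[OF step(1)] step(2) vec.span_add[OF *(2,3)] by (simp add: cip_simps algebra_simps)
  qed
  then show ?thesis by simp
qed

lemma invariant_product_eq_hp:
  assumes h: "invariant_product G \<rho> (vec.span B1) (vec.span B2) h"
    and B1: "\<And>b b'. b \<in> B1 \<Longrightarrow> b' \<in> B1 \<Longrightarrow> h (b, 0) (b', 0) = of_real c1 * cip b b'"
    and B2: "\<And>b b'. b \<in> B2 \<Longrightarrow> b' \<in> B2 \<Longrightarrow> h (0, b) (0, b') = of_real c2 * cip b b'"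
    and x: "x \<in> vec.span B1 \<times> vec.span B2" and y: "y \<in> vec.span B1 \<times> vec.span B2"
  shows "h x y = hp c1 c2 x y"
proof -
  let ?V = "vec.span B1 \<times> vec.span B2"
  have hp: "hermitian_product ?V h" using h by (simp add: invariant_product_def)
  note hd = hp[unfolded hermitian_product_def]
  note hc = herm_on_components[OF hp vec.subspace_span vec.subspace_span]
  have add: "h (x + y) z = h x z + h y z" if "x \<in> ?V" "y \<in> ?V" "z \<in> ?V" for x y z
    using hd that by blast
  have sym: "h y x = cnj (h x y)" if "x \<in> ?V" "y \<in> ?V" for x y
    using hd that by blast
  have orth: "h (v, 0) (0, w) = 0" if "v \<in> vec.span B1" "w \<in> vec.span B2" for v w
    using h that by (simp add: invariant_product_def)
  obtain v w v' w' where xy: "x = (v, w)" "y = (v', w')" by fastforce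
  have in1: "(v, 0) \<in> ?V" "(v', 0) \<in> ?V" and in2: "(0, w) \<in> ?V" "(0, w') \<in> ?V"
    using x y xy by (auto intro: vec.span_zero)
  have "h x y = h (v, 0) y + h (0, w) y"
    using add[OF in1(1) in2(1) y] by (simp add: xy)
  also have "h (v, 0) y = cnj (h (v', 0) (v, 0) + h (0, w') (v, 0))"
    using sym[OF y in1(1)] add[OF in1(2) in2(2) in1(1)] by (simp add: xy)
  also have "\<dots> = h (v, 0) (v', 0)"
    using sym[OF in1(2,1)] sym[OF in1(1) in2(2)] orth x y by (simp add: xy)
  also have "h (0, w) y = cnj (h (v', 0) (0, w) + h (0, w') (0, w))"
    using sym[OF y in2(1)] add[OF in1(2) in2(2) in2(1)] by (simp add: xy)
  also have "\<dots> = h (0, w) (0, w')"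
    using sym[OF in2(2,1)] orth x y by (simp add: xy)
  also have "h (v, 0) (v', 0) = of_real c1 * cip v v'"
    using herm_on_span_eq[OF hc(1) B1] x y by (simp add: xy)
  also have "h (0, w) (0, w') = of_real c2 * cip w w'"
    using herm_on_span_eq[OF hc(2) B2] x y by (simp add: xy)
  finally show ?thesis by (simp add: hp_def xy)
qed

lemma cip_axis: "cip x (axis i 1) = x $ i" "cip (axis i 1) x = cnj (x $ i)"
  by (simp_all add: cip_def axis_def if_distrib if_distribR cong: if_cong)

lemma span_axis: "vec.span (range (\<lambda>i. axis i 1)) = (UNIV :: (complex ^ 'a::finite) set)"
proof -
  have "x \<in> vec.span (range (\<lambda>i. axis i 1))" for x :: "complex ^ 'a"
  proof -
    have "x = (\<Sum>i\<in>UNIV. x $ i *s axis i 1)" by (rule basis_expansion [symmetric])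
    also have "\<dots> \<in> vec.span (range (\<lambda>i. axis i 1))"
      by (intro vec.span_sum vec.span_scale vec.span_base rangeI)
    finally show ?thesis .
  qed
  then show ?thesis by blast
qed

text \<open>For orthogonal \<open>u\<close> and \<open>v\<close>, the value at u + v and u - v
  expands to f u u - f v v. Equal lengths thus follow from orthogonality statements alone.\<close>

lemma herm_on_pair_equal:
  assumes f: "herm_on V f" and V: "vec.subspace V" "u \<in> V" "v \<in> V"
    and uv: "f u v = 0" "f (u + v) (u - v) = 0"
  shows "f u u = f v v"
proof -
  have m: "u - v = u + (- 1) *s v" "(- 1) *s v \<in> V" "u + v \<in> V"
    using V by (auto simp: vec_eq_iff intro: vec.subspace_add vec.subspace_neg)
  have "f v u = 0" using herm_onD(3)[OF f V(2,3)] uv by simp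
  have "f (u + v) (u + (- 1) *s v) = f (u + v) u - f (u + v) v"
    unfolding herm_onD_right(1)[OF f V(1) m(3) V(2) m(2)] herm_onD_right(2)[OF f V(1) m(3) V(3)] by simp
  also have "\<dots> = f u u + f v u - (f u v + f v v)"
    using herm_onD(1)[OF f V(2,3)] V by simp
  finally have "f (u + v) (u - v) = f u u + f v u - (f u v + f v v)" by (simp only: m(1))
  then show ?thesis using uv \<open>f v u = 0\<close> by simp
qed

lemma herm_on_real_pos:
  assumes "herm_on V f" "x \<in> V" "x \<noteq> 0"
  shows "f x x = of_real (Re (f x x))" "0 < Re (f x x)"
proof -
  have "f x x = cnj (f x x)" by (rule herm_onD(3)[OF assms(1,2,2)])
  then have "Im (f x x) = Im (cnj (f x x))" by (rule arg_cong)
  then show "f x x = of_real (Re (f x x))" by (simp add: complex_eq_iff)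
  show "0 < Re (f x x)" by (rule herm_onD(4)[OF assms])
qed

text \<open>An elementary Schur lemma: orthogonality of the coordinate vectors makes
  \<open>f\<close> diagonal, and orthogonality of the normalized sum and difference of two of them
  makes the diagonal constant.\<close>

lemma schur_standard:
  fixes f :: "complex ^ 'a::finite \<Rightarrow> complex ^ 'a \<Rightarrow> complex"
  assumes f: "herm_on UNIV f"
    and orth: "\<And>u v. cip u u = 1 \<Longrightarrow> cip v v = 1 \<Longrightarrow> cip u v = 0 \<Longrightarrow> f u v = 0"
  shows "\<exists>c>0. \<forall>x y. f x y = of_real c * cip x y"
proof -
  let ?e = "\<lambda>i. axis i 1 :: complex ^ 'a"
  have ee: "cip (?e i) (?e j) = (if i = j then 1 else 0)" for i j
    by (simp add: cip_axis) (simp add: axis_def)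
  have 0: "f (?e i) (?e j) = 0" if "i \<noteq> j" for i j
    using that by (intro orth) (auto simp: ee)
  have eq: "f (?e i) (?e i) = f (?e j) (?e j)" for i j
  proof (cases "i = j")
    case False
    define a where "a = complex_of_real (1 / sqrt 2)"
    have a: "a * cnj a = 1 / 2" "a \<noteq> 0"
      by (auto simp: a_def simp flip: of_real_mult of_real_divide) (simp add: real_sqrt_mult_self)
    have "f (a *s (?e i + ?e j)) (a *s (?e i - ?e j)) = 0"
      using False a by (intro orth) (auto simp: cip_simps ee algebra_simps)
    moreover have "f (a *s (?e i + ?e j)) (a *s (?e i - ?e j)) = cnj a * (a * f (?e i + ?e j) (?e i - ?e j))"
      by (simp only: herm_onD(2)[OF f UNIV_I UNIV_I] herm_onD_right(2)[OF f vec.subspace_UNIV UNIV_I UNIV_I])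
    ultimately have "f (?e i + ?e j) (?e i - ?e j) = 0" using a(2) by simp
    then show ?thesis
      using 0[OF False] by (intro herm_on_pair_equal[OF f]) auto
  qed simp
  obtain i0 :: 'a where True by blast
  define c where "c = Re (f (?e i0) (?e i0))"
  have c: "f (?e i0) (?e i0) = of_real c" "0 < c"
    using herm_on_real_pos[OF f, of "?e i0"] by (auto simp: c_def axis_eq_0_iff)
  have "f b b' = of_real c * cip b b'" if "b \<in> range ?e" "b' \<in> range ?e" for b b'
    using that 0 c(1) eq[of _ i0] by (auto simp: ee)
  then have "f x y = of_real c * cip x y" for x y
    using f herm_on_span_eq[of "range ?e" f c x y] unfolding span_axis by blast
  with c(2) show ?thesis by blast
qed

text \<open>Eigenvectors of an isometry for eigenvalues \<open>a\<close> and \<open>b\<close> are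
  orthogonal unless a cnj b = 1, which for unimodular eigenvalues means a = b.\<close>

lemma herm_on_scaled_zero:
  assumes f: "herm_on V f" and V: "vec.subspace V" "u \<in> V" "v \<in> V"
    and inv: "f (a *s u) (b *s v) = f u v" and ab: "a * cnj b \<noteq> 1"
  shows "f u v = 0"
proof -
  have "a *s u \<in> V" "b *s v \<in> V" using V by (auto intro: vec.subspace_scale)
  then have "f (a *s u) (b *s v) = a * cnj b * f u v"
    using V by (simp add: herm_onD(2)[OF f] herm_onD_right(2)[OF f])
  then have "(a * cnj b - 1) * f u v = 0" using inv by (simp add: algebra_simps)
  then show ?thesis using ab by simp
qed

section \<open>Unitary matrices\<close>

definition outer :: "complex ^ 'a::finite \<Rightarrow> complex ^ 'a \<Rightarrow> complex ^ 'a ^ 'a" where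
  "outer x y = (\<chi> i j. x $ i * cnj (y $ j))"

lemma outer_mult_vec: "outer x y *v z = cip z y *s x"
  by (simp add: outer_def matrix_vector_mult_def cip_def vec_eq_iff sum_distrib_left sum_distrib_right ac_simps)

lemma mult_outer: "A ** outer x y = outer (A *v x) y"
  by (simp add: outer_def matrix_matrix_mult_def matrix_vector_mult_def vec_eq_iff sum_distrib_left sum_distrib_right ac_simps)

lemma outer_mult: "outer x y ** A = outer x (adj A *v y)"
  by (simp add: outer_def matrix_matrix_mult_def matrix_vector_mult_def adj_def vec_eq_iff
      sum_distrib_left ac_simps)

lemma adj_outer: "adj (outer x y) = outer y x"
  by (simp add: adj_def outer_def vec_eq_iff)

lemma adj_simps: "adj (A + B) = adj A + adj B" "adj (A - B) = adj A - adj B" "adj (adj A) = A"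
  "adj (mat 1) = mat 1" "adj (A ** B) = adj B ** adj A"
  by (auto simp: adj_def vec_eq_iff mat_def matrix_matrix_mult_def mult.commute)

lemma outer_scale_right: "outer x (c *s y) = outer (cnj c *s x) y"
  by (simp add: outer_def vec_eq_iff ac_simps)

text \<open>For orthonormal \<open>u\<close>, \<open>v\<close> this is diagonal with entries cis r,
  cis (-r) on \<open>u\<close>, \<open>v\<close> and the identity on their orthogonal complement;
  \<open>rot_gen u v\<close> is the generator. Over all orthonormal pairs the generators span the
  traceless skew-Hermitian matrices.\<close>

definition rot :: "complex ^ 'a::finite \<Rightarrow> complex ^ 'a \<Rightarrow> real \<Rightarrow> complex ^ 'a ^ 'a" where
  "rot u v r = mat 1 + outer ((cis r - 1) *s u) u + outer ((cis (- r) - 1) *s v) v"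

definition rot_gen :: "complex ^ 'a::finite \<Rightarrow> complex ^ 'a \<Rightarrow> complex ^ 'a ^ 'a" where
  "rot_gen u v = outer (\<i> *s u) u - outer (\<i> *s v) v"

definition orthonormal :: "complex ^ 'a::finite \<Rightarrow> complex ^ 'a \<Rightarrow> bool" where
  "orthonormal u v \<longleftrightarrow> cip u u = 1 \<and> cip v v = 1 \<and> cip u v = 0"

lemma orthonormalD:
  assumes "orthonormal u v"
  shows "cip u u = 1" "cip v v = 1" "cip u v = 0" "cip v u = 0"
  using assms cnj_cip[of u v] by (auto simp: orthonormal_def)

lemma rot_mult_vec:
  "rot u v r *v z = z + ((cis r - 1) * cip z u) *s u + ((cis (- r) - 1) * cip z v) *s v"
  by (simp add: rot_def matrix_vector_mult_add_rdistrib outer_mult_vec vec_eq_iff algebra_simps)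

lemma rot_gen_mult_vec: "rot_gen u v *v z = (\<i> * cip z u) *s u - (\<i> * cip z v) *s v"
  by (simp add: rot_gen_def matrix_vector_mult_diff_rdistrib outer_mult_vec vector_smult_assoc mult.commute)

lemma rot_mult_uv:
  assumes "orthonormal u v"
  shows "rot u v r *v u = cis r *s u" "rot u v r *v v = cis (- r) *s v"
    "cip z u = 0 \<Longrightarrow> cip z v = 0 \<Longrightarrow> rot u v r *v z = z"
  by (auto simp: rot_mult_vec orthonormalD[OF assms] vec_eq_iff algebra_simps)

lemma rot_0: "rot u v 0 = mat 1"
  by (simp add: rot_def outer_def vec_eq_iff)

lemma adj_rot: "adj (rot u v r) = rot u v (- r)"
  by (simp only: rot_def adj_simps adj_outer outer_scale_right complex_cnj_diff complex_cnj_one cis_cnj minus_minus)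

lemma rot_mult_rot:
  assumes "orthonormal u v"
  shows "rot u v r ** rot u v (- r) = mat 1"
proof -
  have "(rot u v r ** rot u v (- r)) *v z = mat 1 *v z" for z
  proof -
    define a where "a = cis r"
    have a: "cis (- r) = cnj a" "a * cnj a = 1"
      by (auto simp: a_def cis_cnj cis_mult)
    have aa: "a * (cnj a * c) = c" for c using a(2) by (simp flip: mult.assoc)
    have "(rot u v r ** rot u v (- r)) *v z = rot u v r *v (rot u v (- r) *v z)"
      by (rule matrix_vector_mul_assoc[symmetric])
    also have "\<dots> = z"
      unfolding rot_mult_vec
      by (simp add: cip_simps orthonormalD[OF assms] a a_def[symmetric] aa vec_eq_iff algebra_simps)
    finally show ?thesis by simp
  qed
  then show ?thesis by (simp add: matrix_eq)
qed

lemma rot_unitary: "orthonormal u v \<Longrightarrow> adj (rot u v r) ** rot u v r = mat 1"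
  using rot_mult_rot[of u v "- r"] by (simp add: adj_rot)

text \<open>The case of the one-parameter law that exhibits each rotation as a square, for the
  determinant.\<close>

lemma rot_double:
  assumes "orthonormal u v"
  shows "rot u v r ** rot u v r = rot u v (2 * r)"
proof -
  have "(rot u v r ** rot u v r) *v z = rot u v (2 * r) *v z" for z
  proof -
    have "(rot u v r ** rot u v r) *v z = rot u v r *v (rot u v r *v z)"
      by (rule matrix_vector_mul_assoc[symmetric])
    also have "\<dots> = rot u v (2 * r) *v z"
    proof -
      have "cis (2 * r) = cis r * cis r" "cis (- (2 * r)) = cis (- r) * cis (- r)"
        by (simp_all add: cis_mult)
      then show ?thesis
        unfolding rot_mult_vec
        by (simp add: cip_simps orthonormalD[OF assms] vec_eq_iff algebra_simps)
    qed
    finally show ?thesis .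
  qed
  then show ?thesis by (simp add: matrix_eq)
qed

lemma det_rot:
  assumes uv: "orthonormal u v"
  shows "det (rot u v r) = 1"
proof -
  have one: "det (rot u v t) * det (rot u v t) = 1" for t
  proof -
    \<comment> \<open>the reflection \<open>D\<close> exchanges \<open>u\<close> and \<open>v\<close>, so it conjugates \<open>rot u v t\<close> to its inverse\<close>
    define D where "D = mat 1 - outer (u - v) (u - v)"
    have Dz: "D *v z = z - (cip z u - cip z v) *s (u - v)" for z
      by (simp add: D_def matrix_vector_mult_diff_rdistrib outer_mult_vec cip_simps)
    have "(D ** D) *v z = mat 1 *v z" for z
      unfolding matrix_vector_mul_assoc[symmetric] Dz
      by (simp add: cip_simps orthonormalD[OF uv] vec_eq_iff algebra_simps)
    then have "D ** D = mat 1" by (simp add: matrix_eq)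
    then have "det D * det D = 1" by (metis det_I det_mul)
    then have D0: "det D \<noteq> 0" by auto
    have "(rot u v t ** D) *v z = (D ** rot u v (- t)) *v z" for z
      unfolding matrix_vector_mul_assoc[symmetric] Dz rot_mult_vec
      by (simp add: cip_simps orthonormalD[OF uv] vec_eq_iff algebra_simps)
    then have "rot u v t ** D = D ** rot u v (- t)" by (simp add: matrix_eq)
    then have "det (rot u v t) * det D = det D * det (rot u v (- t))" by (metis det_mul)
    then have "det (rot u v t) = det (rot u v (- t))" using D0 by simp
    moreover have "det (rot u v t) * det (rot u v (- t)) = 1"
      using rot_mult_rot[OF uv, of t] by (metis det_I det_mul)
    ultimately show ?thesis by simp
  qed
  \<comment> \<open>The determinant at half the angle squares to 1, and its square is the
    determinant at the full angle.\<close>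
  show ?thesis
    using one[of "r / 2"] rot_double[OF uv, of "r / 2"] by (metis det_mul field_sum_of_halves mult_2)
qed

lemma rot_has_vector_derivative: "(rot u v has_vector_derivative rot_gen u v) (at 0)"
proof -
  have bl: "bounded_linear (\<lambda>c. outer (c *s x) x)" for x :: "complex ^ 'a"
    by (auto intro!: linear_conv_bounded_linear[THEN iffD1] linearI
          simp: outer_def vec_eq_iff algebra_simps scaleR_conv_of_real[where 'a = complex])
  have d: "((\<lambda>r. cis (c * r) - 1) has_vector_derivative of_real c * \<i>) (at 0)" for c
    using has_derivative_cis[of "\<lambda>r. c * r" "\<lambda>r. c * r" 0 UNIV]
      by (auto simp: has_vector_derivative_def scaleR_conv_of_real[where 'a = complex] mult_ac
        intro!: derivative_eq_intros)
  have "((\<lambda>r. mat 1 + outer ((cis (1 * r) - 1) *s u) u + outer ((cis ((- 1) * r) - 1) *s v) v)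
    has_vector_derivative 0 + outer ((of_real 1 * \<i>) *s u) u + outer ((of_real (- 1) * \<i>) *s v) v) (at 0)"
    by (intro has_vector_derivative_add has_vector_derivative_const
        bounded_linear.has_vector_derivative[OF bl] d)
  moreover have "0 + outer ((of_real 1 * \<i>) *s u) u + outer ((of_real (- 1) * \<i>) *s v) v = rot_gen u v"
    by (simp add: rot_gen_def outer_def vec_eq_iff)
  ultimately show ?thesis by (simp add: rot_def[abs_def])
qed

lemma cip_rot_gen: "cip (rot_gen u v *v x) y = - cip x (rot_gen u v *v y)"
  by (simp add: rot_gen_mult_vec cip_simps cnj_cip)

lemma cip_self_eq_1: "cip x x = 1 \<longleftrightarrow> norm x = 1"
proof -
  have "cip x x = 1 \<longleftrightarrow> (norm x)\<^sup>2 = 1"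
    unfolding cip_self by (metis of_real_1 of_real_eq_iff)
  then show ?thesis by (simp add: abs_square_eq_1)
qed

lemma invariant_components:
  assumes h: "invariant_product G (dsum_rep \<rho>1 \<rho>2) V1 V2 h" and V: "vec.subspace V1" "vec.subspace V2"
    and 0: "\<And>g. g \<in> G \<Longrightarrow> \<rho>1 g 0 = 0" "\<And>g. g \<in> G \<Longrightarrow> \<rho>2 g 0 = 0"
  shows "herm_on V1 (\<lambda>x y. h (x, 0) (y, 0))" "herm_on V2 (\<lambda>x y. h (0, x) (0, y))"
    "\<And>g x y. g \<in> G \<Longrightarrow> x \<in> V1 \<Longrightarrow> y \<in> V1 \<Longrightarrow> h (\<rho>1 g x, 0) (\<rho>1 g y, 0) = h (x, 0) (y, 0)"
    "\<And>g x y. g \<in> G \<Longrightarrow> x \<in> V2 \<Longrightarrow> y \<in> V2 \<Longrightarrow> h (0, \<rho>2 g x) (0, \<rho>2 g y) = h (0, x) (0, y)"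
proof -
  have "hermitian_product (V1 \<times> V2) h" using h by (simp add: invariant_product_def)
  from herm_on_components[OF this V]
  show "herm_on V1 (\<lambda>x y. h (x, 0) (y, 0))" "herm_on V2 (\<lambda>x y. h (0, x) (0, y))" .
  have inv: "h (dsum_rep \<rho>1 \<rho>2 g x) (dsum_rep \<rho>1 \<rho>2 g y) = h x y"
    if "g \<in> G" "x \<in> V1 \<times> V2" "y \<in> V1 \<times> V2" for g x y
    using h that unfolding invariant_product_def by blast
  show "h (\<rho>1 g x, 0) (\<rho>1 g y, 0) = h (x, 0) (y, 0)" if "g \<in> G" "x \<in> V1" "y \<in> V1" for g x y
    using inv[OF that(1), of "(x, 0)" "(y, 0)"] that V by (simp add: dsum_rep_def 0 vec.subspace_0)
  show "h (0, \<rho>2 g x) (0, \<rho>2 g y) = h (0, x) (0, y)" if "g \<in> G" "x \<in> V2" "y \<in> V2" for g x y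
    using inv[OF that(1), of "(0, x)" "(0, y)"] that V by (simp add: dsum_rep_def 0 vec.subspace_0)
qed

section \<open>Scaling of base points, and complex spans of infinitesimal rotations\<close>

text \<open>Absorbs a Schur constant \<open>c\<close> into the base point: after scaling by
  \<open>a\<close>, the component carries the prescribed weight \<open>t\<close>.\<close>

lemma real_scalar:
  assumes "0 < c" "0 < t"
  shows "\<exists>a. a \<noteq> 0 \<and> cnj a = a \<and> of_real c * (a * a) = of_real t"
proof (intro exI[of _ "complex_of_real (sqrt (t / c))"] conjI)
  have "c * (sqrt (t / c) * sqrt (t / c)) = t" using assms by simp
  then show "of_real c * (complex_of_real (sqrt (t / c)) * complex_of_real (sqrt (t / c))) = of_real t"
    by (metis of_real_mult)
qed (use assms in auto)

lemma hp_scaled: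
  assumes "cnj a = a" "of_real c1 * (a * a) = of_real t1" "cnj b = b" "of_real c2 * (b * b) = of_real t2"
  shows "hp c1 c2 (a *s x, b *s y) (a *s v, b *s w) = of_real t1 * cip x v + of_real t2 * cip y w"
  unfolding assms(2,4)[symmetric] by (simp add: hp_def cip_simps assms(1,3))

lemma norm_scaled:
  assumes "cnj a = a" "of_real c * (a * a) = of_real t"
  shows "c * (norm (a *s v))\<^sup>2 = t * (norm v)\<^sup>2"
proof -
  have "of_real (c * (norm (a *s v))\<^sup>2) = of_real c * cip (a *s v) (a *s v)" by (simp add: cip_self)
  also have "\<dots> = of_real c * (a * a) * cip v v" by (simp add: cip_simps assms(1))
  also have "\<dots> = of_real (t * (norm v)\<^sup>2)" by (simp add: assms(2) cip_self)
  finally show ?thesis by (simp only: of_real_eq_iff)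
qed

lemma herm_on_rot_orth:
  assumes f: "herm_on UNIV f" and uv: "orthonormal u v"
    and inv: "\<And>x y. f (rot u v r *v x) (rot u v r *v y) = f x y" and r: "cis r * cis r \<noteq> 1"
  shows "f u v = 0"
proof (rule herm_on_scaled_zero[OF f vec.subspace_UNIV UNIV_I UNIV_I])
  show "f (cis r *s u) (cis (- r) *s v) = f u v"
    using inv[of u v] by (simp add: rot_mult_uv[OF uv])
  show "cis r * cnj (cis (- r)) \<noteq> 1" using r by (simp add: cis_cnj)
qed

text \<open>The first vector comes from the Cartan part of the Lie algebra, the second from the
  circle; k m + s is the determinant of the resulting system.\<close>

lemma csub_split:
  fixes k m s :: real
  assumes C: "csub C" and 1: "(x, - (of_real m *s y)) \<in> C" and 2: "(of_real k *s x, of_real s *s y) \<in> C"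
    and nz: "k * m + s \<noteq> 0"
  shows "(x, 0) \<in> C" "(0, y) \<in> C"
proof -
  have "cscale (1 / of_real (k * m + s)) ((of_real k *s x, of_real s *s y) - cscale (of_real k) (x, - (of_real m *s y))) \<in> C"
    by (intro csubD[OF C] 1 2)
  moreover have "cscale (1 / of_real (k * m + s)) ((of_real k *s x, of_real s *s y) - cscale (of_real k) (x, - (of_real m *s y)))
    = (0, (1 / of_real (k * m + s)) *s (of_real (k * m + s) *s y))"
    by (simp add: cscale_def vec_eq_iff algebra_simps)
  ultimately show y: "(0, y) \<in> C" using nz by (simp add: vector_smult_assoc del: of_real_add of_real_mult)
  have "(x, - (of_real m *s y)) + cscale (of_real m) (0, y) \<in> C"
    by (intro csubD[OF C] 1 y)
  then show "(x, 0) \<in> C" by (simp add: cscale_def)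
qed

lemma csub_circ_vel:
  assumes C: "csub C" and x: "circ_vel k s x \<in> C"
  shows "(of_real (real k) *s fst x, of_real (real s) *s snd x) \<in> C"
proof -
  have "cscale \<i> (circ_vel k s x) \<in> C" by (intro csubD[OF C] x)
  then show ?thesis by (simp add: circ_vel_def cscale_def vector_smult_assoc)
qed

lemma csub_unscale:
  assumes C: "csub C" and x: "cscale c x \<in> C" and c: "c \<noteq> 0"
  shows "x \<in> C"
proof -
  have "cscale (1 / c) (cscale c x) \<in> C" by (intro csubD[OF C] x)
  then show ?thesis using c by (simp add: cscale_def vector_smult_assoc)
qed

definition sesq :: "(complex ^ 'c::finite \<Rightarrow> complex ^ 'c \<Rightarrow> ('a::finite, 'b::finite) vsum) \<Rightarrow> bool" where
  "sesq \<Phi> \<longleftrightarrow> (\<forall>x y z. \<Phi> (x + y) z = \<Phi> x z + \<Phi> y z) \<and> (\<forall>x y z. \<Phi> z (x + y) = \<Phi> z x + \<Phi> z y) \<and>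
     (\<forall>c x y. \<Phi> (c *s x) y = cscale c (\<Phi> x y)) \<and> (\<forall>c x y. \<Phi> x (c *s y) = cscale (cnj c) (\<Phi> x y))"

lemma cscale_simps:
  "cscale a (cscale b x) = cscale (a * b) x" "cscale 1 x = x" "cscale a (x + y) = cscale a x + cscale a y"
  "cscale a (x - y) = cscale a x - cscale a y" "cscale a 0 = 0" "cscale 0 x = 0"
  "cscale (- a) x = - cscale a x" "cscale (a + b) x = cscale a x + cscale b x"
  by (simp_all add: cscale_def prod_eq_iff vec_eq_iff algebra_simps)

lemma sesq_polar:
  assumes \<Phi>: "sesq \<Phi>"
  shows "cscale (1 / 2) (\<Phi> (x + y) (x + y) - \<Phi> (x - y) (x - y)) = \<Phi> x y + \<Phi> y x"
    and "\<Phi> x (\<i> *s y) + \<Phi> (\<i> *s y) x = cscale \<i> (\<Phi> y x - \<Phi> x y)"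
proof -
  have neg: "\<Phi> (- y) z = - \<Phi> y z" "\<Phi> z (- y) = - \<Phi> z y" for y z
    using \<Phi>[unfolded sesq_def, THEN conjunct2, THEN conjunct2, THEN conjunct1, rule_format, of "- 1" y z]
      \<Phi>[unfolded sesq_def, THEN conjunct2, THEN conjunct2, THEN conjunct2, rule_format, of z "- 1" y]
    by (simp_all add: cscale_simps)
  have add: "\<Phi> (x + y) z = \<Phi> x z + \<Phi> y z" "\<Phi> z (x + y) = \<Phi> z x + \<Phi> z y" for x y z
    using \<Phi> unfolding sesq_def by blast+
  have scl: "\<Phi> (c *s x) y = cscale c (\<Phi> x y)" "\<Phi> x (c *s y) = cscale (cnj c) (\<Phi> x y)" for c x y
    using \<Phi> unfolding sesq_def by blast+
  show "cscale (1 / 2) (\<Phi> (x + y) (x + y) - \<Phi> (x - y) (x - y)) = \<Phi> x y + \<Phi> y x"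
  proof -
    have "\<Phi> (x - y) (x - y) = \<Phi> (x + - y) (x + - y)" by simp
    also have "\<dots> = \<Phi> x x - \<Phi> x y - \<Phi> y x + \<Phi> y y" by (simp only: add neg) simp
    finally have "\<Phi> (x + y) (x + y) - \<Phi> (x - y) (x - y) = cscale 2 (\<Phi> x y + \<Phi> y x)"
      by (simp add: add cscale_def prod_eq_iff vec_eq_iff)
    then show ?thesis by (simp add: cscale_simps)
  qed
  show "\<Phi> x (\<i> *s y) + \<Phi> (\<i> *s y) x = cscale \<i> (\<Phi> y x - \<Phi> x y)"
    unfolding scl by (simp add: cscale_simps)
qed

text \<open>The symmetrization at (x, y) plus \<i> times the one at (x, \<i> y) is 2 \<Phi> x y,
  since \<Phi> is conjugate linear in its second argument.\<close>

lemma sesq_mem: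
  assumes \<Phi>: "sesq \<Phi>" and C: "csub C"
    and sym: "\<Phi> x y + \<Phi> y x \<in> C" "\<Phi> x (\<i> *s y) + \<Phi> (\<i> *s y) x \<in> C"
  shows "\<Phi> x y \<in> C"
proof -
  have "cscale (1 / 2) ((\<Phi> x y + \<Phi> y x) + cscale \<i> (\<Phi> x (\<i> *s y) + \<Phi> (\<i> *s y) x)) \<in> C"
    by (intro csubD[OF C] sym)
  moreover have "(\<Phi> x y + \<Phi> y x) + cscale \<i> (\<Phi> x (\<i> *s y) + \<Phi> (\<i> *s y) x) = cscale 2 (\<Phi> x y)"
    unfolding sesq_polar(2)[OF \<Phi>] by (simp add: cscale_def prod_eq_iff vec_eq_iff)
  ultimately have "cscale (1 / 2) (cscale 2 (\<Phi> x y)) \<in> C" by (simp only:)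
  then show ?thesis by (simp add: cscale_simps)
qed

text \<open>For \<open>\<Phi> x y\<close> the action of the matrix \<open>outer x y\<close> on a base point: the complex span of the
  infinitesimal rotations is the action of sl(n).\<close>

lemma sesq_orthonormal_mem:
  assumes \<Phi>: "sesq \<Phi>" and C: "csub C"
    and rot: "\<And>u v. orthonormal u v \<Longrightarrow> cscale \<i> (\<Phi> u u - \<Phi> v v) \<in> C" and xy: "orthonormal x y"
  shows "\<Phi> x y \<in> C" "\<Phi> x x - \<Phi> y y \<in> C"
proof -
  have diff: "\<Phi> u u - \<Phi> v v \<in> C" if "orthonormal u v" for u v
    by (rule csub_unscale[OF C rot[OF that]]) simp
  have scl: "\<Phi> (c *s x) (c *s x) = cscale (c * cnj c) (\<Phi> x x)" for c x
    using \<Phi> by (simp add: sesq_def cscale_simps mult.commute)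
  have sym: "\<Phi> x y + \<Phi> y x \<in> C" if xy: "orthonormal x y" for x y
  proof -
    define a where "a = complex_of_real (1 / sqrt 2)"
    have a: "a * cnj a = 1 / 2"
      by (auto simp: a_def simp flip: of_real_mult of_real_divide) (simp add: real_sqrt_mult_self)
    have a': "a * (cnj a * c) = c / 2" for c using a by (simp flip: mult.assoc)
    \<comment> \<open>The normalized sum and difference form another orthonormal pair; the
      hypothesis for it is the polarized, symmetric statement.\<close>
    have "orthonormal (a *s (x + y)) (a *s (x - y))"
      unfolding orthonormal_def by (simp add: cip_simps orthonormalD[OF xy] a' algebra_simps)
    from diff[OF this] have "cscale (1 / 2) (\<Phi> (x + y) (x + y) - \<Phi> (x - y) (x - y)) \<in> C"
      by (simp only: scl a cscale_simps)
    then show ?thesis by (simp only: sesq_polar(1)[OF \<Phi>])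
  qed
  have "orthonormal x (\<i> *s y)"
    using orthonormalD[OF xy] by (simp add: orthonormal_def cip_simps)
  then show "\<Phi> x y \<in> C" using sesq_mem[OF \<Phi> C] sym xy by blast
  show "\<Phi> x x - \<Phi> y y \<in> C" by (rule diff[OF xy])
qed

lemma orthonormal_axis: "i \<noteq> j \<Longrightarrow> orthonormal (axis i 1) (axis j 1)"
  by (simp add: orthonormal_def cip_axis) (simp add: axis_def)

section \<open>The special unitary group\<close>

lemma SU_D: "A \<in> SU \<Longrightarrow> adj A ** A = mat 1" "A \<in> SU \<Longrightarrow> A ** adj A = mat 1"
  by (auto simp: SU_def matrix_left_right_inverse)

lemma mat1_SU: "mat 1 \<in> SU"
  by (simp add: SU_def adj_simps)

lemma mult_SU: "A \<in> SU \<Longrightarrow> B \<in> SU \<Longrightarrow> A ** B \<in> SU"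
proof -
  assume A: "A \<in> SU" and B: "B \<in> SU"
  have "adj (A ** B) ** (A ** B) = adj B ** ((adj A ** A) ** B)"
    by (simp add: adj_simps matrix_mul_assoc)
  then show ?thesis using A B by (simp add: SU_def det_mul)
qed

lemma adj_SU: "A \<in> SU \<Longrightarrow> adj A \<in> SU"
proof -
  assume A: "A \<in> SU"
  have "det (adj A) * det A = 1" using SU_D(1)[OF A] by (metis det_I det_mul)
  then show ?thesis using A SU_D(2)[OF A] by (simp add: SU_def adj_simps)
qed

lemma rot_SU: "orthonormal u v \<Longrightarrow> rot u v r \<in> SU"
  by (simp add: SU_def rot_unitary det_rot)

definition cnjv :: "complex ^ 'a::finite \<Rightarrow> complex ^ 'a" where
  "cnjv x = (\<chi> i. cnj (x $ i))"

text \<open>The entrywise conjugate. It agrees with \<open>dual_rep\<close> on unitary matrices, but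
  is multiplicative and real linear on all matrices, as needed for \<open>R2\<close>.\<close>

definition cnjm :: "complex ^ 'a::finite ^ 'a \<Rightarrow> complex ^ 'a ^ 'a" where
  "cnjm A = transpose (adj A)"

lemma cnjm_nth: "cnjm A $ i $ j = cnj (A $ i $ j)"
  by (simp add: cnjm_def transpose_def adj_def)

lemma cnjm_mult_vec: "cnjm A *v x = cnjv (A *v cnjv x)"
  by (simp add: cnjm_nth cnjv_def matrix_vector_mult_def vec_eq_iff)

lemma cnjv_simps: "cnjv (cnjv x) = x" "cnjv (x + y) = cnjv x + cnjv y" "cnjv (c *s x) = cnj c *s cnjv x"
  "cnjv (x - y) = cnjv x - cnjv y" "cnjv 0 = 0" "cnjv (axis i 1) = axis i 1"
  by (auto simp: cnjv_def vec_eq_iff axis_def)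

lemma cip_cnjv: "cip (cnjv x) (cnjv y) = cnj (cip x y)"
  by (simp add: cip_def cnjv_def)

lemma cnjm_mult: "cnjm (A ** B) = cnjm A ** cnjm B"
  by (simp add: cnjm_nth vec_eq_iff matrix_matrix_mult_def)

lemma cnjm_1: "cnjm (mat 1) = mat 1"
  by (simp add: cnjm_nth vec_eq_iff mat_def)

lemma bounded_linear_cnjm: "bounded_linear cnjm"
  by (auto intro!: linear_conv_bounded_linear[THEN iffD1] linearI simp: cnjm_nth vec_eq_iff)

lemma matrix_inv_unitary:
  assumes "adj A ** A = mat 1"
  shows "matrix_inv A = adj A"
proof -
  have "A ** adj A = mat 1" using assms by (simp add: matrix_left_right_inverse)
  then have "\<exists>B. A ** B = mat 1 \<and> B ** A = mat 1" using assms by blast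
  then have "A ** matrix_inv A = mat 1 \<and> matrix_inv A ** A = mat 1"
    unfolding matrix_inv_def by (rule someI_ex)
  then have "matrix_inv A = (adj A ** A) ** matrix_inv A" using assms by simp
  also have "\<dots> = adj A ** (A ** matrix_inv A)" by (simp only: matrix_mul_assoc)
  also have "\<dots> = adj A" using \<open>A ** matrix_inv A = mat 1 \<and> _\<close> by simp
  finally show ?thesis .
qed

lemma dual_rep_SU: "A \<in> SU \<Longrightarrow> dual_rep A f = cnjm A *v f"
  by (simp add: dual_rep_def cnjm_def matrix_inv_unitary SU_D)

lemma cnjm_SU: "A \<in> SU \<Longrightarrow> cnjm A \<in> SU"
proof -
  assume A: "A \<in> SU"
  have "adj (cnjm A) = cnjm (adj A)" by (simp add: vec_eq_iff adj_def cnjm_nth)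
  then have "adj (cnjm A) ** cnjm A = mat 1"
    using SU_D(1)[OF A] by (simp add: cnjm_1 flip: cnjm_mult)
  moreover have "det (cnjm A) = 1" using adj_SU[OF A] by (simp add: cnjm_def SU_def)
  ultimately show ?thesis by (simp add: SU_def)
qed

lemma cnjm_cnjm: "cnjm (cnjm A) = A"
  by (simp add: vec_eq_iff cnjm_nth)

lemma SU_inv: "A \<in> SU \<Longrightarrow> \<exists>B\<in>SU. B ** A = mat 1"
  using adj_SU SU_D(1) by blast

lemma cis_pi_half: "cis (pi / 2) * cis (pi / 2) \<noteq> 1"
  by (simp add: complex_eq_iff)

lemma SU_invariant_form:
  assumes f: "herm_on (UNIV :: (complex ^ 'a::finite) set) f" and inv: "\<And>A x y. A \<in> SU \<Longrightarrow> f (A *v x) (A *v y) = f x y"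
  shows "\<exists>c>0. \<forall>x y. f x y = of_real c * cip x y"
proof (rule schur_standard[OF f])
  fix u v :: "complex ^ 'a" assume "cip u u = 1" "cip v v = 1" "cip u v = 0"
  then have uv: "orthonormal u v" by (simp add: orthonormal_def)
  show "f u v = 0"
    using herm_on_rot_orth[where f = f, OF f uv _ cis_pi_half] inv[OF rot_SU[OF uv]] by blast
qed

lemma invariant_product_UNIV_eq_hp:
  assumes h: "invariant_product G \<rho> UNIV UNIV h"
    and "\<forall>x y. h (x, 0) (y, 0) = of_real c1 * cip x y" "\<forall>x y. h (0, x) (0, y) = of_real c2 * cip x y"
  shows "h x y = hp c1 c2 x y"
  using invariant_product_eq_hp[of G \<rho> UNIV UNIV h c1 c2 x y] assms unfolding vec.span_UNIV by simp

lemma SU_standard_dual: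
  fixes h :: "('n::finite, 'n) vsum \<Rightarrow> ('n, 'n) vsum \<Rightarrow> complex"
  assumes n: "2 \<le> CARD('n)" and ks: "0 < k" "0 < s"
    and h: "invariant_product SU (dsum_rep std_rep dual_rep) UNIV UNIV h"
  shows "admits_lagrangian_orbit SU (dsum_rep std_rep dual_rep) UNIV UNIV h k s"
proof -
  note hc = invariant_components[OF h vec.subspace_UNIV vec.subspace_UNIV]
  have zero: "std_rep A 0 = 0" "dual_rep A 0 = 0" for A :: "complex ^ 'n ^ 'n"
    by (simp_all add: std_rep_def dual_rep_def)
  obtain c1 where c1: "0 < c1" "\<forall>x y. h (x, 0) (y, 0) = of_real c1 * cip x y"
    using SU_invariant_form[OF hc(1)[OF zero]] hc(3)[OF zero] unfolding std_rep_def by blast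
  \<comment> \<open>Conjugation is an automorphism of SU, so invariance under the dual
    representation is invariance under the standard one.\<close>
  have "h (0, A *v x) (0, A *v y) = h (0, x) (0, y)" if "A \<in> SU" for A x y
    using hc(4)[OF zero cnjm_SU[OF that] UNIV_I UNIV_I] cnjm_SU[OF that] by (simp add: dual_rep_SU cnjm_cnjm)
  then obtain c2 where c2: "0 < c2" "\<forall>x y. h (0, x) (0, y) = of_real c2 * cip x y"
    using SU_invariant_form[OF hc(2)[OF zero]] by blast
  note h_eq = invariant_product_UNIV_eq_hp[OF h c1(2) c2(2)]
  obtain o' j :: 'n where oj: "j \<noteq> o'"
    using n by (metis One_nat_def card_2_iff' ex_card)
  \<comment> \<open>Equal weights \<open>t\<close> in both components let the moment map of SU
    cancel; k t + s t = 1 is the level condition.\<close>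
  define t where "t = 1 / (real k + real s)"
  have t: "0 < t" "real k * t + real s * t = 1" using ks by (auto simp: t_def simp flip: add_divide_distrib)
  obtain a where a: "a \<noteq> 0" "cnj a = a" "of_real c1 * (a * a) = of_real t"
    using real_scalar[OF c1(1) t(1)] by blast
  obtain b where b: "b \<noteq> 0" "cnj b = b" "of_real c2 * (b * b) = of_real t"
    using real_scalar[OF c2(1) t(1)] by blast
  define e where "e = (axis o' 1 :: complex ^ 'n)"
  have norm_e: "norm e = 1" by (simp add: e_def cip_self_eq_1[symmetric] cip_axis)
  define p where "p = (a *s e, b *s e)"
  have p: "fst p = a *s axis o' 1" "snd p = b *s axis o' 1" by (simp_all add: p_def e_def)
  define S where "S = {(rot_gen u v, cnjm (rot_gen u v)) | u v :: complex ^ 'n. orthonormal u v}"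
  have "isotropic_orbit SU std_rep dual_rep (\<lambda>A. A) cnjm UNIV UNIV h c1 c2 k s S p"
  proof (rule isotropic_orbit.intro)
    fix X1 X2 assume "(X1, X2) \<in> S"
    then obtain u v where uv: "orthonormal u v" and X: "X1 = rot_gen u v" "X2 = cnjm (rot_gen u v)"
      by (auto simp: S_def)
    show "\<exists>\<gamma>::real \<Rightarrow> _. (\<forall>r. \<gamma> r \<in> SU) \<and> \<gamma> 0 = mat 1 \<and> (\<gamma> has_vector_derivative X1) (at 0) \<and>
        ((\<lambda>r. cnjm (\<gamma> r)) has_vector_derivative X2) (at 0)"
      unfolding X by (intro exI[of _ "rot u v"] conjI allI rot_SU uv rot_0 rot_has_vector_derivative
          bounded_linear.has_vector_derivative[OF bounded_linear_cnjm])
    fix g :: "complex ^ 'n ^ 'n"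
    define w where "w = g *v e"
    \<comment> \<open>\<open>e\<close> is real, so every translate of the base point again pairs a
      vector with its conjugate.\<close>
    have q: "act2 g (cnjm g) p = (a *s w, b *s cnjv w)"
      by (simp add: p_def act2_def w_def vec.scale cnjm_mult_vec cnjv_simps b e_def)
    define z where "z = cip (rot_gen u v *v w) w"
    \<comment> \<open>\<open>z\<close> is imaginary because the generator is skew-Hermitian; the
      conjugate component contributes \<open>cnj z\<close> with the same weight.\<close>
    have z: "z + cnj z = 0" using cip_rot_gen[of u v w w] by (simp add: z_def cnj_cip)
    have "act2 X1 X2 (a *s w, b *s cnjv w) = (a *s (X1 *v w), b *s cnjv (X1 *v w))"
      by (simp add: act2_def X vec.scale cnjm_mult_vec cnjv_simps b)
    then have "hp c1 c2 (act2 X1 X2 (act2 g (cnjm g) p)) (act2 g (cnjm g) p) = of_real t * (z + cnj z)"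
      by (simp add: q hp_scaled[OF a(2,3) b(2,3)] X z_def cip_cnjv distrib_left)
    then show "hp c1 c2 (act2 X1 X2 (act2 g (cnjm g) p)) (act2 g (cnjm g) p) = 0" by (simp add: z)
  next
    fix C :: "('n, 'n) vsum set"
    assume C: "csub C" and cv: "circ_vel k s p \<in> C" and SC: "\<And>X1 X2. (X1, X2) \<in> S \<Longrightarrow> act2 X1 X2 p \<in> C"
    \<comment> \<open>The complex linear extension of the dual action is minus the transpose; it
      agrees with the conjugate matrix only on skew-Hermitian matrices. The second component is
      minus the transpose of \<open>outer x y\<close> applied to \<open>snd p\<close>.\<close>
    define \<Phi> :: "complex ^ 'n \<Rightarrow> complex ^ 'n \<Rightarrow> ('n, 'n) vsum" where
      "\<Phi> = (\<lambda>x y. (cip (fst p) y *s x, - (cip x (cnjv (snd p)) *s cnjv y)))"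
    have \<Phi>: "sesq \<Phi>"
      by (simp add: sesq_def \<Phi>_def cip_simps cnjv_simps cscale_def vec_eq_iff algebra_simps)
    have rot: "cscale \<i> (\<Phi> u u - \<Phi> v v) \<in> C" if "orthonormal u v" for u v
    proof -
      have "(rot_gen u v, cnjm (rot_gen u v)) \<in> S" using that by (auto simp: S_def)
      from SC[OF this] show ?thesis
        by (simp add: \<Phi>_def act2_def rot_gen_mult_vec cscale_def cnjm_mult_vec cnjv_simps
            cnj_cip vec_eq_iff algebra_simps)
    qed
    note mem = sesq_orthonormal_mem[OF \<Phi> C rot orthonormal_axis]
    have ax: "axis i (1 :: complex) $ j = (if i = j then 1 else 0)" for i j :: 'n by (simp add: axis_def)
    have 1: "(axis i 1, 0) \<in> C" if i: "i \<noteq> o'" for i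
    proof (rule csub_unscale[OF C _ a(1)])
      have "\<Phi> (axis i 1) (axis o' 1) = cscale a (axis i 1, 0)"
        using i by (simp add: \<Phi>_def p cip_simps cnjv_simps cip_axis ax cscale_def)
      then show "cscale a (axis i 1, 0) \<in> C" using mem(1)[of i o'] i by simp
    qed
    have 2: "(0, axis i 1) \<in> C" if i: "i \<noteq> o'" for i
    proof (rule csub_unscale[OF C, of "- b"])
      have "\<Phi> (axis o' 1) (axis i 1) = cscale (- b) (0, axis i 1)"
        using i by (simp add: \<Phi>_def p cip_simps cnjv_simps cip_axis ax cscale_def)
      then show "cscale (- b) (0, axis i 1) \<in> C" using mem(1)[of o' i] i by simp
    qed (use b in simp)
    \<comment> \<open>Only the axis \<open>o'\<close> of either summand is still missing. A
      traceless diagonal matrix, available because a second index \<open>j\<close> exists, yields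
      both with opposite signs (m = 1), and the circle separates them.\<close>
    have "\<Phi> (axis o' 1) (axis o' 1) - \<Phi> (axis j 1) (axis j 1) = (a *s axis o' 1, - (of_real 1 *s (b *s axis o' 1)))"
      using oj by (simp add: \<Phi>_def p cip_simps cnjv_simps cip_axis ax cscale_def)
    then have "(a *s axis o' 1, - (of_real 1 *s (b *s axis o' 1))) \<in> C" using mem(2)[of o' j] oj by simp
    from csub_split[OF C this csub_circ_vel[OF C cv, unfolded p]] ks
    have "cscale a (axis o' 1, 0) \<in> C" "cscale b (0, axis o' 1) \<in> C"
      by (simp_all add: cscale_def)
    then have "(axis o' 1, 0) \<in> C" "(0, axis o' 1) \<in> C"
      using csub_unscale[OF C] a(1) b(1) by blast+
    with 1 2 have "(axis i 1, 0) \<in> C" "(0, axis i 1) \<in> C" for i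
      by (cases "i = o'"; simp)+
    then have "vec.span (range (\<lambda>i. axis i 1)) \<times> vec.span (range (\<lambda>i. axis i 1)) \<subseteq> C"
      by (intro csub_Times[OF C]) auto
    then show "UNIV \<times> UNIV \<subseteq> C" by (simp only: span_axis)
  qed (use ks c1(1) c2(1) h_eq a b t norm_scaled[OF a(2,3), of e] norm_scaled[OF b(2,3), of e] norm_e
      in \<open>auto simp: p_def std_rep_def dual_rep_SU mat1_SU mult_SU SU_inv cnjm_1 cnjm_mult SU_D cnjm_SU\<close>)
  then show ?thesis by (rule isotropic_orbit.lagrangian_orbit)
qed

section \<open>The compact symplectic group\<close>

definition jm :: "complex ^ ('q::finite + 'q) \<Rightarrow> complex ^ ('q + 'q)" where
  "jm x = (\<chi> a. case a of Inl i \<Rightarrow> cnj (x $ Inr i) | Inr i \<Rightarrow> - cnj (x $ Inl i))"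

lemma jm_nth: "jm x $ Inl i = cnj (x $ Inr i)" "jm x $ Inr i = - cnj (x $ Inl i)"
  by (simp_all add: jm_def)

lemma sum_UNIV_Plus: "(\<Sum>a\<in>UNIV. g a) = (\<Sum>i\<in>UNIV. g (Inl i)) + (\<Sum>i\<in>UNIV. g (Inr i))"
  for g :: "'a::finite + 'b::finite \<Rightarrow> complex"
  by (simp add: UNIV_Plus_UNIV[symmetric] sum.Plus del: UNIV_Plus_UNIV)

lemma vec_eq_Plus: "x = y \<longleftrightarrow> (\<forall>i. x $ Inl i = y $ Inl i) \<and> (\<forall>i. x $ Inr i = y $ Inr i)"
  for x y :: "complex ^ ('a::finite + 'b::finite)"
  by (metis obj_sumE vec_eq_iff)

lemma sympl_J_mult: "sympl_J *v cnjv x = jm x"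
  by (simp add: vec_eq_Plus jm_nth matrix_vector_mult_def sum_UNIV_Plus sympl_J_def cnjv_def
      if_distrib if_distribR cong: if_cong)

lemma jm_simps: "jm (x + y) = jm x + jm y" "jm (x - y) = jm x - jm y" "jm (c *s x) = cnj c *s jm x"
  "jm (jm x) = - x" "jm (- x) = - jm x" "jm 0 = 0"
  by (simp_all add: vec_eq_Plus jm_nth)

lemma cip_jm_jm: "cip (jm x) (jm y) = cip y x"
  by (simp add: cip_def sum_UNIV_Plus jm_nth mult.commute add.commute)

lemma cip_jm_right: "cip x (jm y) = - cip y (jm x)"
  by (simp add: cip_def sum_UNIV_Plus jm_nth sum_negf mult.commute)

lemma cip_jm_left: "cip (jm x) y = - cip (jm y) x"
proof -
  have "- cip (jm x) y = cip (jm y) x" using cip_jm_jm[of x "jm y"] by (simp add: jm_simps cip_simps)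
  then show ?thesis by (metis minus_minus)
qed

lemma cip_jm_self: "cip x (jm x) = 0" "cip (jm x) x = 0"
  using cip_jm_right[of x x] cip_jm_left[of x x] by simp_all

lemma cnjm_sympl_J: "cnjm sympl_J = sympl_J"
  by (auto simp: vec_eq_iff cnjm_nth sympl_J_def split: sum.split)

text \<open>For unitary \<open>A\<close> the inverse transpose is \<open>cnjm A\<close>, so
  preserving the form reads J A = cnjm A J. As J is real, conjugating gives commutation with the
  antilinear map \<open>jm\<close>, which is J after conjugation.\<close>

lemma Sp_iff: "A \<in> Sp \<longleftrightarrow> adj A ** A = mat 1 \<and> (\<forall>x. A *v jm x = jm (A *v x))"
proof (cases "adj A ** A = mat 1")
  case True
  then have "A ** adj A = mat 1" by (simp add: matrix_left_right_inverse)
  then have 1: "cnjm A ** transpose A = mat 1"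
    by (simp add: cnjm_def flip: matrix_transpose_mul)
  then have 2: "transpose A ** cnjm A = mat 1" by (simp add: matrix_left_right_inverse)
  have "transpose A ** sympl_J ** A = sympl_J \<longleftrightarrow> sympl_J ** A = cnjm A ** sympl_J"
  proof
    assume *: "transpose A ** sympl_J ** A = sympl_J"
    have "cnjm A ** (transpose A ** sympl_J ** A) = (cnjm A ** transpose A) ** (sympl_J ** A)"
      by (simp only: matrix_mul_assoc)
    then show "sympl_J ** A = cnjm A ** sympl_J" by (simp only: * 1 matrix_mul_lid)
  next
    assume *: "sympl_J ** A = cnjm A ** sympl_J"
    have "transpose A ** sympl_J ** A = transpose A ** (sympl_J ** A)"
      by (simp only: matrix_mul_assoc)
    also have "\<dots> = (transpose A ** cnjm A) ** sympl_J" unfolding * by (simp only: matrix_mul_assoc)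
    finally show "transpose A ** sympl_J ** A = sympl_J" by (simp only: 2 matrix_mul_lid)
  qed
  also have "\<dots> \<longleftrightarrow> cnjm (sympl_J ** A) = cnjm (cnjm A ** sympl_J)"
    by (metis cnjm_cnjm)
  also have "\<dots> \<longleftrightarrow> sympl_J ** cnjm A = A ** sympl_J"
    by (simp only: cnjm_cnjm cnjm_mult cnjm_sympl_J)
  also have "\<dots> \<longleftrightarrow> (\<forall>x. sympl_J *v (cnjm A *v x) = A *v (sympl_J *v x))"
    by (simp add: matrix_eq matrix_vector_mul_assoc)
  also have "\<dots> \<longleftrightarrow> (\<forall>x. sympl_J *v (cnjm A *v cnjv x) = A *v (sympl_J *v cnjv x))"
    by (metis cnjv_simps(1))
  also have "\<dots> \<longleftrightarrow> (\<forall>x. A *v jm x = jm (A *v x))"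
    by (simp add: cnjm_mult_vec cnjv_simps sympl_J_mult) metis
  finally show ?thesis using True by (simp add: Sp_def)
qed (simp add: Sp_def)

lemma Sp_D: "A \<in> Sp \<Longrightarrow> adj A ** A = mat 1" "A \<in> Sp \<Longrightarrow> A ** adj A = mat 1"
  "A \<in> Sp \<Longrightarrow> A *v jm x = jm (A *v x)"
  by (auto simp: Sp_iff matrix_left_right_inverse)

lemma mat1_Sp: "mat 1 \<in> Sp"
  by (simp add: Sp_iff adj_simps)

lemma mult_Sp: "A \<in> Sp \<Longrightarrow> B \<in> Sp \<Longrightarrow> A ** B \<in> Sp"
proof -
  assume A: "A \<in> Sp" and B: "B \<in> Sp"
  have "adj (A ** B) ** (A ** B) = adj B ** ((adj A ** A) ** B)"
    by (simp add: adj_simps matrix_mul_assoc)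
  then show ?thesis using A B by (simp add: Sp_iff flip: matrix_vector_mul_assoc)
qed

lemma adj_Sp: "A \<in> Sp \<Longrightarrow> adj A \<in> Sp"
proof -
  assume A: "A \<in> Sp"
  have "adj A *v jm x = jm (adj A *v x)" for x
  proof -
    have "adj A *v jm (A *v (adj A *v x)) = jm (adj A *v x)"
      by (simp only: Sp_D(3)[OF A, symmetric]) (simp add: matrix_vector_mul_assoc Sp_D(1)[OF A])
    then show ?thesis by (simp add: matrix_vector_mul_assoc Sp_D(2)[OF A])
  qed
  then show ?thesis using Sp_D(2)[OF A] by (simp add: Sp_iff adj_simps)
qed

lemma orthonormal_jm: "cip u u = 1 \<Longrightarrow> orthonormal u (jm u)"
  by (simp add: orthonormal_def cip_jm_jm cip_jm_self)

text \<open>Since \<open>jm\<close> is antilinear, commuting with it forces the eigenvalue on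
  \<open>jm u\<close> to be the conjugate of that on \<open>u\<close>, exactly as in
  \<open>rot\<close>.\<close>

lemma rot_Sp:
  assumes "cip u u = 1"
  shows "rot u (jm u) r \<in> Sp"
proof -
  have "rot u (jm u) r *v jm z = jm (rot u (jm u) r *v z)" for z
  proof -
    have "cip (jm z) u = - cnj (cip z (jm u))" "cip (jm z) (jm u) = cnj (cip z u)"
      by (simp_all add: cip_jm_jm cnj_cip cip_jm_left[of z])
    then show ?thesis
      by (simp add: rot_mult_vec jm_simps cis_cnj vec_eq_iff)
  qed
  then show ?thesis using rot_unitary[OF orthonormal_jm[OF assms]] by (simp add: Sp_iff)
qed

lemma rot_gen_jm: "rot_gen u (jm u) *v jm z = jm (rot_gen u (jm u) *v z)"
proof -
  have "cip (jm z) u = - cnj (cip z (jm u))" "cip (jm z) (jm u) = cnj (cip z u)"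
    by (simp_all add: cip_jm_jm cnj_cip cip_jm_left[of z])
  then show ?thesis
    by (simp add: rot_gen_mult_vec jm_simps vec_eq_iff)
qed

text \<open>Not every orthonormal pair gives a rotation in \<open>Sp\<close>, so \<open>v\<close> is
  split into its \<open>jm u\<close> part and a rest \<open>w\<close>. The quarter rotation for
  \<open>u\<close>, \<open>jm u\<close> has eigenvalues \<i>, - \<i> and 1 on \<open>u\<close>,
  \<open>jm u\<close> and \<open>w\<close>.\<close>

lemma herm_on_Sp_orth:
  assumes f: "herm_on UNIV f" and u: "cip u u = 1" and v: "cip u v = 0"
    and inv: "\<And>x y. f (rot u (jm u) (pi / 2) *v x) (rot u (jm u) (pi / 2) *v y) = f x y"
  shows "f u v = 0"
proof -
  note uj = orthonormal_jm[OF u]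
  define w where "w = v - cip v (jm u) *s jm u"
  have vu: "cip v u = 0" using v cnj_cip[of u v] by simp
  have w: "cip w u = 0" "cip w (jm u) = 0"
    by (simp_all add: w_def cip_simps vu cip_jm_self cip_jm_jm u)
  have "f u (jm u) = 0" using herm_on_rot_orth[where f = f, OF f uj _ cis_pi_half] inv by blast
  moreover have "f u w = 0"
  proof (rule herm_on_scaled_zero[OF f vec.subspace_UNIV UNIV_I UNIV_I])
    show "f (cis (pi / 2) *s u) (1 *s w) = f u w"
      using inv[of u w] by (simp add: rot_mult_uv(1)[OF uj] rot_mult_uv(3)[OF uj w])
    show "cis (pi / 2) * cnj 1 \<noteq> 1" by (simp add: complex_eq_iff)
  qed
  moreover have "f u (w + cip v (jm u) *s jm u) = f u w + f u (cip v (jm u) *s jm u)"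
    "f u (cip v (jm u) *s jm u) = cnj (cip v (jm u)) * f u (jm u)"
    by (rule herm_onD_right(1)[OF f vec.subspace_UNIV UNIV_I UNIV_I UNIV_I])
      (rule herm_onD_right(2)[OF f vec.subspace_UNIV UNIV_I UNIV_I])
  ultimately show ?thesis by (simp add: w_def)
qed

lemma Sp_inv: "A \<in> Sp \<Longrightarrow> \<exists>B\<in>Sp. B ** A = mat 1"
  using adj_Sp Sp_D(1) by blast

lemma Sp_invariant_form:
  assumes f: "herm_on (UNIV :: (complex ^ ('q::finite + 'q)) set) f"
    and inv: "\<And>A x y. A \<in> Sp \<Longrightarrow> f (A *v x) (A *v y) = f x y"
  shows "\<exists>c>0. \<forall>x y. f x y = of_real c * cip x y"
proof (rule schur_standard[OF f])
  fix u v :: "complex ^ ('q + 'q)" assume u: "cip u u = 1" "cip v v = 1" "cip u v = 0"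
  show "f u v = 0"
    using herm_on_Sp_orth[where f = f, OF f u(1,3)] inv[OF rot_Sp[OF u(1)]] by blast
qed

lemma Sp_standard_standard:
  fixes h :: "('q::finite + 'q, 'q + 'q) vsum \<Rightarrow> ('q + 'q, 'q + 'q) vsum \<Rightarrow> complex"
  assumes ks: "0 < k" "0 < s"
    and h: "invariant_product Sp (dsum_rep std_rep std_rep) UNIV UNIV h"
  shows "admits_lagrangian_orbit Sp (dsum_rep std_rep std_rep) UNIV UNIV h k s"
proof -
  note hc = invariant_components[OF h vec.subspace_UNIV vec.subspace_UNIV]
  have zero: "std_rep A 0 = 0" "std_rep A 0 = 0" for A :: "complex ^ ('q + 'q) ^ ('q + 'q)"
    by (simp_all add: std_rep_def)
  obtain c1 where c1: "0 < c1" "\<forall>x y. h (x, 0) (y, 0) = of_real c1 * cip x y"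
    using Sp_invariant_form[OF hc(1)[OF zero]] hc(3)[OF zero] unfolding std_rep_def by blast
  obtain c2 where c2: "0 < c2" "\<forall>x y. h (0, x) (0, y) = of_real c2 * cip x y"
    using Sp_invariant_form[OF hc(2)[OF zero]] hc(4)[OF zero] unfolding std_rep_def by blast
  note h_eq = invariant_product_UNIV_eq_hp[OF h c1(2) c2(2)]
  define t where "t = 1 / (real k + real s)"
  have t: "0 < t" "real k * t + real s * t = 1" using ks by (auto simp: t_def simp flip: add_divide_distrib)
  obtain a where a: "a \<noteq> 0" "cnj a = a" "of_real c1 * (a * a) = of_real t"
    using real_scalar[OF c1(1) t(1)] by blast
  obtain b where b: "b \<noteq> 0" "cnj b = b" "of_real c2 * (b * b) = of_real t"
    using real_scalar[OF c2(1) t(1)] by blast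
  define e :: "complex ^ ('q + 'q)" where "e = axis (Inl undefined) 1"
  define f where "f = jm e"
  have e: "cip e e = 1" by (simp add: e_def cip_axis)
  have ef: "cip f f = 1" "cip e f = 0" "cip f e = 0" "jm e = f" "jm f = - e"
    by (simp_all add: f_def cip_jm_jm cip_jm_self e jm_simps)
  have norm_ef: "norm e = 1" "norm f = 1"
    using e ef(1) by (simp_all add: cip_self_eq_1)
  define p where "p = (a *s e, b *s f)"
  have p: "fst p = a *s e" "snd p = b *s f" by (simp_all add: p_def)
  define S where "S = {(rot_gen u (jm u), rot_gen u (jm u)) | u :: complex ^ ('q + 'q). cip u u = 1}"
  have "isotropic_orbit Sp std_rep std_rep (\<lambda>A. A) (\<lambda>A. A) UNIV UNIV h c1 c2 k s S p"
  proof (rule isotropic_orbit.intro)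
    fix X1 X2 assume "(X1, X2) \<in> S"
    then obtain u where u: "cip u u = 1" and X: "X1 = rot_gen u (jm u)" "X2 = rot_gen u (jm u)"
      by (auto simp: S_def)
    show "\<exists>\<gamma>::real \<Rightarrow> _. (\<forall>r. \<gamma> r \<in> Sp) \<and> \<gamma> 0 = mat 1 \<and> (\<gamma> has_vector_derivative X1) (at 0) \<and>
        (\<gamma> has_vector_derivative X2) (at 0)"
      unfolding X by (intro exI[of _ "rot u (jm u)"] conjI allI rot_Sp u rot_0 rot_has_vector_derivative)
    fix g :: "complex ^ ('q + 'q) ^ ('q + 'q)" assume g: "g \<in> Sp"
    define w where "w = g *v e"
    have q: "act2 g g p = (a *s w, b *s jm w)"
      using g by (simp add: p_def act2_def w_def vec.scale f_def Sp_D)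
    define z where "z = cip (rot_gen u (jm u) *v w) w"
    have z: "z + cnj z = 0" using cip_rot_gen[of u "jm u" w w] by (simp add: z_def cnj_cip)
    have "act2 X1 X2 (a *s w, b *s jm w) = (a *s (X1 *v w), b *s jm (X1 *v w))"
      by (simp add: act2_def X vec.scale rot_gen_jm)
    \<comment> \<open>\<open>jm\<close> commutes with the generator and reverses \<open>cip\<close>,
      so the second component contributes \<open>cnj z\<close>.\<close>
    then have "hp c1 c2 (act2 X1 X2 (act2 g g p)) (act2 g g p) = of_real t * (z + cnj z)"
      by (simp add: q hp_scaled[OF a(2,3) b(2,3)] X z_def cip_jm_jm cnj_cip distrib_left)
    then show "hp c1 c2 (act2 X1 X2 (act2 g g p)) (act2 g g p) = 0" by (simp add: z)
  next
    fix C :: "('q + 'q, 'q + 'q) vsum set"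
    assume C: "csub C" and cv: "circ_vel k s p \<in> C" and SC: "\<And>X1 X2. (X1, X2) \<in> S \<Longrightarrow> act2 X1 X2 p \<in> C"
    define \<Phi> :: "complex ^ ('q + 'q) \<Rightarrow> complex ^ ('q + 'q) \<Rightarrow> ('q + 'q, 'q + 'q) vsum" where
      \<comment> \<open>The action of \<open>outer x y - outer (jm y) (jm x)\<close>, an element of
        the complexified Lie algebra of \<open>Sp\<close>; its diagonal values are the generators in
        \<open>S\<close> up to \<i>. No orthogonality of \<open>x\<close> and \<open>y\<close> is
        required here.\<close>
      "\<Phi> = (\<lambda>x y. (cip (fst p) y *s x - cip (fst p) (jm x) *s jm y, cip (snd p) y *s x - cip (snd p) (jm x) *s jm y))"
    have \<Phi>: "sesq \<Phi>"
      by (simp add: sesq_def \<Phi>_def cip_simps jm_simps cscale_def vec_eq_iff algebra_simps)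
    have unit: "\<Phi> u u \<in> C" if u: "cip u u = 1" for u
    proof (rule csub_unscale[OF C])
      have "(rot_gen u (jm u), rot_gen u (jm u)) \<in> S" using u by (auto simp: S_def)
      from SC[OF this] show "cscale \<i> (\<Phi> u u) \<in> C"
        by (simp add: \<Phi>_def act2_def rot_gen_mult_vec cscale_def vec_eq_iff algebra_simps)
    qed simp
    have diag: "\<Phi> u u \<in> C" for u
    proof (cases "u = 0")
      case True
      then show ?thesis using csubD(1)[OF C] by (simp add: \<Phi>_def cip_simps jm_simps zero_prod_def)
    next
      case False
      define c where "c = complex_of_real (1 / norm u)"
      have "cip (c *s u) (c *s u) = 1"
        unfolding cip_self_eq_1 using False by (simp add: norm_smult c_def norm_divide)
      from unit[OF this] have "cscale (c * cnj c) (\<Phi> u u) \<in> C"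
        using \<Phi> by (simp add: sesq_def cscale_simps mult.commute)
      then show ?thesis by (rule csub_unscale[OF C]) (use False in \<open>simp add: c_def\<close>)
    qed
    have mem: "\<Phi> x y \<in> C" for x y
    proof -
      have "\<Phi> x y + \<Phi> y x \<in> C" for x y
        unfolding sesq_polar(1)[OF \<Phi>, symmetric] by (intro csubD[OF C] diag)
      then show ?thesis using sesq_mem[OF \<Phi> C] by blast
    qed
    \<comment> \<open>The \<open>jm\<close> term drops out, and since the components of
      \<open>p\<close> lie along \<open>e\<close> and \<open>f\<close>, choosing y = e or y = f
      selects the summand.\<close>
    have 1: "(x, 0) \<in> C" "(0, x) \<in> C" if x: "cip x e = 0" "cip x f = 0" for x
    proof -
      have x': "cip e (jm x) = 0" "cip f (jm x) = 0"
        using x cip_jm_right[of e x] cip_jm_jm[of e x] by (simp_all add: ef)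
      have "\<Phi> x e = cscale a (x, 0)" "\<Phi> x f = cscale b (0, x)"
        using x' by (simp_all add: \<Phi>_def p cip_simps e ef cscale_def)
      then show "(x, 0) \<in> C" "(0, x) \<in> C"
        using mem[of x e] mem[of x f] csub_unscale[OF C] a(1) b(1) by simp_all
    qed
    \<comment> \<open>Here the two terms of \<Phi> coincide, whence the factor 2. The vectors (e, 0)
      and (0, f) are left for the circle argument.\<close>
    have "\<Phi> f e = cscale (2 * a) (f, 0)" "\<Phi> e f = cscale (2 * b) (0, e)"
      by (simp_all add: \<Phi>_def p cip_simps e ef cscale_def vec_eq_iff)
    then have 2: "(f, 0) \<in> C" "(0, e) \<in> C"
      using mem[of f e] mem[of e f] csub_unscale[OF C] a(1) b(1) by simp_all
    have "\<Phi> e e = (a *s e, - (of_real 1 *s (b *s f)))"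
      by (simp add: \<Phi>_def p cip_simps e ef)
    then have "(a *s e, - (of_real 1 *s (b *s f))) \<in> C" using mem[of e e] by simp
    from csub_split[OF C this csub_circ_vel[OF C cv, unfolded p]] ks
    have "cscale a (e, 0) \<in> C" "cscale b (0, f) \<in> C"
      by (simp_all add: cscale_def)
    then have 3: "(e, 0) \<in> C" "(0, f) \<in> C"
      using csub_unscale[OF C] a(1) b(1) by blast+
    have all: "(x, 0) \<in> C" "(0, x) \<in> C" for x
    proof -
      define x' where "x' = x - cip x e *s e - cip x f *s f"
      have x': "cip x' e = 0" "cip x' f = 0" by (simp_all add: x'_def cip_simps e ef)
      have "(x', 0) + cscale (cip x e) (e, 0) + cscale (cip x f) (f, 0) \<in> C"
        "(0, x') + cscale (cip x e) (0, e) + cscale (cip x f) (0, f) \<in> C"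
        by (intro csubD[OF C] 1 2 3 x')+
      then show "(x, 0) \<in> C" "(0, x) \<in> C" by (simp_all add: x'_def cscale_def)
    qed
    show "UNIV \<times> UNIV \<subseteq> C"
      using csub_Times[OF C, of UNIV UNIV] all by simp
  qed (use ks c1(1) c2(1) h_eq a b t norm_scaled[OF a(2,3), of e] norm_scaled[OF b(2,3), of f] norm_ef
      in \<open>auto simp: p std_rep_def mat1_Sp mult_Sp Sp_inv Sp_D\<close>)
  then show ?thesis by (rule isotropic_orbit.lagrangian_orbit)
qed

section \<open>The spin group\<close>

lemma UNIV_5: "(UNIV :: 5 set) = {0, 1, 2, 3, 4}"
proof -
  have "card {0, 1, 2, 3, 4 :: 5} = 5" by simp
  then show ?thesis by (intro card_subset_eq[symmetric]) auto
qed

lemma all_5: "(\<forall>i::5. P i) \<longleftrightarrow> P 0 \<and> P 1 \<and> P 2 \<and> P 3 \<and> P 4"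
proof -
  have "(\<forall>i::5. P i) \<longleftrightarrow> (\<forall>i\<in>UNIV. P i)" by simp
  then show ?thesis unfolding UNIV_5 by simp
qed

lemma sum_5: "(\<Sum>i\<in>UNIV. f (i :: 5)) = f 0 + f 1 + f 2 + f 3 + f 4"
  for f :: "5 \<Rightarrow> 'a::comm_monoid_add"
  unfolding UNIV_5 by (simp add: add.assoc)

section \<open>Toggling indices in subsets of a five-element set\<close>

text \<open>Creation and annihilation of \<open>i\<close> both send e_A to a multiple of the basis
  vector of the toggled set, so one formula covers Clifford multiplication.\<close>

definition tog :: "5 \<Rightarrow> 5 set \<Rightarrow> 5 set" where
  "tog i A = (if i \<in> A then A - {i} else insert i A)"

lemma mem_tog: "j \<in> tog i A \<longleftrightarrow> (j \<in> A) \<noteq> (j = i)"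
  by (auto simp: tog_def)

lemma tog_tog: "tog i (tog i A) = A"
  by (auto simp: tog_def)

lemma tog_commute: "tog i (tog j A) = tog j (tog i A)"
  by (auto simp: set_eq_iff mem_tog)

text \<open>Turns parity questions about subsets into propositional ones about five
  memberships.\<close>

lemma even_card_5: "even (card (A :: 5 set)) \<longleftrightarrow> ((0 \<in> A) \<noteq> ((1 \<in> A) = ((2 \<in> A) = ((3 \<in> A) = (4 \<in> A)))))"
proof -
  have "card A = (\<Sum>i\<in>UNIV. of_bool (i \<in> A))" by simp
  then show ?thesis unfolding sum_5 by (simp add: even_add)
qed

lemma even_card_tog: "even (card (tog i A)) \<longleftrightarrow> odd (card A)"
proof -
  have "\<forall>i. even (card (tog i A)) \<longleftrightarrow> odd (card A)"
    unfolding all_5 even_card_5 mem_tog by simp argo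
  then show ?thesis by blast
qed

lemma bij_tog: "bij (tog i)"
  by (rule o_bij[of "tog i"]) (auto simp: tog_tog)

lemma wedge_sign_square: "wedge_sign i A * wedge_sign i A = 1" "cnj (wedge_sign i A) = wedge_sign i A"
  "wedge_sign i A \<noteq> 0"
  by (simp_all add: wedge_sign_def flip: power_add)

lemma wedge_sign_tog:
  "wedge_sign i (tog i A) = wedge_sign i A"
  "j \<noteq> i \<Longrightarrow> wedge_sign i (tog j A) = (if j < i then - wedge_sign i A else wedge_sign i A)"
proof -
  have "{k \<in> tog i A. k < i} = {k \<in> A. k < i}" by (auto simp: mem_tog)
  then show "wedge_sign i (tog i A) = wedge_sign i A" by (simp add: wedge_sign_def)
  assume "j \<noteq> i"
  show "wedge_sign i (tog j A) = (if j < i then - wedge_sign i A else wedge_sign i A)"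
  proof (cases "j < i")
    case True
    then have "{k \<in> tog j A. k < i} = tog j {k \<in> A. k < i}" by (auto simp: mem_tog)
    then have "even (card {k \<in> tog j A. k < i}) \<longleftrightarrow> odd (card {k \<in> A. k < i})"
      by (simp add: even_card_tog)
    then show ?thesis using True by (simp add: wedge_sign_def minus_one_power_iff)
  next
    case False
    then have "{k \<in> tog j A. k < i} = {k \<in> A. k < i}" by (auto simp: mem_tog)
    then show ?thesis using False by (simp add: wedge_sign_def)
  qed
qed

section \<open>Clifford multiplication on the spinor module\<close>

text \<open>The factor with which the \<open>i\<close>-th coordinate of \<open>z\<close> enters the
  coefficient at \<open>B\<close>: creation if i lies in \<open>B\<close>, annihilation
  otherwise.\<close>

definition cl_coeff :: "complex ^ 5 \<Rightarrow> 5 \<Rightarrow> 5 set \<Rightarrow> complex" where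
  "cl_coeff z i B = (if i \<in> B then z $ i else - cnj (z $ i))"

abbreviation cl :: "complex ^ 5 \<Rightarrow> complex ^ (5 set) \<Rightarrow> complex ^ (5 set)" where
  "cl z x \<equiv> clifford z *v x"

lemma clifford_nth:
  "clifford z $ B $ A = (\<Sum>i\<in>UNIV. if A = tog i B then cl_coeff z i B * wedge_sign i B else 0)"
proof -
  have "z $ i * creation i $ B $ A - cnj (z $ i) * annihilation i $ B $ A =
    (if A = tog i B then cl_coeff z i B * wedge_sign i B else 0)" for i
  proof (cases "A = tog i B")
    case True
    then have B: "B = tog i A" by (simp add: tog_tog)
    have W: "wedge_sign i B = wedge_sign i A" by (simp add: B wedge_sign_tog)
    show ?thesis
    proof (cases "i \<in> A")
      case True
      then have "B = A - {i}" "i \<notin> B" by (auto simp: B tog_def)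
      then show ?thesis
        using True \<open>A = tog i B\<close> W by (simp add: creation_def annihilation_def cl_coeff_def)
    next
      case False
      then have "B = insert i A" "i \<in> B" by (auto simp: B tog_def)
      then show ?thesis
        using False \<open>A = tog i B\<close> W by (simp add: creation_def annihilation_def cl_coeff_def)
    qed
  next
    case False
    then have "B \<noteq> tog i A" by (auto simp: tog_tog)
    then show ?thesis using False by (auto simp: creation_def annihilation_def tog_def)
  qed
  then show ?thesis by (simp add: clifford_def)
qed

lemma cl_nth: "cl z x $ B = (\<Sum>i\<in>UNIV. cl_coeff z i B * wedge_sign i B * x $ tog i B)"
proof -
  have "cl z x $ B = (\<Sum>A\<in>UNIV. \<Sum>i\<in>UNIV. (if A = tog i B then cl_coeff z i B * wedge_sign i B else 0) * x $ A)"
    by (simp add: matrix_vector_mult_def clifford_nth sum_distrib_right)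
  also have "\<dots> = (\<Sum>i\<in>UNIV. \<Sum>A\<in>UNIV. if A = tog i B then cl_coeff z i B * wedge_sign i B * x $ A else 0)"
    by (subst sum.swap) (intro sum.cong refl, simp)
  finally show ?thesis by simp
qed

lemma sum_antisymmetric:
  fixes F :: "'i::finite \<Rightarrow> 'i \<Rightarrow> complex"
  assumes "\<And>i j. i \<noteq> j \<Longrightarrow> F i j = - F j i"
  shows "(\<Sum>i\<in>UNIV. \<Sum>j\<in>UNIV. F i j) = (\<Sum>i\<in>UNIV. F i i)"
proof -
  let ?S = "\<Sum>i\<in>UNIV. \<Sum>j\<in>UNIV. F i j"
  have "?S + ?S = ?S + (\<Sum>i\<in>UNIV. \<Sum>j\<in>UNIV. F j i)"
    by (subst (3) sum.swap) simp
  also have "\<dots> = (\<Sum>i\<in>UNIV. \<Sum>j\<in>UNIV. if j = i then 2 * F i i else 0)"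
    unfolding sum.distrib[symmetric]
  proof (intro sum.cong refl)
    fix i j
    show "F i j + F j i = (if j = i then 2 * F i i else 0)"
      using assms[of i j] by (cases "j = i") simp_all
  qed
  also have "\<dots> = (\<Sum>i\<in>UNIV. F i i) + (\<Sum>i\<in>UNIV. F i i)"
    by (simp flip: sum_distrib_left)
  finally show ?thesis by simp
qed

lemma cl_cl_nth: "cl a (cl b x) $ B = (\<Sum>i\<in>UNIV. \<Sum>j\<in>UNIV. cl_coeff a i B * wedge_sign i B *
    (cl_coeff b j (tog i B) * wedge_sign j (tog i B)) * x $ tog j (tog i B))"
  by (simp add: cl_nth sum_distrib_left mult.assoc)

lemma cl_coeff_tog: "i \<noteq> j \<Longrightarrow> cl_coeff z i (tog j B) = cl_coeff z i B"
  "cl_coeff z i (tog i B) = - cnj (cl_coeff z i B)"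
  by (auto simp: cl_coeff_def mem_tog)

text \<open>Mixed terms cancel because of the two ways to toggle \<open>i\<close> and
  \<open>j\<close> exactly one picks up a sign: toggling the smaller index changes the sign of the
  larger one, but not conversely.\<close>

lemma cl_square: "cl z (cl z x) = - (of_real ((norm z)\<^sup>2) *s x)"
proof -
  have "cl z (cl z x) $ B = - (of_real ((norm z)\<^sup>2) *s x) $ B" for B
  proof -
    have "cl z (cl z x) $ B = (\<Sum>i\<in>UNIV. cl_coeff z i B * wedge_sign i B *
      (cl_coeff z i (tog i B) * wedge_sign i (tog i B)) * x $ tog i (tog i B))"
      unfolding cl_cl_nth
    proof (rule sum_antisymmetric)
      fix i j :: 5 assume ij: "i \<noteq> j"
      then have "i < j \<or> j < i" by auto
      then show "cl_coeff z i B * wedge_sign i B * (cl_coeff z j (tog i B) * wedge_sign j (tog i B)) * x $ tog j (tog i B) =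
        - (cl_coeff z j B * wedge_sign j B * (cl_coeff z i (tog j B) * wedge_sign i (tog j B)) * x $ tog i (tog j B))"
        using ij by (auto simp: cl_coeff_tog wedge_sign_tog tog_commute[of i j])
    qed
    also have "\<dots> = (\<Sum>i\<in>UNIV. - (z $ i * cnj (z $ i) * x $ B))"
    proof (intro sum.cong refl)
      fix i
      have "cl_coeff z i B * wedge_sign i B * (cl_coeff z i (tog i B) * wedge_sign i (tog i B)) * x $ tog i (tog i B) =
        cl_coeff z i B * cl_coeff z i (tog i B) * (wedge_sign i B * wedge_sign i B) * x $ B"
        by (simp add: wedge_sign_tog tog_tog)
      also have "\<dots> = - (z $ i * cnj (z $ i) * x $ B)"
        unfolding wedge_sign_square cl_coeff_tog by (simp add: cl_coeff_def)
      finally show "cl_coeff z i B * wedge_sign i B * (cl_coeff z i (tog i B) * wedge_sign i (tog i B)) * x $ tog i (tog i B) =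
        - (z $ i * cnj (z $ i) * x $ B)" .
    qed
    also have "\<dots> = - (cip z z * x $ B)"
      by (simp add: cip_def sum_negf sum_distrib_right)
    finally show ?thesis by (simp add: cip_self)
  qed
  then show ?thesis by (simp add: vec_eq_iff)
qed

lemma clifford_linear: "clifford (a + b) = clifford a + clifford b" "clifford (r *\<^sub>R a) = r *\<^sub>R clifford a"
  "clifford (- a) = - clifford a"
  by (simp_all add: vec_eq_iff clifford_def algebra_simps sum.distrib sum_negf scaleR_sum_right sum_subtractf
      scaleR_conv_of_real[where 'a = complex] sum_distrib_left)

lemma cl_linear: "cl (a + b) x = cl a x + cl b x" "cl (r *\<^sub>R a) x = of_real r *s cl a x" "cl (- a) x = - cl a x"
  "cl a (x + y) = cl a x + cl a y" "cl a (x - y) = cl a x - cl a y" "cl a (- x) = - cl a x" "cl a (c *s x) = c *s cl a x" "cl a 0 = 0"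
  by (simp_all add: clifford_linear matrix_vector_mult_add_rdistrib vec.add vec.diff vec.neg vec.scale)
    (simp_all add: vec_eq_iff matrix_vector_mult_def scaleR_conv_of_real[where 'a = complex] sum_distrib_left mult_ac sum_negf)

text \<open>Polarization of \<open>cl_square\<close>. Clifford multiplication is only real linear in
  the vector, hence the real inner product.\<close>

lemma cl_anticommute: "cl a (cl b x) = - cl b (cl a x) - of_real (2 * (a \<bullet> b)) *s x"
proof -
  have "cl (a + b) (cl (a + b) x) = cl a (cl a x) + cl b (cl b x) + cl a (cl b x) + cl b (cl a x)"
    by (simp add: cl_linear)
  then have "cl a (cl b x) + cl b (cl a x) = - (of_real ((norm (a + b))\<^sup>2 - (norm a)\<^sup>2 - (norm b)\<^sup>2) *s x)"
    unfolding cl_square by (simp add: vec_eq_iff algebra_simps)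
  also have "(norm (a + b))\<^sup>2 - (norm a)\<^sup>2 - (norm b)\<^sup>2 = 2 * (a \<bullet> b)"
    by (simp add: power2_norm_eq_inner inner_add_left inner_add_right inner_commute)
  finally have "cl a (cl b x) + cl b (cl a x) = - (of_real (2 * (a \<bullet> b)) *s x)" .
  moreover have "cl a (cl b x) = - cl b (cl a x) + (cl a (cl b x) + cl b (cl a x))" by simp
  ultimately show ?thesis by simp
qed

lemma cip_cl: "cip (cl z x) y = - cip x (cl z y)"
proof -
  have "cip (cl z x) y = (\<Sum>i\<in>UNIV. \<Sum>B\<in>UNIV. cl_coeff z i B * wedge_sign i B * x $ tog i B * cnj (y $ B))"
    by (subst sum.swap) (simp add: cip_def cl_nth sum_distrib_right)
  also have "\<dots> = (\<Sum>i\<in>UNIV. \<Sum>B\<in>UNIV. cl_coeff z i (tog i B) * wedge_sign i (tog i B) * x $ tog i (tog i B) * cnj (y $ tog i B))"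
    by (intro sum.cong refl sum.reindex_bij_betw[OF bij_tog, symmetric])
  also have "\<dots> = (\<Sum>i\<in>UNIV. \<Sum>B\<in>UNIV. - (x $ B * cnj (cl_coeff z i B * wedge_sign i B * y $ tog i B)))"
    by (simp add: tog_tog cl_coeff_tog wedge_sign_tog wedge_sign_square mult_ac)
  also have "\<dots> = - cip x (cl z y)"
    by (subst sum.swap) (simp add: cip_def cl_nth sum_distrib_left sum_negf)
  finally show ?thesis .
qed

lemma cl_axis:
  "cl (axis i w) (axis A 1) = ((if i \<in> A then - cnj w else w) * wedge_sign i A) *s axis (tog i A) 1"
proof -
  have "cl (axis i w) (axis A 1) $ B = (((if i \<in> A then - cnj w else w) * wedge_sign i A) *s axis (tog i A) 1) $ B" for B
  proof -
    have "cl (axis i w) (axis A 1) $ B = (\<Sum>j\<in>UNIV. if j = i then cl_coeff (axis i w) i B * wedge_sign i B * axis A 1 $ tog i B else 0)"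
      unfolding cl_nth by (intro sum.cong refl) (auto simp: cl_coeff_def axis_def)
    also have "\<dots> = cl_coeff (axis i w) i B * wedge_sign i B * axis A 1 $ tog i B" by simp
    also have "\<dots> = (((if i \<in> A then - cnj w else w) * wedge_sign i A) *s axis (tog i A) 1) $ B"
    proof (cases "B = tog i A")
      case True
      then show ?thesis by (auto simp: cl_coeff_def axis_def tog_tog wedge_sign_tog mem_tog)
    next
      case False
      then have "tog i B \<noteq> A" by (auto simp: tog_tog)
      then show ?thesis using False by (simp add: axis_def)
    qed
    finally show ?thesis .
  qed
  then show ?thesis by (simp add: vec_eq_iff)
qed

lemma half_spin_span: "half_spin par = vec.span {axis A 1 | A. even (card A) = par}"
proof (intro equalityI subsetI)
  fix x assume x: "x \<in> half_spin par"
  have "x = (\<Sum>A\<in>UNIV. x $ A *s axis A 1)" by (rule basis_expansion[symmetric])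
  also have "\<dots> \<in> vec.span {axis A 1 | A. even (card A) = par}"
  proof (rule vec.span_sum)
    fix A
    show "x $ A *s axis A 1 \<in> vec.span {axis A 1 | A. even (card A) = par}"
    proof (cases "x $ A = 0")
      case True
      then show ?thesis by (simp add: vec.span_zero)
    next
      case False
      then have "even (card A) = par" using x by (auto simp: half_spin_def)
      then show ?thesis by (intro vec.span_scale vec.span_base) blast
    qed
  qed
  finally show "x \<in> vec.span {axis A 1 | A. even (card A) = par}" .
next
  fix x :: "complex ^ (5 set)" assume "x \<in> vec.span {axis A 1 | A. even (card A) = par}"
  moreover have "vec.subspace (half_spin par)"
    by (auto simp: vec.subspace_def half_spin_def) (metis add.right_neutral)+
  moreover have "{axis A 1 | A. even (card A) = par} \<subseteq> half_spin par"
    by (auto simp: half_spin_def axis_def split: if_splits)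
  ultimately show "x \<in> half_spin par" using vec.span_minimal by blast
qed

lemma cl_half_spin: "x \<in> half_spin par \<Longrightarrow> cl z x \<in> half_spin (\<not> par)"
proof -
  assume x: "x \<in> half_spin par"
  show ?thesis
    unfolding half_spin_def
  proof (intro CollectI allI impI)
    fix A assume "cl z x $ A \<noteq> 0"
    then obtain i where "x $ tog i A \<noteq> 0"
      unfolding cl_nth by (metis (no_types, lifting) mult_zero_right sum.neutral)
    then have "even (card (tog i A)) = par" using x by (auto simp: half_spin_def)
    then show "even (card A) = (\<not> par)" by (auto simp: even_card_tog)
  qed
qed

section \<open>Products of unit vectors and the invariant forms on half-spinors\<close>

definition cprod :: "(complex ^ 5) list \<Rightarrow> complex ^ (5 set) ^ (5 set)" where
  "cprod zs = foldr (\<lambda>z M. clifford z ** M) zs (mat 1)"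

lemma Spin10_eq: "Spin10 = {cprod zs | zs. even (length zs) \<and> (\<forall>z \<in> set zs. norm z = 1)}"
  by (simp add: Spin10_def cprod_def)

lemma cprod_simps: "cprod [] = mat 1" "cprod (z # zs) = clifford z ** cprod zs"
  by (simp_all add: cprod_def)

lemma cprod_mult_vec: "cprod [] *v x = x" "cprod (z # zs) *v x = cl z (cprod zs *v x)"
  by (simp_all add: cprod_simps matrix_vector_mul_assoc)

lemma cprod_append: "cprod (xs @ ys) *v x = cprod xs *v (cprod ys *v x)"
  by (induction xs) (simp_all add: cprod_mult_vec)

text \<open>Unit vectors square to -1; for even length the signs cancel and the reversed product is
  an inverse inside \<open>Spin10\<close>.\<close>

lemma cprod_rev:
  "\<forall>z \<in> set zs. norm z = 1 \<Longrightarrow> cprod (rev zs) *v (cprod zs *v x) = (- 1) ^ length zs *s x"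
proof (induction zs arbitrary: x)
  case (Cons z zs)
  have "cprod (rev (z # zs)) *v (cprod (z # zs) *v x) = cprod (rev zs) *v (cl z (cl z (cprod zs *v x)))"
    by (simp add: cprod_append cprod_mult_vec)
  also have "cl z (cl z (cprod zs *v x)) = cprod zs *v (- x)"
    using Cons.prems by (simp add: cl_square vec.neg)
  also have "cprod (rev zs) *v (cprod zs *v (- x)) = (- 1) ^ length (z # zs) *s x"
    using Cons by (simp add: vec_eq_iff)
  finally show ?case .
qed (simp add: cprod_mult_vec)

lemma cip_cprod: "\<forall>z \<in> set zs. norm z = 1 \<Longrightarrow> cip (cprod zs *v x) (cprod zs *v y) = cip x y"
  by (induction zs) (simp_all add: cprod_mult_vec cip_cl cl_square cip_simps)

lemma cprod_half_spin: "x \<in> half_spin par \<Longrightarrow> cprod zs *v x \<in> half_spin (par = even (length zs))"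
proof (induction zs)
  case (Cons z zs)
  have "cl z (cprod zs *v x) \<in> half_spin (\<not> (par = even (length zs)))"
    by (rule cl_half_spin[OF Cons.IH[OF Cons.prems]])
  moreover have "(\<not> (par = even (length zs))) = (par = even (length (z # zs)))" by auto
  ultimately show ?case by (simp add: cprod_mult_vec)
qed (simp add: cprod_mult_vec)

lemma cl_cl_Spin10:
  assumes "norm a = 1" "norm b = 1"
  shows "clifford a ** clifford b \<in> Spin10"
  unfolding Spin10_eq using assms by (intro CollectI exI[of _ "[a, b]"]) (auto simp: cprod_simps)

definition tog4 :: "5 set \<Rightarrow> 5 set" where
  "tog4 A = tog 0 (tog 1 (tog 2 (tog 3 A)))"

lemma mem_tog4: "j \<in> tog4 A \<longleftrightarrow> (j \<in> A) \<noteq> (j \<noteq> 4)"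
proof -
  have "\<forall>j. j \<in> tog4 A \<longleftrightarrow> (j \<in> A) \<noteq> (j \<noteq> 4)" unfolding all_5 tog4_def mem_tog by simp
  then show ?thesis by blast
qed

lemma set_eq_5: "A = B \<longleftrightarrow> (\<forall>i::5. i \<in> A \<longleftrightarrow> i \<in> B)"
  by blast

text \<open>The seven double toggles are those for which the four weights of the base point of \<open>Spin(10)\<close> differ in
  their membership pattern at the two toggled indices.\<close>

lemma same_parity_cases:
  assumes "even (card B) = even (card A)"
  shows "B \<in> {A, tog4 A} \<union> (\<Union>X\<in>{A, tog4 A}. {tog 0 (tog 4 X), tog 1 (tog 4 X), tog 2 (tog 4 X), tog 3 (tog 4 X),
    tog 0 (tog 1 X), tog 0 (tog 2 X), tog 0 (tog 3 X)})"
proof -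
  define d where "d i \<longleftrightarrow> (i \<in> B) \<noteq> (i \<in> A)" for i
  have B: "i \<in> B \<longleftrightarrow> (i \<in> A) \<noteq> d i" for i by (auto simp: d_def)
  have par: "d 0 \<noteq> (d 1 \<noteq> (d 2 \<noteq> (d 3 = d 4)))"
    using assms unfolding even_card_5 d_def by argo
  show ?thesis
    unfolding Un_iff UN_iff insert_iff bex_simps empty_iff set_eq_5 all_5 mem_tog mem_tog4 B
    using par
    by (cases "d 0"; cases "d 1"; cases "d 2"; cases "d 3"; cases "d 4") simp_all
qed

lemma wedge_sign_cases: "wedge_sign i A = 1 \<or> wedge_sign i A = - 1"
  by (simp add: wedge_sign_def minus_one_power_iff)

text \<open>These products lie in a maximal torus, with the e_A as weight vectors; the eigenvalue
  records whether \<open>i\<close> belongs to \<open>A\<close>, so different sets are separated by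
  some \<open>i\<close>.\<close>

lemma cl_diag_axis: "cl (axis i 1) (cl (axis i \<i>) (axis A 1)) = (if i \<in> A then \<i> else - \<i>) *s axis A 1"
proof -
  have W: "wedge_sign i A * (wedge_sign i A * c) = c" for c
    using wedge_sign_square(1)[of i A] by (simp flip: mult.assoc)
  show ?thesis
    by (simp add: cl_axis cl_linear vector_smult_assoc mem_tog wedge_sign_tog tog_tog mult.assoc mult.left_commute[of _ \<i>] W wedge_sign_square)
qed

text \<open>Schur's lemma by weights: torus elements make different e_A orthogonal, and products of
  two coordinate vectors permute the e_A of one parity transitively up to sign.\<close>

lemma herm_on_half_spin:
  assumes f: "herm_on (half_spin par) f"
    and inv: "\<And>g x y. g \<in> Spin10 \<Longrightarrow> x \<in> half_spin par \<Longrightarrow> y \<in> half_spin par \<Longrightarrow> f (g *v x) (g *v y) = f x y"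
  shows "\<exists>c>0. \<forall>b\<in>{axis A 1 | A. even (card A) = par}. \<forall>b'\<in>{axis A 1 | A. even (card A) = par}.
    f b b' = of_real c * cip b b'"
proof -
  have sub: "vec.subspace (half_spin par)" unfolding half_spin_span by (rule vec.subspace_span)
  have ax: "axis A 1 \<in> half_spin par" if "even (card A) = par" for A
    unfolding half_spin_span using that by (intro vec.span_base) blast
  have n: "norm (axis i 1 :: complex ^ 5) = 1" "norm (axis i \<i> :: complex ^ 5) = 1" for i
    by (simp_all add: cip_self_eq_1[symmetric] cip_def axis_def if_distrib if_distribR cong: if_cong)
  have off: "f (axis A 1) (axis B 1) = 0" if AB: "even (card A) = par" "even (card B) = par" "A \<noteq> B" for A B
  proof -
    obtain i where i: "(i \<in> A) \<noteq> (i \<in> B)" using AB(3) by blast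
    show ?thesis
    proof (rule herm_on_scaled_zero[OF f sub ax[OF AB(1)] ax[OF AB(2)]])
      show "f ((if i \<in> A then \<i> else - \<i>) *s axis A 1) ((if i \<in> B then \<i> else - \<i>) *s axis B 1) = f (axis A 1) (axis B 1)"
        using inv[OF cl_cl_Spin10[OF n(1,2), of i i] ax[OF AB(1)] ax[OF AB(2)]]
        by (simp only: matrix_vector_mul_assoc[symmetric] cl_diag_axis)
      show "(if i \<in> A then \<i> else - \<i>) * cnj (if i \<in> B then \<i> else - \<i>) \<noteq> 1"
        using i by auto
    qed
  qed
  have eq: "f (axis (tog i (tog j A)) 1) (axis (tog i (tog j A)) 1) = f (axis A 1) (axis A 1)"
    if A: "even (card A) = par" and ij: "i \<noteq> j" for i j A
  proof -
    define c where "c = (if j \<in> A then - 1 else 1) * wedge_sign j A * ((if i \<in> A then - 1 else 1) * wedge_sign i (tog j A))"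
    have c: "c * cnj c = 1"
      using wedge_sign_cases[of j A] wedge_sign_cases[of i "tog j A"] by (auto simp: c_def)
    have A': "even (card (tog i (tog j A))) = par" using A by (simp add: even_card_tog)
    have "cl (axis i 1) (cl (axis j 1) (axis A 1)) = c *s axis (tog i (tog j A)) 1"
      using ij by (simp add: cl_axis cl_linear vector_smult_assoc mem_tog c_def)
    then have "f (c *s axis (tog i (tog j A)) 1) (c *s axis (tog i (tog j A)) 1) = f (axis A 1) (axis A 1)"
      using inv[OF cl_cl_Spin10[OF n(1,1), of i j] ax[OF A] ax[OF A]]
      by (simp only: matrix_vector_mul_assoc[symmetric])
    moreover have "f (c *s axis (tog i (tog j A)) 1) (c *s axis (tog i (tog j A)) 1) =
      c * (cnj c * f (axis (tog i (tog j A)) 1) (axis (tog i (tog j A)) 1))"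
      using herm_onD(2)[OF f ax[OF A'] vec.subspace_scale[OF sub ax[OF A']]]
        herm_onD_right(2)[OF f sub ax[OF A'] ax[OF A']] by metis
    ultimately show ?thesis using c by (simp flip: mult.assoc)
  qed
  define A0 :: "5 set" where "A0 = (if par then {} else {0})"
  have A0: "even (card A0) = par" by (simp add: A0_def)
  have eq0: "f (axis A 1) (axis A 1) = f (axis A0 1) (axis A0 1)" if A: "even (card A) = par" for A
  proof -
    \<comment> \<open>\<open>same_parity_cases\<close> reaches every set by a double toggle of
      \<open>A0\<close> or of \<open>tog4 A0\<close>, and \<open>tog4\<close> is itself two double
      toggles.\<close>
    have A0': "even (card (tog4 A0)) = par" using A0 by (simp add: tog4_def even_card_tog)
    have 4: "f (axis (tog4 A0) 1) (axis (tog4 A0) 1) = f (axis A0 1) (axis A0 1)"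
      unfolding tog4_def using A0 by (subst eq, simp add: even_card_tog, simp)+ simp
    show ?thesis
      using same_parity_cases[of A A0] A A0 A0' by (auto simp: eq 4)
  qed
  define c where "c = Re (f (axis A0 1) (axis A0 1))"
  have c: "f (axis A0 1) (axis A0 1) = of_real c" "0 < c"
    using herm_on_real_pos[OF f ax[OF A0]] by (auto simp: c_def axis_eq_0_iff)
  have "f b b' = of_real c * cip b b'"
    if "b \<in> {axis A 1 | A. even (card A) = par}" "b' \<in> {axis A 1 | A. even (card A) = par}" for b b'
  proof -
    obtain A B where AB: "b = axis A 1" "b' = axis B 1" "even (card A) = par" "even (card B) = par"
      using \<open>b \<in> _\<close> \<open>b' \<in> _\<close> by blast
    have "cip b b' = (if A = B then 1 else 0)" unfolding AB(1,2) cip_axis by (simp add: axis_def)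
    then show ?thesis using off[OF AB(3,4)] eq0[OF AB(3)] c(1) AB(1,2) by auto
  qed
  then show ?thesis using c(2) by blast
qed

section \<open>The moment map of Spin(10)\<close>

definition cl2 :: "complex ^ 5 \<Rightarrow> (5 set, 5 set) vsum \<Rightarrow> (5 set, 5 set) vsum" where
  "cl2 z = map_prod (cl z) (cl z)"

lemma cl2_simps:
  "cl2 (a + b) x = cl2 a x + cl2 b x" "cl2 (- a) x = - cl2 a x" "cl2 (r *\<^sub>R a) x = cscale (of_real r) (cl2 a x)"
  "cl2 a (x + y) = cl2 a x + cl2 a y" "cl2 a (x - y) = cl2 a x - cl2 a y" "cl2 a (- x) = - cl2 a x"
  "cl2 a (cscale c x) = cscale c (cl2 a x)"
  by (cases x; cases y; simp add: cl2_def cl_linear cscale_def)+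

lemma cl2_anticommute: "cl2 a (cl2 b x) = - cl2 b (cl2 a x) - cscale (of_real (2 * (a \<bullet> b))) x"
  using cl_anticommute[of a b "fst x"] cl_anticommute[of a b "snd x"]
  by (cases x) (simp add: cl2_def cscale_def)

lemma cl2_square: "norm z = 1 \<Longrightarrow> cl2 z (cl2 z x) = - x"
  by (cases x) (simp add: cl2_def cl_square)

lemma hp_cl2: "hp c1 c2 (cl2 z x) y = - hp c1 c2 x (cl2 z y)"
  by (cases x; cases y) (simp add: hp_def cl2_def cip_cl)

text \<open>For orthogonal \<open>a\<close>, \<open>b\<close> this is the moment map along an
  element of the Lie algebra. Allowing all pairs costs nothing, as parallel vectors multiply to a
  real scalar, and makes the condition stable under a single Clifford factor. The real part is left
  out because it vanishes only for orthogonal pairs in general.\<close>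

definition spin_moment_zero :: "real \<Rightarrow> real \<Rightarrow> (5 set, 5 set) vsum \<Rightarrow> bool" where
  "spin_moment_zero c1 c2 x \<longleftrightarrow> (\<forall>a b. Im (hp c1 c2 (cl2 a (cl2 b x)) x) = 0)"

lemma hp_minus_diff:
  "hp c1 c2 (- x) y = - hp c1 c2 x y" "hp c1 c2 (x - y) z = hp c1 c2 x z - hp c1 c2 y z"
  by (simp_all add: hp_def cip_simps algebra_simps)

text \<open>Equivariance under one reflection. Moving \<open>z\<close> through \<open>a\<close> and
  \<open>b\<close> leaves three terms, real multiples of moment values for the pairs (z, b), (a, b)
  and (z, a).\<close>

lemma spin_moment_zero_cl2:
  assumes x: "spin_moment_zero c1 c2 x" and z: "norm z = 1"
  shows "spin_moment_zero c1 c2 (cl2 z x)"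
  unfolding spin_moment_zero_def
proof (intro allI)
  fix a b
  define \<alpha> \<beta> where "\<alpha> = complex_of_real (2 * (a \<bullet> z))" and "\<beta> = complex_of_real (2 * (b \<bullet> z))"
  have az: "cl2 z (cl2 a (cl2 z y)) = cl2 a y - cscale \<alpha> (cl2 z y)" for y
  proof -
    have "cl2 a (cl2 z y) = - cl2 z (cl2 a y) - cscale \<alpha> y" unfolding \<alpha>_def by (rule cl2_anticommute)
    then show ?thesis by (simp add: cl2_simps cl2_square z)
  qed
  have "cl2 b (cl2 z x) = - cl2 z (cl2 b x) - cscale \<beta> x" unfolding \<beta>_def by (rule cl2_anticommute)
  then have "cl2 z (cl2 a (cl2 b (cl2 z x))) = - cl2 z (cl2 a (cl2 z (cl2 b x))) - cscale \<beta> (cl2 z (cl2 a x))"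
    by (simp add: cl2_simps)
  also have "\<dots> = cscale \<alpha> (cl2 z (cl2 b x)) - cl2 a (cl2 b x) - cscale \<beta> (cl2 z (cl2 a x))"
    unfolding az by simp
  finally have "hp c1 c2 (cl2 z (cl2 a (cl2 b (cl2 z x)))) x =
    \<alpha> * hp c1 c2 (cl2 z (cl2 b x)) x - hp c1 c2 (cl2 a (cl2 b x)) x - \<beta> * hp c1 c2 (cl2 z (cl2 a x)) x"
    by (simp add: hp_minus_diff hp_cscale_left)
  then have "Im (hp c1 c2 (cl2 z (cl2 a (cl2 b (cl2 z x)))) x) = 0"
    using x by (simp add: spin_moment_zero_def \<alpha>_def \<beta>_def)
  then show "Im (hp c1 c2 (cl2 a (cl2 b (cl2 z x))) (cl2 z x)) = 0"
    by (simp add: hp_cl2[of _ _ z])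
qed

lemma spin_moment_zero_cprod:
  assumes "spin_moment_zero c1 c2 x" "\<forall>z\<in>set zs. norm z = 1"
  shows "spin_moment_zero c1 c2 (cprod zs *v fst x, cprod zs *v snd x)"
  using assms(2)
proof (induction zs)
  case (Cons z zs)
  have "spin_moment_zero c1 c2 (cl2 z (cprod zs *v fst x, cprod zs *v snd x))"
    using Cons by (intro spin_moment_zero_cl2) auto
  then show ?case by (simp add: cl2_def cprod_mult_vec)
qed (use assms(1) in \<open>simp add: cprod_mult_vec\<close>)

lemma cip_cl_cl_axis_self:
  "cip (cl a (cl b (axis X 1))) (axis X 1) = - (\<Sum>i\<in>UNIV. if i \<in> X then a $ i * cnj (b $ i) else cnj (a $ i) * b $ i)"
proof -
  have "cip (cl a (cl b (axis X 1))) (axis X 1) = (\<Sum>i\<in>UNIV. \<Sum>j\<in>UNIV. cl_coeff a i X * wedge_sign i X *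
    (cl_coeff b j (tog i X) * wedge_sign j (tog i X)) * axis X 1 $ tog j (tog i X))"
    by (simp add: cip_axis cl_cl_nth)
  also have "\<dots> = (\<Sum>i\<in>UNIV. \<Sum>j\<in>UNIV. if j = i then cl_coeff a i X * cl_coeff b i (tog i X) else 0)"
  proof (intro sum.cong refl)
    fix i j
    show "cl_coeff a i X * wedge_sign i X * (cl_coeff b j (tog i X) * wedge_sign j (tog i X)) * axis X 1 $ tog j (tog i X) =
      (if j = i then cl_coeff a i X * cl_coeff b i (tog i X) else 0)"
    proof (cases "j = i")
      case True
      have "wedge_sign i X * (wedge_sign i X * c) = c" for c
        using wedge_sign_square(1)[of i X] by (simp flip: mult.assoc)
      then show ?thesis using True by (simp add: tog_tog wedge_sign_tog axis_def mult_ac)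
    next
      case False
      then have "i \<in> tog j (tog i X) \<longleftrightarrow> i \<notin> X" by (simp add: mem_tog)
      then have "tog j (tog i X) \<noteq> X" by blast
      then show ?thesis using False by (simp add: axis_def)
    qed
  qed
  also have "\<dots> = (\<Sum>i\<in>UNIV. - (if i \<in> X then a $ i * cnj (b $ i) else cnj (a $ i) * b $ i))"
    by (intro sum.cong refl) (simp add: cl_coeff_def mem_tog)
  finally show ?thesis by (simp add: sum_negf)
qed

lemma cip_cl_cl_axis_zero:
  assumes "\<And>i j. tog j (tog i Y) \<noteq> X"
  shows "cip (cl a (cl b (axis X 1))) (axis Y 1) = 0"
  unfolding cip_axis cl_cl_nth using assms by (simp add: axis_def)

lemma tog_tog_neq_tog4: "tog j (tog i Y) \<noteq> tog4 Y"
proof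
  assume *: "tog j (tog i Y) = tog4 Y"
  have "k \<in> tog j (tog i Y) \<longleftrightarrow> k \<in> tog4 Y" for k using * by simp
  then have "k = i \<or> k = j" if "k \<noteq> 4" for k using that by (auto simp: mem_tog mem_tog4)
  from this[of 0] this[of 1] this[of 2] show False by auto
qed

lemma tog4_tog4: "tog4 (tog4 Y) = Y"
  by (auto simp: set_eq_iff mem_tog4)

text \<open>Two Clifford factors change at most two indices, whereas \<open>X\<close> and
  \<open>tog4 X\<close> differ in four, so there are no cross terms.\<close>

lemma cip_cl_cl_pair:
  "cip (cl a (cl b (axis X 1 + axis (tog4 X) 1))) (axis X 1 + axis (tog4 X) 1) =
    cip (cl a (cl b (axis X 1))) (axis X 1) + cip (cl a (cl b (axis (tog4 X) 1))) (axis (tog4 X) 1)"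
proof -
  have "cip (cl a (cl b (axis X 1))) (axis (tog4 X) 1) = 0" "cip (cl a (cl b (axis (tog4 X) 1))) (axis X 1) = 0"
    using tog_tog_neq_tog4[of _ _ "tog4 X"] tog_tog_neq_tog4[of _ _ X]
    by (auto intro!: cip_cl_cl_axis_zero simp: tog4_tog4)
  then show ?thesis by (simp add: cl_linear cip_simps)
qed

text \<open>Index by index the imaginary part changes sign with membership. The indices 0 to 3
  cancel within each pair of sets, and index 4 cancels between the pairs.\<close>

lemma Im_cip_cl_cl_weights:
  "Im (cip (cl a (cl b (axis A 1 + axis (tog4 A) 1))) (axis A 1 + axis (tog4 A) 1) +
    cip (cl a (cl b (axis B 1 + axis (tog4 B) 1))) (axis B 1 + axis (tog4 B) 1)) = 0"
  if "(4 \<in> B) \<noteq> (4 \<in> A)"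
  using that unfolding cip_cl_cl_pair cip_cl_cl_axis_self sum_5 mem_tog4
  by (simp add: algebra_simps)

section \<open>The complex span of the infinitesimal orbit of Spin(10)\<close>

definition half_cl :: "5 \<Rightarrow> bool \<Rightarrow> complex ^ (5 set) \<Rightarrow> complex ^ (5 set)" where
  "half_cl i \<sigma> x = cl (axis i 1) x + (if \<sigma> then \<i> else - \<i>) *s cl (axis i \<i>) x"

text \<open>Up to a factor, \<open>half_cl i True\<close> annihilates and \<open>half_cl i False\<close> creates \<open>i\<close>.\<close>

lemma half_cl_linear: "half_cl i \<sigma> (x + y) = half_cl i \<sigma> x + half_cl i \<sigma> y"
  "half_cl i \<sigma> (c *s x) = c *s half_cl i \<sigma> x"
  by (simp_all add: half_cl_def cl_linear vec_eq_iff algebra_simps)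

lemma half_cl_axis: "half_cl i \<sigma> (axis A 1) =
    (if (i \<in> A) = \<sigma> then (if \<sigma> then - 2 else 2) * wedge_sign i A else 0) *s axis (tog i A) 1"
  by (auto simp: half_cl_def cl_axis vec_eq_iff)

definition half_cl_coeff :: "5 \<Rightarrow> 5 \<Rightarrow> bool \<Rightarrow> bool \<Rightarrow> 5 set \<Rightarrow> complex" where
  "half_cl_coeff i j \<sigma> \<tau> A = (if \<tau> then - 2 else 2) * wedge_sign j A * ((if \<sigma> then - 2 else 2) * wedge_sign i (tog j A))"

lemma half_cl_half_cl_axis:
  assumes "i \<noteq> j"
  shows "half_cl i \<sigma> (half_cl j \<tau> (axis A 1)) =
    (if (i \<in> A) = \<sigma> \<and> (j \<in> A) = \<tau> then half_cl_coeff i j \<sigma> \<tau> A else 0) *s axis (tog i (tog j A)) 1"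
  using assms by (auto simp: half_cl_axis half_cl_linear vector_smult_assoc half_cl_coeff_def mem_tog)

lemma half_cl_coeff_nz: "half_cl_coeff i j \<sigma> \<tau> A \<noteq> 0"
  by (simp add: half_cl_coeff_def wedge_sign_square)

lemma inner_axis_axis_complex: "axis i u \<bullet> axis j w = (if i = j then u \<bullet> w else 0)" for u w :: complex
  by (simp add: inner_axis) (simp add: axis_def)

lemma norm_axis_complex: "norm (axis i u :: complex ^ 5) = norm u"
  by (simp add: norm_eq_sqrt_inner inner_axis_axis_complex)

lemma csub_half:
  assumes C: "csub C" and uv: "u + v \<in> C" "u - v \<in> C"
  shows "u \<in> C" "v \<in> C"
proof -
  have "cscale (1 / 2) ((u + v) + (u - v)) \<in> C" "cscale (1 / 2) ((u + v) - (u - v)) \<in> C"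
    by (intro csubD[OF C] uv)+
  moreover have "(u + v) + (u - v) = cscale 2 u" "(u + v) - (u - v) = cscale 2 v"
    by (simp_all add: cscale_def prod_eq_iff vec_eq_iff)
  ultimately show "u \<in> C" "v \<in> C" by (simp_all only: cscale_simps) (simp_all add: cscale_simps)
qed

text \<open>A product of two \<open>half_cl\<close> with distinct indices kills every e_X whose
  membership pattern there is not the prescribed one. When the four weights of \<open>p\<close> have
  four different patterns, choosing a pattern isolates one of them. Double toggles then give all
  weights of the half-spin space outside the base point, and the torus together with the circle
  gives those of the base point.\<close>

lemma spin_spanning:
  fixes C :: "(5 set, 5 set) vsum set"
  assumes C: "csub C" and AB: "B = tog 0 (tog 4 A)"
    and ab: "a \<noteq> 0" "b \<noteq> 0" and ks: "0 < k" "0 < s"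
    and p: "p = (a *s (axis A 1 + axis (tog4 A) 1), b *s (axis B 1 + axis (tog4 B) 1))"
    and cv: "circ_vel k s p \<in> C"
    and SC: "\<And>x y. norm x = 1 \<Longrightarrow> norm y = 1 \<Longrightarrow> x \<bullet> y = 0 \<Longrightarrow> cl2 x (cl2 y p) \<in> C"
    and par: "even (card A) = par"
  shows "half_spin par \<times> half_spin par \<subseteq> C"
proof -
  \<comment> \<open>Expanding gives four products of real directions from different coordinate
    lines, which are orthogonal, so each lies in \<open>C\<close>.\<close>
  have pairs: "map_prod (\<lambda>x. half_cl i \<sigma> (half_cl j \<tau> x)) (\<lambda>x. half_cl i \<sigma> (half_cl j \<tau> x)) p \<in> C"
    if ij: "i \<noteq> j" for i j \<sigma> \<tau>
  proof -
    define u v where "u = (if \<sigma> then \<i> else - \<i>)" and "v = (if \<tau> then \<i> else - \<i>)"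
    have "map_prod (\<lambda>x. half_cl i \<sigma> (half_cl j \<tau> x)) (\<lambda>x. half_cl i \<sigma> (half_cl j \<tau> x)) p =
      cl2 (axis i 1) (cl2 (axis j 1) p) + cscale v (cl2 (axis i 1) (cl2 (axis j \<i>) p)) +
      cscale u (cl2 (axis i \<i>) (cl2 (axis j 1) p)) + cscale (u * v) (cl2 (axis i \<i>) (cl2 (axis j \<i>) p))"
      unfolding half_cl_def u_def[symmetric] v_def[symmetric]
      by (cases p) (simp add: cl2_def cl_linear cscale_def vec_eq_iff algebra_simps)
    also have "\<dots> \<in> C"
      using ij by (intro csubD[OF C] SC) (simp_all add: norm_axis_complex inner_axis_axis_complex)
    finally show ?thesis .
  qed
  have weights: "(axis (tog i (tog j A)) 1, 0) \<in> C \<and> (axis (tog i (tog j (tog4 A))) 1, 0) \<in> C \<and>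
      (0, axis (tog i (tog j B)) 1) \<in> C \<and> (0, axis (tog i (tog j (tog4 B))) 1) \<in> C"
    if "i \<noteq> j" "i = 0 \<or> j = 4" for i j
  proof -
    have r: "(i \<in> tog4 A) = ((i \<in> A) \<noteq> (i \<noteq> 4))" "(i \<in> B) = ((i \<in> A) \<noteq> (i = 0 \<or> i = 4))" "(i \<in> tog4 B) = ((i \<in> A) \<noteq> (i \<noteq> 0))" for i
      by (auto simp: AB mem_tog mem_tog4)
    have e: "map_prod (\<lambda>x. half_cl i \<sigma> (half_cl j \<tau> x)) (\<lambda>x. half_cl i \<sigma> (half_cl j \<tau> x)) p =
      (a *s ((if (i \<in> A) = \<sigma> \<and> (j \<in> A) = \<tau> then half_cl_coeff i j \<sigma> \<tau> A else 0) *s axis (tog i (tog j A)) 1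
        + (if (i \<in> tog4 A) = \<sigma> \<and> (j \<in> tog4 A) = \<tau> then half_cl_coeff i j \<sigma> \<tau> (tog4 A) else 0) *s axis (tog i (tog j (tog4 A))) 1),
       b *s ((if (i \<in> B) = \<sigma> \<and> (j \<in> B) = \<tau> then half_cl_coeff i j \<sigma> \<tau> B else 0) *s axis (tog i (tog j B)) 1
        + (if (i \<in> tog4 B) = \<sigma> \<and> (j \<in> tog4 B) = \<tau> then half_cl_coeff i j \<sigma> \<tau> (tog4 B) else 0) *s axis (tog i (tog j (tog4 B))) 1))" for \<sigma> \<tau>
      using that(1) by (simp add: p half_cl_linear half_cl_half_cl_axis)
    \<comment> \<open>The four patterns are pairwise distinct: relative to \<open>A\<close>, the
      other three weights differ by the three nonzero patterns at (i, j).\<close>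
    have nd: "((i \<in> A) = (i \<in> tog4 A) \<and> (j \<in> A) = (j \<in> tog4 A)) = False"
      "((i \<in> A) = (i \<in> B) \<and> (j \<in> A) = (j \<in> B)) = False"
      "((i \<in> A) = (i \<in> tog4 B) \<and> (j \<in> A) = (j \<in> tog4 B)) = False"
      "((i \<in> tog4 A) = (i \<in> A) \<and> (j \<in> tog4 A) = (j \<in> A)) = False"
      "((i \<in> tog4 A) = (i \<in> B) \<and> (j \<in> tog4 A) = (j \<in> B)) = False"
      "((i \<in> tog4 A) = (i \<in> tog4 B) \<and> (j \<in> tog4 A) = (j \<in> tog4 B)) = False"
      "((i \<in> B) = (i \<in> A) \<and> (j \<in> B) = (j \<in> A)) = False"
      "((i \<in> B) = (i \<in> tog4 A) \<and> (j \<in> B) = (j \<in> tog4 A)) = False"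
      "((i \<in> B) = (i \<in> tog4 B) \<and> (j \<in> B) = (j \<in> tog4 B)) = False"
      "((i \<in> tog4 B) = (i \<in> A) \<and> (j \<in> tog4 B) = (j \<in> A)) = False"
      "((i \<in> tog4 B) = (i \<in> tog4 A) \<and> (j \<in> tog4 B) = (j \<in> tog4 A)) = False"
      "((i \<in> tog4 B) = (i \<in> B) \<and> (j \<in> tog4 B) = (j \<in> B)) = False"
      using \<open>i \<noteq> j\<close> \<open>i = 0 \<or> j = 4\<close> by (cases "i \<in> A"; cases "j \<in> A"; auto simp: r)+
    have 1: "cscale (a * half_cl_coeff i j (i \<in> A) (j \<in> A) A) (axis (tog i (tog j A)) 1, 0) \<in> C"
      using pairs[OF that(1), of "i \<in> A" "j \<in> A"] unfolding e
      by (simp add: cscale_def vector_smult_assoc nd)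
    have 2: "cscale (a * half_cl_coeff i j (i \<in> tog4 A) (j \<in> tog4 A) (tog4 A)) (axis (tog i (tog j (tog4 A))) 1, 0) \<in> C"
      using pairs[OF that(1), of "i \<in> tog4 A" "j \<in> tog4 A"] unfolding e
      by (simp add: cscale_def vector_smult_assoc nd)
    have 3: "cscale (b * half_cl_coeff i j (i \<in> B) (j \<in> B) B) (0, axis (tog i (tog j B)) 1) \<in> C"
      using pairs[OF that(1), of "i \<in> B" "j \<in> B"] unfolding e
      by (simp add: cscale_def vector_smult_assoc nd)
    have 4: "cscale (b * half_cl_coeff i j (i \<in> tog4 B) (j \<in> tog4 B) (tog4 B)) (0, axis (tog i (tog j (tog4 B))) 1) \<in> C"
      using pairs[OF that(1), of "i \<in> tog4 B" "j \<in> tog4 B"] unfolding e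
      by (simp add: cscale_def vector_smult_assoc nd)
    show ?thesis
      using 1 2 3 4 ab half_cl_coeff_nz csub_unscale[OF C] by (metis mult_eq_0_iff)
  qed
  define x0 x1 y0 y1 :: "(5 set, 5 set) vsum" where "x0 = (a *s axis A 1, 0)" and "x1 = (a *s axis (tog4 A) 1, 0)"
    and "y0 = (0, b *s axis B 1)" and "y1 = (0, b *s axis (tog4 B) 1)"
  define \<epsilon> where "\<epsilon> i X = (if i \<in> X then 1 else - 1 :: complex)" for i :: 5 and X
  have diag: "cscale (\<epsilon> i A) x0 + cscale (\<epsilon> i (tog4 A)) x1 + cscale (\<epsilon> i B) y0 + cscale (\<epsilon> i (tog4 B)) y1 \<in> C" for i
  proof (rule csub_unscale[OF C])
    have "cl2 (axis i 1) (cl2 (axis i \<i>) p) \<in> C"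
      by (rule SC) (simp_all add: norm_axis_complex inner_axis_axis_complex)
    also have "cl2 (axis i 1) (cl2 (axis i \<i>) p) = cscale \<i> (cscale (\<epsilon> i A) x0 + cscale (\<epsilon> i (tog4 A)) x1 + cscale (\<epsilon> i B) y0 + cscale (\<epsilon> i (tog4 B)) y1)"
      by (auto simp: p cl2_def cl_linear cl_diag_axis \<epsilon>_def x0_def x1_def y0_def y1_def cscale_def vec_eq_iff algebra_simps)
    finally show "cscale \<i> (cscale (\<epsilon> i A) x0 + cscale (\<epsilon> i (tog4 A)) x1 + cscale (\<epsilon> i B) y0 + cscale (\<epsilon> i (tog4 B)) y1) \<in> C" .
  qed simp
  have \<epsilon>: "\<epsilon> i A * \<epsilon> i A = 1" "\<epsilon> i (tog4 A) = (if i = 4 then \<epsilon> i A else - \<epsilon> i A)"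
    "\<epsilon> i B = (if i = 0 \<or> i = 4 then - \<epsilon> i A else \<epsilon> i A)"
    "\<epsilon> i (tog4 B) = (if i = 0 then \<epsilon> i A else - \<epsilon> i A)" for i
    by (auto simp: \<epsilon>_def AB mem_tog mem_tog4)
  have "cscale (\<epsilon> i A) (cscale (\<epsilon> i A) x0 + cscale (\<epsilon> i (tog4 A)) x1 + cscale (\<epsilon> i B) y0 + cscale (\<epsilon> i (tog4 B)) y1) \<in> C" for i
    by (rule csubD(3)[OF C diag])
  \<comment> \<open>On (x0, x1, y0, y1) the torus directions 0, 1 and 4 have the sign rows (+ - -
    +), (+ - + -) and (+ + - -); the circle supplies the fourth independent row (k, k, s,
    s).\<close>
  from this[of 0] this[of 1] this[of 4]
  have d: "x0 - x1 - y0 + y1 \<in> C" "x0 - x1 + y0 - y1 \<in> C" "x0 + x1 - y0 - y1 \<in> C"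
    unfolding \<epsilon>(2-4) by (simp_all add: cscale_simps \<epsilon>(1) add_diff_eq diff_diff_eq)
  have pp: "fst p = fst (x0 + x1)" "snd p = snd (y0 + y1)"
    by (simp_all add: p x0_def x1_def y0_def y1_def vec_eq_iff algebra_simps)
  have "x0 + x1 - y0 - y1 = (fst p, - (of_real 1 *s snd p))"
    by (simp add: pp x0_def x1_def y0_def y1_def)
  then have "(fst p, - (of_real 1 *s snd p)) \<in> C" using d(3) by simp
  from csub_split[OF C this csub_circ_vel[OF C cv]] ks
  have "(fst p, 0) \<in> C" "(0, snd p) \<in> C" by simp_all
  then have sums: "x0 + x1 \<in> C" "y0 + y1 \<in> C" by (simp_all add: pp x0_def x1_def y0_def y1_def)
  have "(x0 - x1) + (y0 - y1) \<in> C" "(x0 - x1) - (y0 - y1) \<in> C" using d by (simp_all add: algebra_simps)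
  from csub_half[OF C this] have diffs: "x0 - x1 \<in> C" "y0 - y1 \<in> C" .
  have "x0 \<in> C" "x1 \<in> C" "y0 \<in> C" "y1 \<in> C"
    using csub_half[OF C sums(1) diffs(1)] csub_half[OF C sums(2) diffs(2)] by blast+
  then have "cscale a (axis A 1, 0) \<in> C" "cscale a (axis (tog4 A) 1, 0) \<in> C"
    "cscale b (0, axis B 1) \<in> C" "cscale b (0, axis (tog4 B) 1) \<in> C"
    by (simp_all add: cscale_def x0_def x1_def y0_def y1_def)
  then have base: "(axis A 1, 0) \<in> C" "(axis (tog4 A) 1, 0) \<in> C" "(0, axis B 1) \<in> C" "(0, axis (tog4 B) 1) \<in> C"
    using csub_unscale[OF C] ab by blast+
  have parB: "even (card B) = par" using par by (simp add: AB even_card_tog)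
  have "(axis X 1, 0) \<in> C" if X: "even (card X) = par" for X
  proof -
    have "even (card X) = even (card A)" using X par by simp
    from same_parity_cases[OF this] show ?thesis using base weights by auto
  qed
  moreover have "(0, axis X 1) \<in> C" if X: "even (card X) = par" for X
  proof -
    have "even (card X) = even (card B)" using X parB by simp
    from same_parity_cases[OF this] show ?thesis using base weights by auto
  qed
  ultimately show ?thesis
    unfolding half_spin_span by (intro csub_Times[OF C]) auto
qed

lemma Spin10_half_spin: "g \<in> Spin10 \<Longrightarrow> x \<in> half_spin par \<Longrightarrow> g *v x \<in> half_spin par"
proof -
  assume "g \<in> Spin10" and x: "x \<in> half_spin par"
  then obtain zs where "g = cprod zs" "even (length zs)" by (auto simp: Spin10_eq)
  then show ?thesis using cprod_half_spin[OF x, of zs] by simp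
qed

text \<open>The second factor starts at - a, not a, because a unit vector squares to -1 and the
  curve has to start at the identity.\<close>

lemma Spin10_curve:
  assumes "norm a = 1" "norm b = 1" "a \<bullet> b = 0"
  defines "\<gamma> \<equiv> \<lambda>r. clifford a ** clifford (- cos r *\<^sub>R a + sin r *\<^sub>R b)"
  shows "\<gamma> r \<in> Spin10" "\<gamma> 0 = mat 1"
    "(\<gamma> has_vector_derivative clifford a ** clifford b) (at 0)"
proof -
  have "(norm (- cos r *\<^sub>R a + sin r *\<^sub>R b))\<^sup>2 = (cos r)\<^sup>2 * (norm a)\<^sup>2 + (sin r)\<^sup>2 * (norm b)\<^sup>2"
    unfolding power2_norm_eq_inner using assms(3)
    by (simp add: inner_add_left inner_add_right inner_diff_left inner_diff_right inner_commute power2_eq_square)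
  then have "(norm (- cos r *\<^sub>R a + sin r *\<^sub>R b))\<^sup>2 = 1" using assms(1,2) by simp
  then have "norm (- cos r *\<^sub>R a + sin r *\<^sub>R b) = 1"
    by (simp add: abs_square_eq_1)
  then show "\<gamma> r \<in> Spin10" unfolding \<gamma>_def by (intro cl_cl_Spin10 assms)
  have "\<gamma> 0 *v x = mat 1 *v x" for x
    using assms(1) by (simp add: \<gamma>_def matrix_vector_mul_assoc[symmetric] cl_linear cl_square)
  then show "\<gamma> 0 = mat 1" unfolding matrix_eq by blast
  have bl: "bounded_linear (\<lambda>z. clifford a ** clifford z)"
    by (auto intro!: linear_conv_bounded_linear[THEN iffD1] linearI
        simp: clifford_linear matrix_matrix_mult_def vec_eq_iff scaleR_sum_right distrib_left sum.distrib)
  have "((\<lambda>r. - cos r *\<^sub>R a + sin r *\<^sub>R b) has_vector_derivative b) (at 0)"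
    by (auto intro!: derivative_eq_intros simp: has_vector_derivative_def)
  then show "(\<gamma> has_vector_derivative clifford a ** clifford b) (at 0)"
    unfolding \<gamma>_def by (rule bounded_linear.has_vector_derivative[OF bl])
qed

lemma Spin10_group:
  assumes "g \<in> Spin10"
  shows "adj g ** g = mat 1" "\<exists>g'\<in>Spin10. g' ** g = mat 1" "g' \<in> Spin10 \<Longrightarrow> g ** g' \<in> Spin10"
proof -
  obtain zs where zs: "g = cprod zs" "even (length zs)" "\<forall>z\<in>set zs. norm z = 1"
    using assms by (auto simp: Spin10_eq)
  have "cip ((adj g ** g) *v x) y = cip (mat 1 *v x) y" for x y
    using cip_cprod[OF zs(3), of x y] cip_adj[of "adj g" "g *v x" y]
    by (simp add: zs(1) adj_simps matrix_vector_mul_assoc)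
  then have "((adj g ** g) *v x) $ i = (mat 1 *v x) $ i" for x i by (metis cip_axis(1))
  then have "(adj g ** g) *v x = mat 1 *v x" for x unfolding vec_eq_iff by blast
  then show "adj g ** g = mat 1" unfolding matrix_eq by blast
  have "(cprod (rev zs) ** g) *v x = mat 1 *v x" for x
    using zs by (simp add: cprod_rev matrix_vector_mul_assoc[symmetric])
  then have "cprod (rev zs) ** g = mat 1" unfolding matrix_eq by blast
  moreover have "cprod (rev zs) \<in> Spin10" unfolding Spin10_eq using zs by auto
  ultimately show "\<exists>g'\<in>Spin10. g' ** g = mat 1" by blast
  assume "g' \<in> Spin10"
  then obtain zs' where zs': "g' = cprod zs'" "even (length zs')" "\<forall>z\<in>set zs'. norm z = 1"
    by (auto simp: Spin10_eq)
  have "cprod (zs @ zs') *v x = (g ** g') *v x" for x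
    by (simp add: zs zs' cprod_append matrix_vector_mul_assoc)
  then have "g ** g' = cprod (zs @ zs')" unfolding matrix_eq by metis
  then show "g ** g' \<in> Spin10" unfolding Spin10_eq using zs zs' by (intro CollectI exI[of _ "zs @ zs'"]) auto
qed

lemma mat1_Spin10: "mat 1 \<in> Spin10"
  unfolding Spin10_eq by (intro CollectI exI[of _ "[]"]) (auto simp: cprod_simps)

lemma Spin10_half_spin_half_spin:
  fixes h :: "(5 set, 5 set) vsum \<Rightarrow> (5 set, 5 set) vsum \<Rightarrow> complex"
  assumes ks: "0 < k" "0 < s"
    and h: "invariant_product Spin10 (dsum_rep std_rep std_rep) (half_spin par) (half_spin par) h"
  shows "admits_lagrangian_orbit Spin10 (dsum_rep std_rep std_rep) (half_spin par) (half_spin par) h k s"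
proof -
  have sub: "vec.subspace (half_spin par)" unfolding half_spin_span by (rule vec.subspace_span)
  note hc = invariant_components[OF h sub sub]
  have zero: "std_rep A 0 = 0" "std_rep A 0 = 0" for A :: "complex ^ (5 set) ^ (5 set)"
    by (simp_all add: std_rep_def)
  define Bas :: "(complex ^ (5 set)) set" where "Bas = {axis A 1 | A. even (card A) = par}"
  obtain c1 where c1: "0 < c1" "\<forall>b\<in>Bas. \<forall>b'\<in>Bas. h (b, 0) (b', 0) = of_real c1 * cip b b'"
    using herm_on_half_spin[OF hc(1)[OF zero]] hc(3)[OF zero] unfolding Bas_def std_rep_def by blast
  obtain c2 where c2: "0 < c2" "\<forall>b\<in>Bas. \<forall>b'\<in>Bas. h (0, b) (0, b') = of_real c2 * cip b b'"
    using herm_on_half_spin[OF hc(2)[OF zero]] hc(4)[OF zero] unfolding Bas_def std_rep_def by blast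
  have h_eq: "h x y = hp c1 c2 x y" if "x \<in> half_spin par \<times> half_spin par" "y \<in> half_spin par \<times> half_spin par" for x y
    using invariant_product_eq_hp[of Spin10 _ Bas Bas h c1 c2 x y] h c1(2) c2(2) that
    unfolding half_spin_span Bas_def by blast
  \<comment> \<open>\<open>v\<close> and \<open>w\<close> have squared norm 2, whence the additional
    factor 2.\<close>
  define t where "t = 1 / (2 * (real k + real s))"
  have t: "0 < t" "real k * (t * 2) + real s * (t * 2) = 1" using ks by (auto simp: t_def simp flip: add_divide_distrib)
  obtain a where a: "a \<noteq> 0" "cnj a = a" "of_real c1 * (a * a) = of_real t"
    using real_scalar[OF c1(1) t(1)] by blast
  obtain b where b: "b \<noteq> 0" "cnj b = b" "of_real c2 * (b * b) = of_real t"
    using real_scalar[OF c2(1) t(1)] by blast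
  define A B :: "5 set" where "A = (if par then {} else {0})" and "B = tog 0 (tog 4 A)"
  have parA: "even (card A) = par" by (simp add: A_def)
  define v w :: "complex ^ (5 set)" where "v = axis A 1 + axis (tog4 A) 1" and "w = axis B 1 + axis (tog4 B) 1"
  have ax: "axis X 1 \<in> half_spin par" if "even (card X) = par" for X
    unfolding half_spin_span using that by (intro vec.span_base) blast
  have vw: "v \<in> half_spin par" "w \<in> half_spin par"
    using parA unfolding v_def w_def B_def tog4_def
    by (intro vec.subspace_add[OF sub] ax; simp add: even_card_tog)+
  have neq: "X \<noteq> tog4 X" "tog4 X \<noteq> X" for X using mem_tog4[of 0 X] by auto
  have cips: "cip v v = 2" "cip w w = 2"
    unfolding v_def w_def cip_simps cip_axis using neq by (simp_all add: axis_def)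
  have norm_vw: "(norm v)\<^sup>2 = 2" "(norm w)\<^sup>2 = 2"
    using cips unfolding cip_self by (metis of_real_eq_iff of_real_numeral)+
  define p where "p = (a *s v, b *s w)"
  define S where "S = {(clifford x ** clifford y, clifford x ** clifford y) | x y. norm x = 1 \<and> norm y = 1 \<and> x \<bullet> y = 0}"
  have p0: "spin_moment_zero c1 c2 p"
    unfolding spin_moment_zero_def
  proof (intro allI)
    fix x y
    have "hp c1 c2 (cl2 x (cl2 y p)) p = of_real t * (cip (cl x (cl y v)) v + cip (cl x (cl y w)) w)"
      by (simp add: p_def cl2_def cl_linear hp_scaled[OF a(2,3) b(2,3)] distrib_left)
    then show "Im (hp c1 c2 (cl2 x (cl2 y p)) p) = 0"
      using Im_cip_cl_cl_weights[of B A x y] by (simp add: v_def w_def B_def mem_tog)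
  qed
  have "isotropic_orbit Spin10 std_rep std_rep (\<lambda>A. A) (\<lambda>A. A) (half_spin par) (half_spin par) h c1 c2 k s S p"
  proof (rule isotropic_orbit.intro)
    show "vec.subspace (half_spin par)" "vec.subspace (half_spin par)" by (rule sub)+
    show "p \<in> half_spin par \<times> half_spin par" using vw by (auto simp: p_def intro: vec.subspace_scale[OF sub])
  next
    fix X1 X2 assume "(X1, X2) \<in> S"
    then obtain x y where xy: "norm x = 1" "norm y = 1" "x \<bullet> y = 0"
      and X: "X1 = clifford x ** clifford y" "X2 = clifford x ** clifford y"
      by (auto simp: S_def)
    have Xcl: "act2 X1 X2 z = cl2 x (cl2 y z)" for z
      by (cases z) (simp add: X cl2_def act2_def matrix_vector_mul_assoc)
    show "\<exists>\<gamma>::real \<Rightarrow> _. (\<forall>r. \<gamma> r \<in> Spin10) \<and> \<gamma> 0 = mat 1 \<and> (\<gamma> has_vector_derivative X1) (at 0) \<and>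
        (\<gamma> has_vector_derivative X2) (at 0)"
      unfolding X using Spin10_curve[OF xy]
      by (intro exI[of _ "\<lambda>r. clifford x ** clifford (- cos r *\<^sub>R x + sin r *\<^sub>R y)"]) simp
    fix g assume g: "g \<in> Spin10"
    then obtain zs where zs: "g = cprod zs" "\<forall>z\<in>set zs. norm z = 1"
      by (auto simp: Spin10_eq)
    define q where "q = act2 g g p"
    have "q = (cprod zs *v fst p, cprod zs *v snd p)"
      by (simp add: q_def act2_def zs)
    then have "spin_moment_zero c1 c2 q" using spin_moment_zero_cprod[OF p0 zs(2)] by simp
    then have Im: "Im (hp c1 c2 (cl2 x (cl2 y q)) q) = 0" by (simp add: spin_moment_zero_def)
    \<comment> \<open>For orthogonal \<open>x\<close>, \<open>y\<close> the product of the two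
      factors is skew, so the real part vanishes and the known imaginary part is all there
      is.\<close>
    have "hp c1 c2 (cl2 x (cl2 y q)) q = hp c1 c2 q (cl2 y (cl2 x q))"
      by (simp add: hp_cl2)
    also have "cl2 y (cl2 x q) = - cl2 x (cl2 y q)"
      using cl2_anticommute[of y x q] xy(3) by (simp add: inner_commute cscale_simps)
    also have "hp c1 c2 q (- cl2 x (cl2 y q)) = - cnj (hp c1 c2 (cl2 x (cl2 y q)) q)"
      by (simp add: cnj_hp) (simp add: hp_def cip_simps)
    finally have "Re (hp c1 c2 (cl2 x (cl2 y q)) q) = Re (- cnj (hp c1 c2 (cl2 x (cl2 y q)) q))"
      by (rule arg_cong)
    then have "hp c1 c2 (cl2 x (cl2 y q)) q = 0" using Im by (simp add: complex_eq_iff)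
    then show "hp c1 c2 (act2 X1 X2 (act2 g g p)) (act2 g g p) = 0"
      by (simp add: Xcl q_def)
  next
    fix C :: "(5 set, 5 set) vsum set"
    assume C: "csub C" and cv: "circ_vel k s p \<in> C" and SC: "\<And>X1 X2. (X1, X2) \<in> S \<Longrightarrow> act2 X1 X2 p \<in> C"
    have "cl2 x (cl2 y p) \<in> C" if "norm x = 1" "norm y = 1" "x \<bullet> y = 0" for x y
    proof -
      have "(clifford x ** clifford y, clifford x ** clifford y) \<in> S"
        using that by (auto simp: S_def)
      from SC[OF this] show ?thesis by (cases p) (simp add: cl2_def act2_def matrix_vector_mul_assoc)
    qed
    then show "half_spin par \<times> half_spin par \<subseteq> C"
      by (intro spin_spanning[OF C B_def a(1) b(1) ks p_def[unfolded v_def w_def] cv _ parA])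
  qed (use ks c1(1) c2(1) h_eq a b t norm_scaled[OF a(2,3), of v] norm_scaled[OF b(2,3), of w] norm_vw
      in \<open>auto simp: p_def std_rep_def mat1_Spin10 Spin10_group Spin10_half_spin\<close>)
  then show ?thesis by (rule isotropic_orbit.lagrangian_orbit)
qed

section \<open>The second exterior power\<close>

definition kron :: "complex ^ 'm::finite ^ 'm \<Rightarrow> complex ^ 'm ^ 'm \<Rightarrow> complex ^ ('m \<times> 'm) ^ ('m \<times> 'm)" where
  "kron A B = (\<chi> p q. A $ fst p $ fst q * B $ snd p $ snd q)"

lemma sum_UNIV_prod: "(\<Sum>p\<in>UNIV. f p) = (\<Sum>i\<in>UNIV. \<Sum>j\<in>UNIV. f (i, j))"
  for f :: "'a::finite \<times> 'b::finite \<Rightarrow> 'c::comm_monoid_add"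
  by (simp add: sum.cartesian_product)

lemma kron_mult: "kron A B ** kron C D = kron (A ** C) (B ** D)"
  by (simp add: vec_eq_iff kron_def matrix_matrix_mult_def sum_UNIV_prod sum_product mult_ac)

lemma kron_1: "kron (mat 1) (mat 1) = mat 1"
  by (auto simp: vec_eq_iff kron_def mat_def prod_eq_iff)

lemma adj_kron: "adj (kron A B) = kron (adj A) (adj B)"
  by (simp add: vec_eq_iff kron_def adj_def)

lemma ext2_rep_eq: "ext2_rep A = (*v) (kron A A)"
  by (auto simp: fun_eq_iff vec_eq_iff ext2_rep_def kron_def matrix_vector_mult_def sum_UNIV_prod)

definition kron_der :: "complex ^ 'm::finite ^ 'm \<Rightarrow> complex ^ ('m \<times> 'm) ^ ('m \<times> 'm)" where
  "kron_der Y = kron Y (mat 1) + kron (mat 1) Y"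

lemma bounded_bilinear_kron: "bounded_bilinear kron"
  unfolding bilinear_conv_bounded_bilinear [symmetric] bilinear_def
  by (auto intro!: linearI simp: kron_def vec_eq_iff algebra_simps)

lemma kron_der_mult_vec:
  "(kron_der Y *v T) $ (i, j) = (\<Sum>a\<in>UNIV. Y $ i $ a * T $ (a, j)) + (\<Sum>b\<in>UNIV. Y $ j $ b * T $ (i, b))"
proof -
  have 1: "(kron Y (mat 1) *v T) $ (i, j) = (\<Sum>a\<in>UNIV. \<Sum>b\<in>UNIV. if j = b then Y $ i $ a * T $ (a, b) else 0)"
    unfolding matrix_vector_mult_def kron_def sum_UNIV_prod mat_def vec_lambda_beta
    by (intro sum.cong refl) simp
  have 2: "(kron (mat 1) Y *v T) $ (i, j) = (\<Sum>a\<in>UNIV. if i = a then (\<Sum>b\<in>UNIV. Y $ j $ b * T $ (a, b)) else 0)"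
    unfolding matrix_vector_mult_def kron_def sum_UNIV_prod mat_def vec_lambda_beta
    by (intro sum.cong refl) simp
  show ?thesis
    unfolding kron_der_def matrix_vector_mult_add_rdistrib vector_add_component 1 2 by simp
qed

lemma kron_der_intertwine:
  fixes A :: "complex ^ 'm::finite ^ 'm"
  assumes "Y ** A = A ** Y'"
  shows "kron_der Y ** kron A A = kron A A ** kron_der Y'"
proof -
  have "(B + C) ** D = B ** D + C ** D" for B C D :: "complex ^ ('m \<times> 'm) ^ ('m \<times> 'm)"
    by (simp add: vec_eq_iff matrix_matrix_mult_def sum.distrib distrib_right)
  then show ?thesis using assms by (simp add: kron_der_def kron_mult matrix_add_ldistrib)
qed

definition wedge :: "complex ^ 'm::finite \<Rightarrow> complex ^ 'm \<Rightarrow> complex ^ ('m \<times> 'm)" where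
  "wedge x y = (\<chi> p. x $ fst p * y $ snd p - x $ snd p * y $ fst p)"

lemma kron_wedge: "kron A A *v wedge x y = wedge (A *v x) (A *v y)"
proof -
  have "(kron A A *v wedge x y) $ (i, j) = wedge (A *v x) (A *v y) $ (i, j)" for i j
  proof -
    have "(kron A A *v wedge x y) $ (i, j) =
      (\<Sum>a\<in>UNIV. \<Sum>b\<in>UNIV. (A $ i $ a * x $ a) * (A $ j $ b * y $ b) - (A $ i $ a * y $ a) * (A $ j $ b * x $ b))"
      unfolding matrix_vector_mult_def kron_def sum_UNIV_prod wedge_def vec_lambda_beta
      by (intro sum.cong refl) (simp add: algebra_simps)
    also have "\<dots> = wedge (A *v x) (A *v y) $ (i, j)"
      by (simp add: sum_subtractf wedge_def matrix_vector_mult_def mult.commute[of "\<Sum>_\<in>_. A $ i $ _ * y $ _"] flip: sum_product)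
    finally show ?thesis .
  qed
  then show ?thesis by (simp add: vec_eq_iff)
qed

lemma wedge_simps: "wedge (c *s x) y = c *s wedge x y" "wedge x (c *s y) = c *s wedge x y"
  "wedge (x + z) y = wedge x y + wedge z y" "wedge (x - z) y = wedge x y - wedge z y"
  "wedge x x = 0" "wedge y x = - wedge x y"
  by (simp_all add: vec_eq_iff wedge_def algebra_simps)

lemma ext2_iff: "T \<in> ext2 \<longleftrightarrow> (\<forall>i j. T $ (i, j) + T $ (j, i) = 0)"
  unfolding ext2_def by (simp add: eq_neg_iff_add_eq_0)

lemma ext2D: "T \<in> ext2 \<Longrightarrow> T $ (i, j) = - T $ (j, i)"
  unfolding ext2_def by blast

lemma kron_ext2: "T \<in> ext2 \<Longrightarrow> kron A A *v T \<in> ext2"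
proof -
  assume T: "T \<in> ext2"
  have "(kron A A *v T) $ (i, j) = - (kron A A *v T) $ (j, i)" for i j
  proof -
    have "(kron A A *v T) $ (i, j) = (\<Sum>a\<in>UNIV. \<Sum>b\<in>UNIV. A $ i $ a * A $ j $ b * T $ (a, b))"
      by (simp add: matrix_vector_mult_def kron_def sum_UNIV_prod)
    also have "\<dots> = (\<Sum>b\<in>UNIV. \<Sum>a\<in>UNIV. A $ i $ a * A $ j $ b * T $ (a, b))" by (rule sum.swap)
    also have "\<dots> = (\<Sum>b\<in>UNIV. \<Sum>a\<in>UNIV. - (A $ j $ b * A $ i $ a * T $ (b, a)))"
    proof (intro sum.cong refl)
      fix a b
      have "T $ (a, b) = - T $ (b, a)" by (rule ext2D[OF T])
      then show "A $ i $ a * A $ j $ b * T $ (a, b) = - (A $ j $ b * A $ i $ a * T $ (b, a))" by simp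
    qed
    also have "\<dots> = - (kron A A *v T) $ (j, i)"
      by (simp add: matrix_vector_mult_def kron_def sum_UNIV_prod sum_negf)
    finally show ?thesis .
  qed
  then show ?thesis unfolding ext2_def by blast
qed

abbreviation ew :: "'m::finite \<Rightarrow> 'm \<Rightarrow> complex ^ ('m \<times> 'm)" where
  "ew i j \<equiv> wedge (axis i 1) (axis j 1)"

lemma wedge_ext2: "wedge x y \<in> ext2"
  by (simp add: ext2_iff wedge_def)

lemma subspace_ext2: "vec.subspace (ext2 :: (complex ^ ('m::finite \<times> 'm)) set)"
proof -
  have "x + y \<in> ext2" if "x \<in> ext2" "y \<in> ext2" for x y :: "complex ^ ('m \<times> 'm)"
    unfolding ext2_def
  proof (intro CollectI allI)
    fix i j
    show "(x + y) $ (i, j) = - (x + y) $ (j, i)"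
      using ext2D[OF that(1), of i j] ext2D[OF that(2), of i j] by simp
  qed
  moreover have "c *s x \<in> ext2" if "x \<in> ext2" for c and x :: "complex ^ ('m \<times> 'm)"
    unfolding ext2_def
  proof (intro CollectI allI)
    fix i j
    show "(c *s x) $ (i, j) = - (c *s x) $ (j, i)"
      using ext2D[OF that, of i j] by simp
  qed
  moreover have "0 \<in> (ext2 :: (complex ^ ('m \<times> 'm)) set)" by (simp add: ext2_iff)
  ultimately show ?thesis by (simp add: vec.subspace_def)
qed

lemma ew_nth: "ew i j $ (a, b) = (if a = i \<and> b = j then 1 else 0) - (if a = j \<and> b = i then 1 else 0)"
  by (cases "a = i"; cases "b = j"; cases "a = j"; cases "b = i"; simp add: wedge_def axis_def)

lemma ext2_span: "(ext2 :: (complex ^ ('m::finite \<times> 'm)) set) = vec.span {ew i j | i j. i \<noteq> j}"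
proof (intro equalityI subsetI)
  fix T :: "complex ^ ('m \<times> 'm)" assume T: "T \<in> ext2"
  \<comment> \<open>Each unordered pair occurs twice in the double sum, hence the halves.\<close>
  have "T = (\<Sum>i\<in>UNIV. \<Sum>j\<in>UNIV. (T $ (i, j) / 2) *s ew i j)"
  proof -
    have "T $ (a, b) = (\<Sum>i\<in>UNIV. \<Sum>j\<in>UNIV. (T $ (i, j) / 2) *s ew i j) $ (a, b)" for a b
    proof -
      have "(\<Sum>i\<in>UNIV. \<Sum>j\<in>UNIV. (T $ (i, j) / 2) *s ew i j) $ (a, b) =
        (\<Sum>i\<in>UNIV. \<Sum>j\<in>UNIV. (if j = b then (if i = a then T $ (i, j) / 2 else 0) else 0) -
          (if j = a then (if i = b then T $ (i, j) / 2 else 0) else 0))"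
        unfolding sum_component vector_smult_component ew_nth by (intro sum.cong refl) auto
      also have "\<dots> = T $ (a, b) / 2 - T $ (b, a) / 2" by (simp add: sum_subtractf)
      also have "T $ (b, a) = - T $ (a, b)" by (rule ext2D[OF T])
      finally show ?thesis by simp
    qed
    then show ?thesis unfolding vec_eq_iff split_paired_All by blast
  qed
  also have "\<dots> \<in> vec.span {ew i j | i j. i \<noteq> j}"
  proof (intro vec.span_sum vec.span_scale)
    fix i j
    show "ew i j \<in> vec.span {ew i j | i j :: 'm. i \<noteq> j}"
    proof (cases "i = j")
      case True
      then show ?thesis by (simp add: wedge_simps(5) vec.span_zero)
    qed (intro vec.span_base, blast)
  qed
  finally show "T \<in> vec.span {ew i j | i j. i \<noteq> j}" .
next
  fix T :: "complex ^ ('m \<times> 'm)" assume "T \<in> vec.span {ew i j | i j. i \<noteq> j}"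
  moreover have "vec.span {ew i j | i j :: 'm. i \<noteq> j} \<subseteq> ext2"
    by (intro vec.span_minimal subspace_ext2) (auto simp: wedge_ext2)
  ultimately show "T \<in> ext2" by blast
qed

lemma rot_axis_fixed:
  assumes uv: "orthonormal u v" and "u $ j = 0" "v $ j = 0"
  shows "rot u v r *v axis j 1 = axis j 1"
  using assms by (intro rot_mult_uv(3)) (simp_all add: cip_axis)

lemma exists_outside:
  fixes F :: "'m::finite set"
  assumes "card F < CARD('m)"
  obtains y where "y \<notin> F"
  using assms by (metis UNIV_eq_I less_irrefl)

text \<open>Schur's lemma by weights again: rotations in coordinate planes separate the e_i wedge
  e_j, and rotations along normalized sums and differences compare their lengths.\<close>

lemma herm_on_ext2:
  fixes f :: "complex ^ ('m::finite \<times> 'm) \<Rightarrow> complex ^ ('m \<times> 'm) \<Rightarrow> complex"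
  assumes m: "5 \<le> CARD('m)" and f: "herm_on ext2 f"
    and inv: "\<And>g x y. g \<in> SU \<Longrightarrow> x \<in> ext2 \<Longrightarrow> y \<in> ext2 \<Longrightarrow> f (kron g g *v x) (kron g g *v y) = f x y"
  shows "\<exists>c>0. \<forall>b\<in>{ew i j | i j. i \<noteq> j}. \<forall>b'\<in>{ew i j | i j. i \<noteq> j}. f b b' = of_real c * cip b b'"
proof -
  note sub = subspace_ext2[where 'm = 'm]
  have c2: "cis (pi / 2) = \<i>" "cis (- (pi / 2)) = - \<i>" by (simp_all add: complex_eq_iff)
  have off1: "f (ew x i) (ew k l) = 0" if x: "x \<notin> {k, l}" "x \<noteq> i" for x i k l
  proof -
    \<comment> \<open>Dimension at least 5 leaves room for an index \<open>y\<close> outside these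
      four. The rotation in \<open>x\<close>, \<open>y\<close> then multiplies e_x wedge e_i by \<i>
      and fixes e_k wedge e_l.\<close>
    have "card {x, i, k, l} \<le> 4" by (simp add: card_insert_if)
    then have "card {x, i, k, l} < CARD('m)" using m by simp
    then obtain y where y: "y \<notin> {x, i, k, l}" by (rule exists_outside)
    have uv: "orthonormal (axis x 1 :: complex ^ 'm) (axis y 1)" using y by (intro orthonormal_axis) auto
    have fix': "rot (axis x 1) (axis y 1) (pi / 2) *v axis z 1 = (axis z 1 :: complex ^ 'm)" if "z \<noteq> x" "z \<noteq> y" for z
      using that by (intro rot_axis_fixed[OF uv]) (auto simp: axis_def)
    have fixed: "rot (axis x 1) (axis y 1) (pi / 2) *v axis i 1 = (axis i 1 :: complex ^ 'm)"
      "rot (axis x 1) (axis y 1) (pi / 2) *v axis k 1 = (axis k 1 :: complex ^ 'm)"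
      "rot (axis x 1) (axis y 1) (pi / 2) *v axis l 1 = (axis l 1 :: complex ^ 'm)"
      using x y by (intro fix'; blast)+
    have "kron (rot (axis x 1) (axis y 1) (pi / 2)) (rot (axis x 1) (axis y 1) (pi / 2)) *v ew x i = \<i> *s ew x i"
      "kron (rot (axis x 1) (axis y 1) (pi / 2)) (rot (axis x 1) (axis y 1) (pi / 2)) *v ew k l = 1 *s ew k l"
      by (simp_all add: kron_wedge rot_mult_uv(1)[OF uv] fixed wedge_simps(1) c2)
    then have "f (\<i> *s ew x i) (1 *s ew k l) = f (ew x i) (ew k l)"
      using inv[OF rot_SU[OF uv], of "ew x i" "ew k l" "pi / 2"] by (simp only: wedge_ext2)
    then show ?thesis by (rule herm_on_scaled_zero[OF f sub wedge_ext2 wedge_ext2]) (simp add: complex_eq_iff)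
  qed
  have neg: "f (- x) y = - f x y" if "x \<in> ext2" "y \<in> ext2" for x y
    using herm_onD(2)[OF f that, of "- 1"] by simp
  have neg': "f x (- y) = - f x y" if "x \<in> ext2" "y \<in> ext2" for x y
    using herm_onD_right(2)[OF f sub that, of "- 1"] by simp
  have off: "f (ew i j) (ew k l) = 0" if ij: "i \<noteq> j" "{i, j} \<noteq> {k, l}" "k \<noteq> l" for i j k l
  proof -
    from ij consider "i \<notin> {k, l}" | "j \<notin> {k, l}" by fastforce
    then show ?thesis
    proof cases
      case 2
      have "f (ew j i) (ew k l) = 0" using 2 ij by (intro off1) auto
      then show ?thesis using neg[OF wedge_ext2[of "axis j 1" "axis i 1"] wedge_ext2[of "axis k 1" "axis l 1"]]
        by (simp add: wedge_simps(6)[of "axis i 1" "axis j 1"])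
    qed (use off1 ij in auto)
  qed
  have ew_sym: "f (ew i j) (ew i j) = f (ew j i) (ew j i)" for i j
  proof -
    have 1: "- ew i j \<in> ext2" by (rule vec.subspace_neg[OF sub wedge_ext2])
    have "f (ew j i) (ew j i) = f (- ew i j) (- ew i j)"
      by (simp only: wedge_simps(6)[of "axis j 1" "axis i 1"])
    also have "\<dots> = - f (ew i j) (- ew i j)" by (rule neg[OF wedge_ext2 1])
    also have "\<dots> = f (ew i j) (ew i j)" by (simp only: neg'[OF wedge_ext2 wedge_ext2] minus_minus)
    finally show ?thesis by (rule sym)
  qed
  have step: "f (ew i j) (ew i j) = f (ew k j) (ew k j)" if "i \<noteq> j" "k \<noteq> j" for i j k
  proof (cases "i = k")
    case False
    define a where "a = complex_of_real (1 / sqrt 2)"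
    have a: "a * cnj a = 1 / 2" "a \<noteq> 0"
      by (auto simp: a_def simp flip: of_real_mult of_real_divide) (simp add: real_sqrt_mult_self)
    have a': "a * (cnj a * c) = c / 2" for c using a by (simp flip: mult.assoc)
    \<comment> \<open>Wedged with e_j, these have eigenvalues \<i> and - \<i>. Their orthogonality
      is that of the sum and difference needed for \<open>herm_on_pair_equal\<close>.\<close>
    define u v :: "complex ^ 'm" where "u = a *s (axis i 1 + axis k 1)" and "v = a *s (axis i 1 - axis k 1)"
    have uv: "orthonormal u v"
      using orthonormalD[OF orthonormal_axis[OF False]]
      unfolding orthonormal_def u_def v_def by (simp add: cip_simps a' algebra_simps)
    have j: "rot u v r *v axis j 1 = axis j 1" for r
      using that by (intro rot_axis_fixed[OF uv]) (auto simp: u_def v_def axis_def)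
    have e: "kron (rot u v (pi / 2)) (rot u v (pi / 2)) *v wedge u (axis j 1) = \<i> *s wedge u (axis j 1)"
      "kron (rot u v (pi / 2)) (rot u v (pi / 2)) *v wedge v (axis j 1) = (- \<i>) *s wedge v (axis j 1)"
      by (simp_all only: kron_wedge rot_mult_uv(1,2)[OF uv] j wedge_simps(1) c2)
    have "f (\<i> *s wedge u (axis j 1)) ((- \<i>) *s wedge v (axis j 1)) = f (wedge u (axis j 1)) (wedge v (axis j 1))"
      using inv[OF rot_SU[OF uv], of "wedge u (axis j 1)" "wedge v (axis j 1)" "pi / 2"]
      unfolding e by (simp only: wedge_ext2)
    then have "f (wedge u (axis j 1)) (wedge v (axis j 1)) = 0"
      by (rule herm_on_scaled_zero[OF f sub wedge_ext2 wedge_ext2]) simp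
    then have "f (a *s (ew i j + ew k j)) (a *s (ew i j - ew k j)) = 0"
      by (simp only: u_def v_def wedge_simps(1,3,4))
    moreover have mem: "ew i j + ew k j \<in> ext2" "ew i j - ew k j \<in> ext2" "a *s (ew i j - ew k j) \<in> ext2"
      by (intro vec.subspace_add[OF sub] vec.subspace_diff[OF sub] vec.subspace_scale[OF sub] wedge_ext2)+
    moreover have "f (a *s (ew i j + ew k j)) (a *s (ew i j - ew k j)) = a * (cnj a * f (ew i j + ew k j) (ew i j - ew k j))"
      by (simp only: herm_onD(2)[OF f mem(1,3)] herm_onD_right(2)[OF f sub mem(1,2)])
    ultimately have "f (ew i j + ew k j) (ew i j - ew k j) = 0" using a(2) by simp
    moreover have "f (ew i j) (ew k j) = 0" using that False by (intro off) (auto simp: doubleton_eq_iff)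
    ultimately show ?thesis by (intro herm_on_pair_equal[OF f sub wedge_ext2 wedge_ext2])
  qed simp
  obtain i0 :: 'm where True by blast
  have "card {i0} < CARD('m)" using m by simp
  then obtain j0 where "j0 \<notin> {i0}" by (rule exists_outside)
  then have ij0: "i0 \<noteq> j0" by auto
  have const: "f (ew i j) (ew i j) = f (ew i0 j0) (ew i0 j0)" if "i \<noteq> j" for i j
  proof (cases "i0 = j")
    case True
    have "f (ew i j) (ew i j) = f (ew i i0) (ew i i0)" by (simp add: True)
    also have "\<dots> = f (ew j0 i0) (ew j0 i0)" using that True ij0 by (intro step) auto
    also have "\<dots> = f (ew i0 j0) (ew i0 j0)" by (rule ew_sym)
    finally show ?thesis .
  next
    case False
    have "f (ew i j) (ew i j) = f (ew i0 j) (ew i0 j)" using that False by (intro step) auto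
    also have "\<dots> = f (ew j i0) (ew j i0)" by (rule ew_sym)
    also have "\<dots> = f (ew j0 i0) (ew j0 i0)" using False ij0 by (intro step) auto
    also have "\<dots> = f (ew i0 j0) (ew i0 j0)" by (rule ew_sym)
    finally show ?thesis .
  qed
  \<comment> \<open>\<open>wedge\<close> is not normalized: e_i wedge e_j has squared norm 2 in the
    tensor space.\<close>
  define c where "c = Re (f (ew i0 j0) (ew i0 j0)) / 2"
  have nz: "ew i0 j0 \<noteq> 0"
  proof
    assume "ew i0 j0 = 0"
    then have "ew i0 j0 $ (i0, j0) = 0" by simp
    then show False using ij0 by (simp add: ew_nth)
  qed
  have c: "f (ew i0 j0) (ew i0 j0) = of_real c * 2" "0 < c"
    using herm_on_real_pos[OF f wedge_ext2 nz] by (auto simp: c_def)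
  have cip_ew: "cip (ew i j) (ew k l) = ew i j $ (k, l) - ew i j $ (l, k)" for i j k l
  proof -
    have "cip (ew i j) (ew k l) = (\<Sum>a\<in>UNIV. \<Sum>b\<in>UNIV. (if b = l then (if a = k then ew i j $ (a, b) else 0) else 0) -
        (if b = k then (if a = l then ew i j $ (a, b) else 0) else 0))"
      unfolding cip_def sum_UNIV_prod ew_nth[of k l] by (intro sum.cong refl) auto
    then show ?thesis by (simp add: sum_subtractf)
  qed
  have "f b b' = of_real c * cip b b'"
    if "b \<in> {ew i j | i j. i \<noteq> j}" "b' \<in> {ew i j | i j. i \<noteq> j}" for b b'
  proof -
    obtain i j k l where b: "b = ew i j" "b' = ew k l" "i \<noteq> j" "k \<noteq> l" using \<open>b \<in> _\<close> \<open>b' \<in> _\<close> by blast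
    consider "{i, j} \<noteq> {k, l}" | "k = i" "l = j" | "k = j" "l = i" by (auto simp: doubleton_eq_iff)
    then show ?thesis
    proof cases
      case 1
      then have "cip b b' = 0" by (auto simp: b cip_ew ew_nth)
      then show ?thesis using off[of i j k l] 1 b by simp
    next
      case 2
      then have "cip b b' = 2" using b by (auto simp: cip_ew ew_nth)
      then show ?thesis using const[of i j] 2 b c(1) by simp
    next
      case 3
      then have "cip b b' = - 2" using b by (auto simp: cip_ew ew_nth)
      moreover have "f b b' = - f (ew i j) (ew i j)"
      proof -
        have "b' = - ew i j" unfolding b 3 by (rule wedge_simps(6))
        then show ?thesis using neg'[OF wedge_ext2 wedge_ext2] b(1) by (simp only:)
      qed
      ultimately show ?thesis using const[of i j] b c(1) by simp
    qed
  qed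
  then show ?thesis using c(2) by blast
qed

section \<open>The symplectic form on a hyperplane as a bivector\<close>

text \<open>The index type is arbitrary of the given size, so a pairing must be built, by removing
  two elements at a time. Opposite signs on partners make \<tau> free of fixed points.\<close>

lemma pairing_even:
  "finite S \<Longrightarrow> card S = 2 * n \<Longrightarrow> \<exists>(\<tau> :: 'a \<Rightarrow> 'a) (\<epsilon> :: 'a \<Rightarrow> complex).
     \<forall>i\<in>S. \<tau> i \<in> S \<and> \<tau> (\<tau> i) = i \<and> \<epsilon> (\<tau> i) = - \<epsilon> i \<and> (\<epsilon> i = 1 \<or> \<epsilon> i = - 1)"
proof (induction n arbitrary: S)
  case (Suc n)
  then have "card S = Suc (Suc (2 * n))" by simp
  then obtain x y S' where S: "S = insert x (insert y S')" "x \<noteq> y" "x \<notin> S'" "y \<notin> S'" "card S' = 2 * n"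
    by (auto simp: card_Suc_eq)
  then have "finite S'" using Suc.prems by simp
  then obtain \<tau> :: "'a \<Rightarrow> 'a" and \<epsilon> :: "'a \<Rightarrow> complex" where \<tau>: "\<forall>i\<in>S'. \<tau> i \<in> S' \<and> \<tau> (\<tau> i) = i \<and> \<epsilon> (\<tau> i) = - \<epsilon> i \<and> (\<epsilon> i = 1 \<or> \<epsilon> i = - 1)"
    using Suc.IH S(5) by blast
  show ?case
    using \<tau> S(2-4) unfolding S(1)
    by (intro exI[of _ "\<tau>(x := y, y := x)"] exI[of _ "\<epsilon>(x := 1, y := - 1)"]) auto
qed auto

lemma pairing_odd:
  assumes "CARD('m::finite) = 2 * n + 1"
  shows "\<exists>(o' :: 'm) \<tau> (\<epsilon> :: 'm \<Rightarrow> complex). \<tau> o' = o' \<and> \<epsilon> o' = 0 \<and> (\<forall>i. \<tau> (\<tau> i) = i) \<and> (\<forall>i. \<epsilon> (\<tau> i) = - \<epsilon> i) \<and>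
    (\<forall>i. i \<noteq> o' \<longrightarrow> \<epsilon> i = 1 \<or> \<epsilon> i = - 1)"
proof -
  obtain o' :: 'm where True by blast
  have "card (UNIV - {o'}) = 2 * n" using assms by simp
  from pairing_even[OF _ this] obtain \<tau> :: "'m \<Rightarrow> 'm" and \<epsilon> :: "'m \<Rightarrow> complex"
    where \<tau>: "\<forall>i\<in>UNIV - {o'}. \<tau> i \<in> UNIV - {o'} \<and> \<tau> (\<tau> i) = i \<and> \<epsilon> (\<tau> i) = - \<epsilon> i \<and> (\<epsilon> i = 1 \<or> \<epsilon> i = - 1)"
    by auto
  show ?thesis
    using \<tau> by (intro exI[of _ o'] exI[of _ "\<tau>(o' := o')"] exI[of _ "\<epsilon>(o' := 0)"]) auto
qed

text \<open>For the pairing of \<open>pairing_odd\<close> this is half the sum of all \<epsilon> i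
  times e_i wedge e_(\<tau> i).\<close>

definition pair_form :: "('m \<Rightarrow> 'm) \<Rightarrow> ('m \<Rightarrow> complex) \<Rightarrow> complex ^ ('m::finite \<times> 'm)" where
  "pair_form \<tau> \<epsilon> = (\<chi> p. if snd p = \<tau> (fst p) then \<epsilon> (fst p) else 0)"

lemma kron_der_mult_outer:
  "(kron_der (outer x y) *v T) $ (i, j) = x $ i * (\<Sum>a\<in>UNIV. cnj (y $ a) * T $ (a, j)) + x $ j * (\<Sum>b\<in>UNIV. cnj (y $ b) * T $ (i, b))"
  by (simp add: kron_der_mult_vec outer_def sum_distrib_left mult.assoc)

lemma kron_der_diff: "kron_der (A - B) = kron_der A - kron_der B"
  by (simp add: kron_der_def kron_def vec_eq_iff algebra_simps)

text \<open>Adjoint invariance of the generating family: conjugating by a unitary matrix moves the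
  orthonormal pair.\<close>

lemma rot_gen_intertwine:
  assumes "A \<in> SU"
  shows "rot_gen u v ** A = A ** rot_gen (adj A *v u) (adj A *v v)"
proof -
  have "A ** (X - Y) = A ** X - A ** Y" "(X - Y) ** A = X ** A - Y ** A" for X Y
    by (simp_all add: vec_eq_iff matrix_matrix_mult_def algebra_simps sum_subtractf)
  moreover have "A *v (adj A *v x) = x" for x by (simp add: matrix_vector_mul_assoc SU_D(2)[OF assms])
  ultimately show ?thesis
    by (simp add: rot_gen_def outer_mult mult_outer vec.scale)
qed

lemma SU_ext2_standard:
  fixes h :: "('m::finite \<times> 'm, 'm) vsum \<Rightarrow> ('m \<times> 'm, 'm) vsum \<Rightarrow> complex"
  assumes m: "CARD('m) = 2 * n + 1" "2 \<le> n" and ks: "0 < k" "0 < s"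
    and h: "invariant_product SU (dsum_rep ext2_rep std_rep) ext2 UNIV h"
  shows "admits_lagrangian_orbit SU (dsum_rep ext2_rep std_rep) ext2 UNIV h k s"
proof -
  note hc = invariant_components[OF h subspace_ext2 vec.subspace_UNIV]
  have zero: "ext2_rep A 0 = 0" "std_rep A 0 = 0" for A :: "complex ^ 'm ^ 'm"
    by (simp_all add: std_rep_def ext2_rep_eq)
  define B1 :: "(complex ^ ('m \<times> 'm)) set" where "B1 = {ew i j | i j. i \<noteq> j}"
  have m5: "5 \<le> CARD('m)" using m by simp
  have "\<exists>c>0. \<forall>b\<in>B1. \<forall>b'\<in>B1. h (b, 0) (b', 0) = of_real c * cip b b'"
    unfolding B1_def
  proof (rule herm_on_ext2[where f = "\<lambda>x y. h (x, 0) (y, 0)", OF m5 hc(1)[OF zero]])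
    fix g :: "complex ^ 'm ^ 'm" and x y :: "complex ^ ('m \<times> 'm)"
    assume "g \<in> SU" "x \<in> ext2" "y \<in> ext2"
    then show "h (kron g g *v x, 0) (kron g g *v y, 0) = h (x, 0) (y, 0)" using hc(3)[OF zero] by (simp add: ext2_rep_eq)
  qed
  then obtain c1 where c1: "0 < c1" "\<forall>b\<in>B1. \<forall>b'\<in>B1. h (b, 0) (b', 0) = of_real c1 * cip b b'" by blast
  obtain c2 where c2: "0 < c2" "\<forall>x y. h (0, x) (0, y) = of_real c2 * cip x y"
    using SU_invariant_form[OF hc(2)[OF zero]] hc(4)[OF zero] unfolding std_rep_def by blast
  have "invariant_product SU (dsum_rep ext2_rep std_rep) (vec.span B1) (vec.span (range (\<lambda>i. axis i 1))) h"
    unfolding B1_def ext2_span[symmetric] span_axis by (rule h)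
  note h_span = invariant_product_eq_hp[OF this, unfolded B1_def ext2_span[symmetric] span_axis]
  have h_eq: "h x y = hp c1 c2 x y" if "x \<in> ext2 \<times> UNIV" "y \<in> ext2 \<times> UNIV" for x y
  proof (rule h_span[OF _ _ that])
    fix b b' assume "b \<in> {ew i j | i j :: 'm. i \<noteq> j}" "b' \<in> {ew i j | i j :: 'm. i \<noteq> j}"
    then show "h (b, 0) (b', 0) = of_real c1 * cip b b'" using c1(2) unfolding B1_def by blast
  qed (simp add: c2(2))
  obtain o' :: 'm and \<tau> and \<epsilon> :: "'m \<Rightarrow> complex" where o: "\<tau> o' = o'" "\<epsilon> o' = 0" and \<tau>: "\<And>i. \<tau> (\<tau> i) = i"
    and \<epsilon>: "\<And>i. \<epsilon> (\<tau> i) = - \<epsilon> i" "\<And>i. i \<noteq> o' \<Longrightarrow> \<epsilon> i = 1 \<or> \<epsilon> i = - 1"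
    using pairing_odd[OF m(1)] by blast
  have \<tau>_eq: "\<tau> i = j \<longleftrightarrow> i = \<tau> j" for i j using \<tau> by metis
  have bij: "bij \<tau>" by (rule o_bij[of \<tau>]) (auto simp: \<tau>)
  have \<epsilon>2: "\<epsilon> i * cnj (\<epsilon> i) = (if i = o' then 0 else 1)" for i
    using \<epsilon>(2)[of i] o by auto
  define \<Omega> where "\<Omega> = pair_form \<tau> \<epsilon>"
  have \<Omega>: "\<Omega> $ (i, j) = (if j = \<tau> i then \<epsilon> i else 0)" for i j by (simp add: \<Omega>_def pair_form_def)
  have \<Omega>_ext2: "\<Omega> \<in> ext2"
    unfolding ext2_iff
  proof (intro allI)
    fix i j
    show "\<Omega> $ (i, j) + \<Omega> $ (j, i) = 0"
      using \<tau>_eq[of i j] \<epsilon>(1)[of i] unfolding \<Omega> by (cases "j = \<tau> i") auto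
  qed
  have kd: "(kron_der Y *v \<Omega>) $ (i, j) = - \<epsilon> j * Y $ i $ \<tau> j + \<epsilon> i * Y $ j $ \<tau> i" for Y i j
  proof -
    have "(\<Sum>a\<in>UNIV. Y $ i $ a * \<Omega> $ (a, j)) = (\<Sum>a\<in>UNIV. if a = \<tau> j then - \<epsilon> j * Y $ i $ a else 0)"
      by (intro sum.cong refl) (auto simp: \<Omega> \<tau> \<epsilon>)
    moreover have "(\<Sum>b\<in>UNIV. Y $ j $ b * \<Omega> $ (i, b)) = (\<Sum>b\<in>UNIV. if b = \<tau> i then \<epsilon> i * Y $ j $ b else 0)"
      by (intro sum.cong refl) (auto simp: \<Omega>)
    ultimately show ?thesis by (simp add: kron_der_mult_vec)
  qed
  have cip\<Omega>: "cip T \<Omega> = (\<Sum>i\<in>UNIV. T $ (i, \<tau> i) * cnj (\<epsilon> i))" for T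
  proof -
    have "cip T \<Omega> = (\<Sum>i\<in>UNIV. \<Sum>j\<in>UNIV. if j = \<tau> i then T $ (i, j) * cnj (\<epsilon> i) else 0)"
      unfolding cip_def sum_UNIV_prod by (intro sum.cong refl) (auto simp: \<Omega>)
    then show ?thesis by simp
  qed
  have "cip \<Omega> \<Omega> = (\<Sum>i\<in>UNIV. if i = o' then 0 else 1)"
    unfolding cip\<Omega> by (simp add: \<Omega> \<epsilon>2)
  also have "\<dots> = of_nat (card (UNIV - {o'}))"
    by (simp add: sum.If_cases Compl_eq_Diff_UNIV set_diff_eq)
  also have "card (UNIV - {o'}) = 2 * n" using m by simp
  finally have cip\<Omega>\<Omega>: "cip \<Omega> \<Omega> = of_real (2 * real n)" by simp
  then have norm\<Omega>: "(norm \<Omega>)\<^sup>2 = 2 * real n" unfolding cip_self of_real_eq_iff .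
  \<comment> \<open>\<Omega> has squared norm 2 n. With weight \<open>t\<close> its moment along
    \<open>Y\<close> is - 2 t times the \<open>o'\<close> diagonal entry of \<open>Y\<close>, so
    \<open>e\<close> needs weight 2 t to cancel it; the level condition then fixes
    \<open>t\<close>.\<close>
  define t where "t = 1 / (2 * (real k * real n + real s))"
  have t: "0 < t" "real k * (t * (2 * real n)) + real s * (2 * t) = 1"
  proof -
    have "0 < real k * real n + real s" using ks by (simp add: add_nonneg_pos)
    moreover have "real k * (t * (2 * real n)) + real s * (2 * t) = t * (2 * (real k * real n + real s))"
      by (simp add: algebra_simps)
    ultimately show "0 < t" "real k * (t * (2 * real n)) + real s * (2 * t) = 1"
      by (simp_all add: t_def)
  qed
  obtain a where a: "a \<noteq> 0" "cnj a = a" "of_real c1 * (a * a) = of_real t"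
    using real_scalar[OF c1(1) t(1)] by blast
  have "0 < 2 * t" using t(1) by simp
  then obtain b where b: "b \<noteq> 0" "cnj b = b" "of_real c2 * (b * b) = of_real (2 * t)"
    using real_scalar[OF c2(1)] by blast
  define e where "e = (axis o' 1 :: complex ^ 'm)"
  define p where "p = (a *s \<Omega>, b *s e)"
  define S where "S = {(kron_der (rot_gen u v), rot_gen u v) | u v :: complex ^ 'm. orthonormal u v}"
  have norm_e: "norm e = 1"
    by (simp add: e_def cip_self_eq_1[symmetric] cip_axis)
  have p: "fst p = a *s \<Omega>" "snd p = b *s axis o' 1" by (simp_all add: p_def e_def)
  have mom: "hp c1 c2 (act2 (kron_der (rot_gen u v)) (rot_gen u v) p) p = 0" if uv: "orthonormal u v" for u v
  proof -
    define Y where "Y = rot_gen u v"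
    have tr: "(\<Sum>i\<in>UNIV. Y $ i $ i) = 0"
    proof -
      have "(\<Sum>i\<in>UNIV. Y $ i $ i) = \<i> * cip u u - \<i> * cip v v"
        by (simp add: Y_def rot_gen_def outer_def cip_def sum_subtractf sum_distrib_left mult.assoc)
      then show ?thesis by (simp add: orthonormalD[OF uv])
    qed
    \<comment> \<open>Both sums run over the diagonal entries outside \<open>o'\<close>, the second
      after reindexing by \<tau>. As the trace vanishes, each is minus the \<open>o'\<close>
      entry.\<close>
    have "cip (kron_der Y *v \<Omega>) \<Omega> = (\<Sum>i\<in>UNIV. \<epsilon> i * cnj (\<epsilon> i) * Y $ i $ i) + (\<Sum>i\<in>UNIV. \<epsilon> i * cnj (\<epsilon> i) * Y $ \<tau> i $ \<tau> i)"
      unfolding cip\<Omega> kd sum.distrib[symmetric] by (intro sum.cong refl) (simp add: \<tau> \<epsilon> algebra_simps)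
    also have "(\<Sum>i\<in>UNIV. \<epsilon> i * cnj (\<epsilon> i) * Y $ \<tau> i $ \<tau> i) = (\<Sum>i\<in>UNIV. \<epsilon> (\<tau> i) * cnj (\<epsilon> (\<tau> i)) * Y $ \<tau> i $ \<tau> i)"
      by (simp add: \<epsilon>)
    also have "\<dots> = (\<Sum>i\<in>UNIV. \<epsilon> i * cnj (\<epsilon> i) * Y $ i $ i)"
      by (rule sum.reindex_bij_betw[OF bij])
    also have "(\<Sum>i\<in>UNIV. \<epsilon> i * cnj (\<epsilon> i) * Y $ i $ i) = (\<Sum>i\<in>UNIV. Y $ i $ i - (if i = o' then Y $ i $ i else 0))"
      unfolding \<epsilon>2 by (intro sum.cong refl) simp
    also have "\<dots> = - Y $ o' $ o'" by (simp add: sum_subtractf tr)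
    finally have 1: "cip (kron_der Y *v \<Omega>) \<Omega> = - (2 * Y $ o' $ o')" by simp
    have 2: "cip (Y *v e) e = Y $ o' $ o'"
      unfolding e_def cip_axis by (simp add: matrix_vector_mult_def axis_def if_distrib cong: if_cong)
    have "hp c1 c2 (act2 (kron_der Y) Y p) p = of_real t * cip (kron_der Y *v \<Omega>) \<Omega> + of_real (2 * t) * cip (Y *v e) e"
      by (simp only: p_def act2_def fst_conv snd_conv vec.scale hp_scaled[OF a(2,3) b(2,3)])
    also have "\<dots> = 0" by (simp add: 1 2)
    finally show ?thesis by (simp add: Y_def)
  qed
  have ku: "adj (kron A A) ** kron A A = mat 1" if "A \<in> SU" for A :: "complex ^ 'm ^ 'm"
    using SU_D(1)[OF that] by (simp add: adj_kron kron_mult kron_1)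
  have "isotropic_orbit SU ext2_rep std_rep (\<lambda>A. kron A A) (\<lambda>A. A) ext2 UNIV h c1 c2 k s S p"
  proof (rule isotropic_orbit.intro)
    show "vec.subspace (ext2 :: (complex ^ ('m \<times> 'm)) set)" by (rule subspace_ext2)
    show "p \<in> ext2 \<times> UNIV" using \<Omega>_ext2 by (auto simp: p_def intro: vec.subspace_scale[OF subspace_ext2])
  next
    fix X1 X2 assume "(X1, X2) \<in> S"
    then obtain u v where uv: "orthonormal u v" and X: "X1 = kron_der (rot_gen u v)" "X2 = rot_gen u v"
      by (auto simp: S_def)
    have kr: "((\<lambda>r. kron (rot u v r) (rot u v r)) has_vector_derivative kron_der (rot_gen u v)) (at 0)"
      using bounded_bilinear.has_vector_derivative[OF bounded_bilinear_kron rot_has_vector_derivative rot_has_vector_derivative, of u v u v]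
      by (simp add: rot_0 kron_der_def add.commute)
    show "\<exists>\<gamma>::real \<Rightarrow> _. (\<forall>r. \<gamma> r \<in> SU) \<and> \<gamma> 0 = mat 1 \<and>
        ((\<lambda>r. kron (\<gamma> r) (\<gamma> r)) has_vector_derivative X1) (at 0) \<and> (\<gamma> has_vector_derivative X2) (at 0)"
      unfolding X by (intro exI[of _ "rot u v"] conjI allI rot_SU uv rot_0 rot_has_vector_derivative kr)
    fix g assume g: "(g :: complex ^ 'm ^ 'm) \<in> SU"
    \<comment> \<open>Moving the generator past \<open>g\<close> replaces it by a conjugate from the
      same family, so vanishing at \<open>p\<close> suffices.\<close>
    define u' v' where "u' = adj g *v u" and "v' = adj g *v v"
    have uv': "orthonormal u' v'"
      using uv cip_unitary[OF SU_D(1)[OF adj_SU[OF g]]] by (simp add: orthonormal_def u'_def v'_def)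
    define q where "q = act2 (kron_der (rot_gen u' v')) (rot_gen u' v') p"
    have I: "rot_gen u v ** g = g ** rot_gen u' v'" unfolding u'_def v'_def by (rule rot_gen_intertwine[OF g])
    have "act2 X1 X2 (act2 (kron g g) g p) = act2 (kron g g) g q"
      using I kron_der_intertwine[OF I] by (simp add: X q_def act2_def matrix_vector_mul_assoc)
    moreover have "hp c1 c2 (act2 (kron g g) g q) (act2 (kron g g) g p) = hp c1 c2 q p"
      by (simp add: hp_def act2_def cip_unitary[OF ku[OF g]] cip_unitary[OF SU_D(1)[OF g]])
    ultimately show "hp c1 c2 (act2 X1 X2 (act2 (kron g g) g p)) (act2 (kron g g) g p) = 0"
      using mom[OF uv'] by (simp add: q_def)
  next
    fix C :: "('m \<times> 'm, 'm) vsum set"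
    assume C: "csub C" and cv: "circ_vel k s p \<in> C" and SC: "\<And>X1 X2. (X1, X2) \<in> S \<Longrightarrow> act2 X1 X2 p \<in> C"
    define \<Phi> :: "complex ^ 'm \<Rightarrow> complex ^ 'm \<Rightarrow> ('m \<times> 'm, 'm) vsum" where
      "\<Phi> = (\<lambda>x y. (kron_der (outer x y) *v fst p, cip (snd p) y *s x))"
    have \<Phi>: "sesq \<Phi>"
      unfolding sesq_def \<Phi>_def cscale_def
      by (simp add: vec_eq_iff split_paired_all kron_der_mult_outer cip_simps algebra_simps sum.distrib sum_distrib_left)
    have rot: "cscale \<i> (\<Phi> u u - \<Phi> v v) \<in> C" if "orthonormal u v" for u v
    proof -
      have "(kron_der (rot_gen u v), rot_gen u v) \<in> S" using that by (auto simp: S_def)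
      from SC[OF this] have "(kron_der (rot_gen u v) *v fst p, rot_gen u v *v snd p) \<in> C"
        by (simp add: act2_def)
      moreover have "kron_der (rot_gen u v) *v fst p = \<i> *s (kron_der (outer u u) *v fst p - kron_der (outer v v) *v fst p)"
        unfolding rot_gen_def kron_der_diff matrix_vector_mult_diff_rdistrib
        by (simp add: vec_eq_iff split_paired_all kron_der_mult_outer algebra_simps)
      ultimately show ?thesis
        by (simp add: \<Phi>_def cscale_def rot_gen_mult_vec vector_smult_assoc vec_eq_iff algebra_simps)
    qed
    note mem = sesq_orthonormal_mem[OF \<Phi> C rot orthonormal_axis]
    have ax: "axis i (1 :: complex) $ j = (if i = j then 1 else 0)" for i j :: 'm by (simp add: axis_def)
    have kE: "kron_der (outer (axis i 1) (axis j 1)) *v \<Omega> = \<epsilon> j *s ew i (\<tau> j)" for i j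
    proof -
      have "(kron_der (outer (axis i 1) (axis j 1)) *v \<Omega>) $ (c, d) = (\<epsilon> j *s ew i (\<tau> j)) $ (c, d)" for c d
      proof -
        have A: "\<epsilon> d * cnj (axis j 1 $ \<tau> d) = (if d = \<tau> j then - \<epsilon> j else 0)" for d
          using \<tau>_eq[of d j] \<epsilon>(1)[of j] by (cases "d = \<tau> j") (simp_all add: ax)
        have "(kron_der (outer (axis i 1) (axis j 1)) *v \<Omega>) $ (c, d) =
          - (axis i 1 $ c * (\<epsilon> d * cnj (axis j 1 $ \<tau> d))) + axis i 1 $ d * (\<epsilon> c * cnj (axis j 1 $ \<tau> c))"
          unfolding kd by (simp add: outer_def)
        also have "\<dots> = (\<epsilon> j *s ew i (\<tau> j)) $ (c, d)"
          unfolding A vector_smult_component ew_nth ax[of i] by (cases "c = i"; cases "d = i"; simp)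
        finally show ?thesis .
      qed
      then show ?thesis unfolding vec_eq_iff split_paired_All by blast
    qed
    have \<Phi>E: "\<Phi> (axis i 1) (axis j 1) = ((a * \<epsilon> j) *s ew i (\<tau> j), (if j = o' then b else 0) *s axis i 1)" for i j
      by (simp add: \<Phi>_def p vec.scale kE vector_smult_assoc cip_simps cip_axis ax)
    have \<epsilon>0: "\<epsilon> i \<noteq> 0" if "i \<noteq> o'" for i using \<epsilon>(2)[OF that] by auto
    \<comment> \<open>Column \<open>o'\<close> of the matrix does not see \<Omega>, since \<epsilon>
      vanishes there.\<close>
    have 1: "(0, axis i 1) \<in> C" if i: "i \<noteq> o'" for i
    proof (rule csub_unscale[OF C _ b(1)])
      show "cscale b (0, axis i 1) \<in> C" using mem(1)[of i o'] i by (simp add: \<Phi>E o cscale_def)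
    qed
    \<comment> \<open>The elementary matrix with row \<open>i\<close> and column \<tau> l sends
      \<Omega> to a multiple of e_i wedge e_l and kills \<open>e\<close>. For i = \<tau> l it is
      diagonal and not traceless, so those bivectors have to wait for \<open>4\<close>.\<close>
    have 2: "(ew i l, 0) \<in> C" if il: "l \<noteq> o'" "i \<noteq> \<tau> l" for i l
    proof (rule csub_unscale[OF C, of "a * \<epsilon> (\<tau> l)"])
      have l: "\<tau> l \<noteq> o'" using il o \<tau> by metis
      show "cscale (a * \<epsilon> (\<tau> l)) (ew i l, 0) \<in> C" using mem(1)[of i "\<tau> l"] il l by (simp add: \<Phi>E cscale_def \<tau>)
      show "a * \<epsilon> (\<tau> l) \<noteq> 0" using \<epsilon>0[OF l] a(1) by simp
    qed
    have diag: "((a * \<epsilon> i) *s ew i (\<tau> i), - (b *s axis o' 1)) \<in> C" if "i \<noteq> o'" for i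
      using mem(2)[of i o'] that by (simp add: \<Phi>E o)
    have sumC: "(\<Sum>i\<in>F. f i) \<in> C" if "finite F" "\<And>i. i \<in> F \<Longrightarrow> f i \<in> C" for F and f :: "'m \<Rightarrow> _"
      using that by (induction rule: finite_induct) (auto intro: csubD[OF C])
    \<comment> \<open>The sum over the 2 n indices meets each pair from both ends with equal
      contributions, hence the half. The result is \<open>p\<close> with ratio m = n.\<close>
    have "cscale (1 / 2) (\<Sum>i\<in>UNIV - {o'}. ((a * \<epsilon> i) *s ew i (\<tau> i), - (b *s axis o' 1))) \<in> C"
      by (intro csubD(3)[OF C] sumC diag) auto
    also have "(\<Sum>i\<in>UNIV - {o'}. ((a * \<epsilon> i) *s ew i (\<tau> i), - (b *s axis o' 1))) =
      cscale 2 (fst p, - (of_real (real n) *s snd p))"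
    proof -
      have "(\<Sum>i\<in>UNIV - {o'}. (a * \<epsilon> i) *s ew i (\<tau> i)) $ (c, d) = (2 *s (a *s \<Omega>)) $ (c, d)" for c d
      proof -
        have "(\<Sum>i\<in>UNIV - {o'}. (a * \<epsilon> i) *s ew i (\<tau> i)) = (\<Sum>i\<in>UNIV. (a * \<epsilon> i) *s ew i (\<tau> i))"
          by (rule sum.mono_neutral_left) (auto simp: o)
        also have "\<dots> $ (c, d) = (\<Sum>i\<in>UNIV. (if i = c then a * \<Omega> $ (c, d) else 0) - (if i = d then a * \<Omega> $ (d, c) else 0))"
          unfolding sum_component vector_smult_component ew_nth by (intro sum.cong refl) (auto simp: \<Omega>)
        also have "\<dots> = a * \<Omega> $ (c, d) - a * \<Omega> $ (d, c)" by (simp add: sum_subtractf)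
        also have "\<Omega> $ (d, c) = - \<Omega> $ (c, d)" by (rule ext2D[OF \<Omega>_ext2])
        finally show ?thesis by simp
      qed
      then have 1: "(\<Sum>i\<in>UNIV - {o'}. (a * \<epsilon> i) *s ew i (\<tau> i)) = 2 *s fst p"
        unfolding vec_eq_iff split_paired_All p by blast
      have 2: "(\<Sum>i\<in>UNIV - {o'}. - (b *s axis o' 1)) = 2 *s (- (of_real (real n) *s snd p))"
        unfolding vec_eq_iff sum_component using m by (simp add: p)
      have "(\<Sum>i\<in>UNIV - {o'}. ((a * \<epsilon> i) *s ew i (\<tau> i), - (b *s axis o' 1))) =
        (\<Sum>i\<in>UNIV - {o'}. (a * \<epsilon> i) *s ew i (\<tau> i), \<Sum>i\<in>UNIV - {o'}. - (b *s axis o' 1))"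
        by (simp add: prod_eq_iff fst_sum snd_sum)
      then show ?thesis unfolding 1 2 by (simp add: cscale_def)
    qed
    finally have "(fst p, - (of_real (real n) *s snd p)) \<in> C" by (simp add: cscale_simps)
    from csub_split[OF C this csub_circ_vel[OF C cv]] ks
    have "(0, snd p) \<in> C" by (simp add: add_nonneg_eq_0_iff)
    then have bo: "(0, b *s axis o' 1) \<in> C" by (simp only: p)
    then have "cscale b (0, axis o' 1) \<in> C" by (simp add: cscale_def)
    then have 3: "(0, axis o' 1) \<in> C" by (rule csub_unscale[OF C _ b(1)])
    \<comment> \<open>With e_(o') now available in the second summand, the diagonal relations can be
      cleared of it.\<close>
    have 4: "(ew i (\<tau> i), 0) \<in> C" if i: "i \<noteq> o'" for i
    proof (rule csub_unscale[OF C, of "a * \<epsilon> i"])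
      have "((a * \<epsilon> i) *s ew i (\<tau> i), - (b *s axis o' 1)) + (0, b *s axis o' 1) \<in> C"
        by (intro csubD[OF C] diag[OF i] bo)
      then show "cscale (a * \<epsilon> i) (ew i (\<tau> i), 0) \<in> C" by (simp add: cscale_def)
      show "a * \<epsilon> i \<noteq> 0" using \<epsilon>0[OF i] a(1) by simp
    qed
    have all1: "(ew i l, 0) \<in> C" if "i \<noteq> l" for i l
    proof (cases "l = o'")
      case True
      have "(ew l i, 0) \<in> C"
      proof (rule 2)
        show "i \<noteq> o'" using that True by simp
        then show "l \<noteq> \<tau> i" using True o \<tau> by metis
      qed
      then have "cscale (- 1) (ew l i, 0) \<in> C" by (rule csubD[OF C])
      moreover have "cscale (- 1) (ew l i, 0) = (ew i l, 0 :: complex ^ 'm)"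
        using wedge_simps(6)[of "axis i 1" "axis l 1"] by (simp add: cscale_def)
      ultimately show ?thesis by (simp only:)
    next
      case False
      show ?thesis
      proof (cases "i = \<tau> l")
        case True
        have "i \<noteq> o'" using False True o \<tau> by metis
        then have "(ew i (\<tau> i), 0) \<in> C" by (rule 4)
        then show ?thesis by (simp add: True \<tau>)
      qed (use 2 False in blast)
    qed
    have all2: "(0, axis i 1) \<in> C" for i
      using 1 3 by (cases "i = o'") auto
    have "vec.span {ew i j | i j :: 'm. i \<noteq> j} \<times> vec.span (range (\<lambda>i. axis i 1)) \<subseteq> C"
      using all1 all2 by (intro csub_Times[OF C]) auto
    then show "ext2 \<times> UNIV \<subseteq> C" by (simp only: span_axis ext2_span)
  qed (use ks c1(1) c2(1) h_eq a b t m norm_scaled[OF a(2,3), of \<Omega>] norm_scaled[OF b(2,3), of e] norm\<Omega> norm_e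
      in \<open>auto simp: p_def std_rep_def ext2_rep_eq mat1_SU mult_SU SU_inv kron_1 kron_mult SU_D ku kron_ext2\<close>)
  then show ?thesis by (rule isotropic_orbit.lagrangian_orbit)
qed

theorem mainTheorem10:
  fixes k s :: nat
  assumes "0 < k" and "0 < s" and "k \<noteq> s"
  shows
    "(2 \<le> CARD('n) \<longrightarrow>
       (\<forall>h. invariant_product (SU :: (complex ^ 'n::finite ^ 'n) set)
               (dsum_rep std_rep dual_rep) UNIV UNIV h \<longrightarrow>
            admits_lagrangian_orbit (SU :: (complex ^ 'n ^ 'n) set)
               (dsum_rep std_rep dual_rep) UNIV UNIV h k s)) \<and>
     (\<forall>n\<ge>2. CARD('m) = 2 * n + 1 \<longrightarrow>
       (\<forall>h. invariant_product (SU :: (complex ^ 'm::finite ^ 'm) set)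
               (dsum_rep ext2_rep std_rep) ext2 UNIV h \<longrightarrow>
            admits_lagrangian_orbit (SU :: (complex ^ 'm ^ 'm) set)
               (dsum_rep ext2_rep std_rep) ext2 UNIV h k s)) \<and>
     (\<forall>h. invariant_product (Sp :: (complex ^ ('q::finite + 'q) ^ ('q + 'q)) set)
             (dsum_rep std_rep std_rep) UNIV UNIV h \<longrightarrow>
          admits_lagrangian_orbit (Sp :: (complex ^ ('q + 'q) ^ ('q + 'q)) set)
             (dsum_rep std_rep std_rep) UNIV UNIV h k s) \<and>
     (\<forall>half h. invariant_product Spin10
             (dsum_rep std_rep std_rep) (half_spin half) (half_spin half) h \<longrightarrow>
          admits_lagrangian_orbit Spin10
             (dsum_rep std_rep std_rep) (half_spin half) (half_spin half) h k s)"
proof (intro conjI impI allI)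
  fix h :: "('n, 'n) vsum \<Rightarrow> ('n, 'n) vsum \<Rightarrow> complex"
  assume "2 \<le> CARD('n)" "invariant_product SU (dsum_rep std_rep dual_rep) UNIV UNIV h"
  then show "admits_lagrangian_orbit SU (dsum_rep std_rep dual_rep) UNIV UNIV h k s"
    using assms(1,2) by (intro SU_standard_dual)
next
  fix n and h :: "('m \<times> 'm, 'm) vsum \<Rightarrow> ('m \<times> 'm, 'm) vsum \<Rightarrow> complex"
  assume "2 \<le> n" "CARD('m) = 2 * n + 1" "invariant_product SU (dsum_rep ext2_rep std_rep) ext2 UNIV h"
  then show "admits_lagrangian_orbit SU (dsum_rep ext2_rep std_rep) ext2 UNIV h k s"
    using assms(1,2) by (intro SU_ext2_standard)
next
  fix h :: "('q + 'q, 'q + 'q) vsum \<Rightarrow> ('q + 'q, 'q + 'q) vsum \<Rightarrow> complex"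
  assume "invariant_product Sp (dsum_rep std_rep std_rep) UNIV UNIV h"
  then show "admits_lagrangian_orbit Sp (dsum_rep std_rep std_rep) UNIV UNIV h k s"
    using assms(1,2) by (intro Sp_standard_standard)
next
  fix half h
  assume "invariant_product Spin10 (dsum_rep std_rep std_rep) (half_spin half) (half_spin half) h"
  then show "admits_lagrangian_orbit Spin10 (dsum_rep std_rep std_rep) (half_spin half) (half_spin half) h k s"
    using assms(1,2) by (intro Spin10_half_spin_half_spin)
qed

end
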